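(* Let $R=S^G$ be the invariant subring of $S=\Bbbk[[x,y]]$ under the cyclic group $G=\frac1n(1,a)$, with $i$-series $(i_1,\dots,i_r)$. Let $t\in\{0,1,\dots,n-1\}$, and let $(d_{1,t},\dots,d_{r,t})$ be the sequence of non-negative integers obtained from $t$ by successive division by $i_1,\dots,i_r$, so that $t=d_{1,t}i_1+\cdots+d_{r,t}i_r$. Then $M_t$ is an Ulrich $R$-module if and only if $$d_{1,t}+d_{2,t}+\cdots+d_{r,t}=\mathrm{e}(R)-1,$$ where $\mathrm{e}(R)$ is the multiplicity of $R$ with respect to its maximal ideal.
   Context: $\Bbbk$ is an algebraically closed field; $n,a$ are integers with $1\le a\le n-1$, $\gcd(a,n)=1$, and $n$ is invertible in $\Bbbk$. $\frac1n(1,a)$ denotes the cyclic group generated by $\sigma=\mathrm{diag}(\zeta_n,\zeta_n^a)$, $\zeta_n$ a primitive $n$-th root of unity, acting on $S=\Bbbk[[x,y]]$ by $x\mapsto\zeta_n x$, $y\mapsto\zeta_n^a y$. $R=S^G$ is a local ring with maximal ideal $\mathfrak m$. For an integer $t$, $M_t\subset S$ is the $R$-submodule generated by the monomials $x^iy^j$ with $i+ja\equiv t \pmod n$; $M_0=R$, and $M_0,\dots,M_{n-1}$ are, up to isomorphism, exactly the indecomposable maximal Cohen-Macaulay (MCM) $R$-modules, pairwise non-isomorphic and of rank one. Ulrich module: an MCM $R$-module $M$ is Ulrich if $\mu_R(M)=\mathrm{e}_{\mathfrak m}(M)$, where $\mu_R(M)=\dim_\Bbbk M/\mathfrak mM$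 is the minimal number of generators and $\mathrm{e}_{\mathfrak m}(M)$ is the multiplicity of $M$ with respect to $\mathfrak m$. Write $\mathrm{e}(R)=\mathrm{e}_{\mathfrak m}(R)$. $i$-series: write the Hirzebruch-Jung continued fraction $n/a=[\alpha_1,\dots,\alpha_r]=\alpha_1-\cfrac{1}{\alpha_2-\cfrac{1}{\cdots-\frac{1}{\alpha_r}}}$ with integers $\alpha_u\ge2$. Put $i_0=n$, $i_1=a$, $i_u=\alpha_{u-1}i_{u-1}-i_{u-2}$ for $u=2,\dots,r+1$; then $i_1>i_2>\cdots>i_r=1$, $i_{r+1}=0$. The $i$-series is $(i_1,\dots,i_r)$. An MCM module $M$ is called special if $(M\otimes_R\omega_R)/\mathrm{tor}$ is also MCM ($\omega_R$ the canonical module, tor the torsion submodule); $M_{i_1},\dots,M_{i_r}$ are exactly the non-free indecomposable special modules (Wunram). Division: for $t\in\{0,\dots,n-1\}$, the $d_{u,t}\in\mathbb Z_{\ge0}$ are defined by $t=d_{1,t}i_1+h_{1,t}$ with $0\le h_{1,t}<i_1$, and $h_{u,t}=d_{u+1,t}i_{u+1}+h_{u+1,t}$ with $0\le h_{u+1,t}<i_{u+1}$ for $u=1,\dots,r-1$ (all $h_{u,t}$ integers, and $h_{r,t}=0$). *)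

theory Defs
  imports
    Complex_Main
    "HOL-Library.Extended_Nat"
    "HOL-Number_Theory.Cong"
    "HOL-Computational_Algebra.Polynomial"
    "HOL-Computational_Algebra.Formal_Power_Series"
    "HOL-Algebra.Ideal_Product"
    "Jordan_Normal_Form.Missing_VectorSpace"
begin

section \<open>Commutative algebra over HOL-Algebra rings and modules\<close>

definition krull_dim :: "('a, 'b) ring_scheme \<Rightarrow> enat" where
  "krull_dim R = Sup (enat ` {k. \<exists>P :: nat \<Rightarrow> 'a set.
     (\<forall>i\<le>k. primeideal (P i) R) \<and> (\<forall>i<k. P i \<subset> P (Suc i))})"

text \<open>The maximal ideal of a local ring.\<close>
definition max_ideal :: "('a, 'b) ring_scheme \<Rightarrow> 'a set" where
  "max_ideal R = (THE \<mm>. maximalideal \<mm> R)"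

definition ideal_power :: "('a, 'b) ring_scheme \<Rightarrow> 'a set \<Rightarrow> nat \<Rightarrow> 'a set" where
  "ideal_power R I k = (ideal_prod R I ^^ k) (carrier R)"

text \<open>The submodule \<open>IM\<close>.\<close>
definition ideal_smult ::
    "('a, 'b) ring_scheme \<Rightarrow> 'a set \<Rightarrow> ('a, 'c, 'd) module_scheme \<Rightarrow> 'c set" where
  "ideal_smult R I M = module.span R M {r \<odot>\<^bsub>M\<^esub> x | r x. r \<in> I \<and> x \<in> carrier M}"

text \<open>The quotient \<open>M/N\<close>. The ring multiplication and unit that every module record carries
  play no role.\<close>
definition quot_module ::
    "('a, 'c, 'd) module_scheme \<Rightarrow> 'c set \<Rightarrow> ('a, 'c set) module" where
  "quot_module M N = \<lparr>carrier = a_rcosets\<^bsub>M\<^esub> N, monoid.mult = (\<lambda>A B. N), one = N,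
     ring.zero = N, add = set_add M, module.smult = (\<lambda>r A. \<Union>x\<in>A. N +>\<^bsub>M\<^esub> (r \<odot>\<^bsub>M\<^esub> x))\<rparr>"

lemma submodule_abelian_subgroup:
  assumes "module R M" "submodule R N M"
  shows "abelian_subgroup N M"
proof -
  interpret M: Module.module R M by (rule assms)
  interpret N: submodule R N M by (rule assms)
  have "N \<noteq> {}"
    using N.zero_closed by blast
  then show ?thesis
    by (intro abelian_subgroupI3)
      (use M.abelian_group_axioms N.subset
          N.smult_closed[of "\<ominus>\<^bsub>R\<^esub> \<one>\<^bsub>R\<^esub>"] M.smult_l_minus[of "\<one>\<^bsub>R\<^esub>"] in
        \<open>auto intro!: additive_subgroup.intro M.add.subgroupI
           simp flip: a_inv_def simp: subset_iff\<close>)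
qed

lemma quot_module_smult_coset:
  assumes "module R M" "submodule R N M" "r \<in> carrier R" "x \<in> carrier M"
  shows "r \<odot>\<^bsub>quot_module M N\<^esub> (N +>\<^bsub>M\<^esub> x) = N +>\<^bsub>M\<^esub> (r \<odot>\<^bsub>M\<^esub> x)"
proof -
  interpret M: Module.module R M by (rule assms)
  interpret N: submodule R N M by (rule assms)
  interpret A: abelian_subgroup N M
    using assms(1,2) by (rule submodule_abelian_subgroup)
  have "N +>\<^bsub>M\<^esub> (r \<odot>\<^bsub>M\<^esub> y) = N +>\<^bsub>M\<^esub> (r \<odot>\<^bsub>M\<^esub> x)" if "y \<in> N +>\<^bsub>M\<^esub> x" for y
  proof -
    from that obtain h where h: "h \<in> N" "y = h \<oplus>\<^bsub>M\<^esub> x"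
      by (auto simp: a_r_coset_def')
    then have "r \<odot>\<^bsub>M\<^esub> y \<in> N +>\<^bsub>M\<^esub> (r \<odot>\<^bsub>M\<^esub> x)"
      using assms N.smult_closed[of r h] N.subset
      by (auto simp: a_r_coset_def' M.smult_r_distr subset_iff)
    then show ?thesis
      using A.a_repr_independence'[of "r \<odot>\<^bsub>M\<^esub> y" "r \<odot>\<^bsub>M\<^esub> x"] assms by simp
  qed
  then have "(\<Union>y\<in>N +>\<^bsub>M\<^esub> x. N +>\<^bsub>M\<^esub> (r \<odot>\<^bsub>M\<^esub> y)) = (\<Union>y\<in>N +>\<^bsub>M\<^esub> x. N +>\<^bsub>M\<^esub> (r \<odot>\<^bsub>M\<^esub> x))"
    by (intro SUP_cong refl)
  moreover have "N +>\<^bsub>M\<^esub> x \<noteq> {}"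
    using A.a_rcos_self[of x] assms by blast
  ultimately show ?thesis
    by (simp add: quot_module_def)
qed

lemma quot_module_is_module:
  assumes "module R M" "submodule R N M"
  shows "module R (quot_module M N)"
proof -
  interpret M: Module.module R M by (rule assms)
  interpret N: submodule R N M by (rule assms)
  interpret A: abelian_subgroup N M
    using assms(1,2) by (rule submodule_abelian_subgroup)
  have carr: "A \<in> carrier (quot_module M N) \<longleftrightarrow> (\<exists>x\<in>carrier M. A = N +>\<^bsub>M\<^esub> x)" for A
    by (auto simp: quot_module_def A_RCOSETS_def')
  have add: "(N +>\<^bsub>M\<^esub> x) \<oplus>\<^bsub>quot_module M N\<^esub> (N +>\<^bsub>M\<^esub> y) = N +>\<^bsub>M\<^esub> (x \<oplus>\<^bsub>M\<^esub> y)"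
    if "x \<in> carrier M" "y \<in> carrier M" for x y
    using A.a_rcos_sum that by (simp add: quot_module_def)
  have zero: "\<zero>\<^bsub>quot_module M N\<^esub> = N +>\<^bsub>M\<^esub> \<zero>\<^bsub>M\<^esub>"
    using M.a_coset_add_zero[OF A.a_subset] by (simp add: quot_module_def)
  have "abelian_group (quot_module M N)"
  proof (rule abelian_groupI)
    fix A assume "A \<in> carrier (quot_module M N)"
    then obtain x where x: "x \<in> carrier M" "A = N +>\<^bsub>M\<^esub> x"
      by (auto simp: carr)
    then show "\<exists>B\<in>carrier (quot_module M N). B \<oplus>\<^bsub>quot_module M N\<^esub> A = \<zero>\<^bsub>quot_module M N\<^esub>"
      by (intro bexI[of _ "N +>\<^bsub>M\<^esub> (\<ominus>\<^bsub>M\<^esub> x)"]) (auto simp: carr add zero M.l_neg)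
  next
    fix A B assume "A \<in> carrier (quot_module M N)" "B \<in> carrier (quot_module M N)"
    then show "A \<oplus>\<^bsub>quot_module M N\<^esub> B \<in> carrier (quot_module M N)"
      by (force simp: carr add)
  next
    fix A B assume "A \<in> carrier (quot_module M N)" "B \<in> carrier (quot_module M N)"
    then show "A \<oplus>\<^bsub>quot_module M N\<^esub> B = B \<oplus>\<^bsub>quot_module M N\<^esub> A"
      by (auto simp: carr add M.a_comm)
  qed (auto simp: carr add zero M.a_assoc)
  then show ?thesis
    by (intro moduleI)
      (auto simp: carr add quot_module_smult_coset[OF assms] M.R.is_cring M.smult_l_distr
        M.smult_r_distr M.smult_assoc1)
qed

definition module_length :: "('a, 'b) ring_scheme \<Rightarrow> ('a, 'c, 'd) module_scheme \<Rightarrow> enat" where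
  "module_length R M = Sup (enat ` {k. \<exists>N :: nat \<Rightarrow> 'c set.
     (\<forall>i\<le>k. submodule R (N i) M) \<and> (\<forall>i<k. N i \<subset> N (Suc i))})"

definition finitely_generated :: "('a, 'b) ring_scheme \<Rightarrow> ('a, 'c, 'd) module_scheme \<Rightarrow> bool" where
  "finitely_generated R M \<longleftrightarrow>
     (\<exists>A. finite A \<and> A \<subseteq> carrier M \<and> module.span R M A = carrier M)"

definition nonzerodivisor_on :: "'a \<Rightarrow> ('a, 'c, 'd) module_scheme \<Rightarrow> bool" where
  "nonzerodivisor_on f M \<longleftrightarrow>
     (\<forall>x\<in>carrier M. f \<odot>\<^bsub>M\<^esub> x = \<zero>\<^bsub>M\<^esub> \<longrightarrow> x = \<zero>\<^bsub>M\<^esub>)"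

definition regular_sequence ::
    "('a, 'b) ring_scheme \<Rightarrow> ('a, 'c, 'd) module_scheme \<Rightarrow> 'a list \<Rightarrow> bool" where
  "regular_sequence R M fs \<longleftrightarrow> set fs \<subseteq> carrier R \<and>
     (\<forall>i<length fs. nonzerodivisor_on (fs ! i)
        (quot_module M (ideal_smult R (Idl\<^bsub>R\<^esub> (set (take i fs))) M))) \<and>
     ideal_smult R (Idl\<^bsub>R\<^esub> (set fs)) M \<noteq> carrier M"

definition depth :: "('a, 'b) ring_scheme \<Rightarrow> ('a, 'c, 'd) module_scheme \<Rightarrow> enat" where
  "depth R M = Sup ((\<lambda>fs. enat (length fs)) `
     {fs. regular_sequence R M fs \<and> set fs \<subseteq> max_ideal R})"

definition maximal_Cohen_Macaulay ::
    "('a, 'b) ring_scheme \<Rightarrow> ('a, 'c, 'd) module_scheme \<Rightarrow> bool" where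
  "maximal_Cohen_Macaulay R M \<longleftrightarrow>
     module R M \<and> finitely_generated R M \<and> depth R M = krull_dim R"

text \<open>The Hilbert-Samuel multiplicity \<open>e\<^sub>I(M) = lim d! \<ell>(M/I\<^sup>kM) / k\<^sup>d\<close>, normalised by
  \<open>d = dim R\<close>, which is also the dimension of every nonzero maximal Cohen-Macaulay module.\<close>
definition multiplicity_module ::
    "('a, 'b) ring_scheme \<Rightarrow> 'a set \<Rightarrow> ('a, 'c, 'd) module_scheme \<Rightarrow> real" where
  "multiplicity_module R I M = (let d = the_enat (krull_dim R) in
     lim (\<lambda>k. fact d *
       real (the_enat (module_length R (quot_module M (ideal_smult R (ideal_power R I k) M))))
         / real k ^ d))"

text \<open>\<open>\<mu>\<^sub>R(M) = dim\<^sub>K M/\<mm>M\<close>, where \<open>K \<subseteq> R\<close> is a field mapping isomorphically onto the residue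
  field; \<open>K\<close> acts through the scalar multiplication by \<open>R\<close>.\<close>
definition min_num_generators ::
    "('a, 'e) ring_scheme \<Rightarrow> ('a, 'b) ring_scheme \<Rightarrow> ('a, 'c, 'd) module_scheme \<Rightarrow> nat" where
  "min_num_generators K R M =
     vectorspace.dim K (quot_module M (ideal_smult R (max_ideal R) M))"

definition Ulrich ::
    "('a, 'e) ring_scheme \<Rightarrow> ('a, 'b) ring_scheme \<Rightarrow> ('a, 'c, 'd) module_scheme \<Rightarrow> bool" where
  "Ulrich K R M \<longleftrightarrow> maximal_Cohen_Macaulay R M \<and>
     real (min_num_generators K R M) = multiplicity_module R (max_ideal R) M"

text \<open>A ring as a module over itself, or, by restriction, over any of its subrings.\<close>
definition ring_as_module :: "('a, 'b) ring_scheme \<Rightarrow> ('a, 'a) module" where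
  "ring_as_module R = \<lparr>carrier = carrier R, monoid.mult = monoid.mult R, one = \<one>\<^bsub>R\<^esub>,
     ring.zero = \<zero>\<^bsub>R\<^esub>, add = add R, module.smult = monoid.mult R\<rparr>"

definition ring_multiplicity :: "('a, 'b) ring_scheme \<Rightarrow> real" where
  "ring_multiplicity R = multiplicity_module R (max_ideal R) (ring_as_module R)"


section \<open>The cyclic quotient singularity\<close>

definition primitive_root_of_unity :: "nat \<Rightarrow> 'k::field \<Rightarrow> bool" where
  "primitive_root_of_unity n \<zeta> \<longleftrightarrow> n > 0 \<and> \<zeta> ^ n = 1 \<and> (\<forall>m. 0 < m \<and> m < n \<longrightarrow> \<zeta> ^ m \<noteq> 1)"

text \<open>\<open>\<bbbk>[[x,y]]\<close> is represented as \<open>\<bbbk>[[x]][[y]]\<close>, so the coefficient of \<open>x\<^sup>i y\<^sup>j\<close> in \<open>f\<close> is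
  \<open>fps_nth (fps_nth f j) i\<close>.\<close>
definition ring_S :: "('k::field) fps fps ring" where
  "ring_S = \<lparr>carrier = UNIV, monoid.mult = (*), one = 1, ring.zero = 0, add = (+)\<rparr>"

definition monom_xy :: "nat \<Rightarrow> nat \<Rightarrow> ('k::field) fps fps" where
  "monom_xy i j = fps_const fps_X ^ i * fps_X ^ j"

definition const_xy :: "'k::field \<Rightarrow> 'k fps fps" where
  "const_xy c = fps_const (fps_const c)"

unbundle fps_syntax

text \<open>The substitution \<open>x \<mapsto> \<zeta>x\<close>, \<open>y \<mapsto> \<zeta>\<^sup>ay\<close>.\<close>
definition sigma :: "'k::field \<Rightarrow> nat \<Rightarrow> 'k fps fps \<Rightarrow> 'k fps fps" where
  "sigma \<zeta> a f =
     Abs_fps (\<lambda>j. Abs_fps (\<lambda>i. \<zeta> ^ i * (\<zeta> ^ a) ^ j * fps_nth (fps_nth f j) i))"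

lemma sigma_x: "sigma \<zeta> a (monom_xy 1 0) = const_xy \<zeta> * monom_xy 1 0"
  and sigma_y: "sigma \<zeta> a (monom_xy 0 1) = const_xy (\<zeta> ^ a) * monom_xy 0 1"
  by (auto simp: sigma_def monom_xy_def const_xy_def fps_eq_iff fps_X_def)

lemma sigma_add: "sigma \<zeta> a (f + g) = sigma \<zeta> a f + sigma \<zeta> a g"
  by (simp add: sigma_def fps_eq_iff distrib_left)

lemma sigma_mult: "sigma \<zeta> a (f * g) = sigma \<zeta> a f * sigma \<zeta> a g"
proof (intro fps_ext)
  fix j i
  have "\<zeta> ^ i * (\<zeta> ^ a) ^ j * (f $ p $ q * g $ (j - p) $ (i - q)) =
      (\<zeta> ^ q * (\<zeta> ^ a) ^ p * f $ p $ q) *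
      (\<zeta> ^ (i - q) * (\<zeta> ^ a) ^ (j - p) * g $ (j - p) $ (i - q))"
    if "p \<le> j" "q \<le> i" for p q
  proof -
    have "\<zeta> ^ i = \<zeta> ^ q * \<zeta> ^ (i - q)" "(\<zeta> ^ a) ^ j = (\<zeta> ^ a) ^ p * (\<zeta> ^ a) ^ (j - p)"
      using that by (simp_all flip: power_add)
    then show ?thesis by (simp only: mult_ac)
  qed
  note eq = this
  show "sigma \<zeta> a (f * g) $ j $ i = (sigma \<zeta> a f * sigma \<zeta> a g) $ j $ i"
    by (simp add: sigma_def fps_mult_nth fps_sum_nth sum_distrib_left)
      (intro sum.cong refl eq; simp)
qed

lemma sigma_const: "sigma \<zeta> a (const_xy c) = const_xy c"
  by (auto simp: sigma_def const_xy_def fps_eq_iff)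

definition group_G :: "'k::field \<Rightarrow> nat \<Rightarrow> ('k fps fps \<Rightarrow> 'k fps fps) set" where
  "group_G \<zeta> a = range (\<lambda>k. sigma \<zeta> a ^^ k)"

definition ring_R :: "'k::field \<Rightarrow> nat \<Rightarrow> 'k fps fps ring" where
  "ring_R \<zeta> a = ring_S\<lparr>carrier := {f. \<forall>g\<in>group_G \<zeta> a. g f = f}\<rparr>"

definition field_k :: "('k::field) fps fps ring" where
  "field_k = ring_S\<lparr>carrier := range const_xy\<rparr>"

definition module_M ::
    "nat \<Rightarrow> 'k::field \<Rightarrow> nat \<Rightarrow> nat \<Rightarrow> ('k fps fps, 'k fps fps) module" where
  "module_M n \<zeta> a t = (ring_as_module ring_S)\<lparr>carrier :=
     module.span (ring_R \<zeta> a) (ring_as_module ring_S)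
       {monom_xy i j | i j. [i + j * a = t] (mod n)}\<rparr>"


section \<open>The i-series\<close>

text \<open>The value of \<open>[\<alpha>\<^sub>1, \<dots>, \<alpha>\<^sub>r]\<close>; the empty list gets a junk value.\<close>
fun HJ_fraction :: "int list \<Rightarrow> rat" where
  "HJ_fraction [] = 0"
| "HJ_fraction [\<alpha>] = of_int \<alpha>"
| "HJ_fraction (\<alpha> # \<beta> # \<gamma>s) = of_int \<alpha> - 1 / HJ_fraction (\<beta> # \<gamma>s)"

text \<open>Since lists are indexed from 0, \<open>\<alpha>\<^sub>u\<close> is \<open>\<alpha>s ! (u - 1)\<close>.\<close>
fun i_seq :: "nat \<Rightarrow> nat \<Rightarrow> int list \<Rightarrow> nat \<Rightarrow> int" where
  "i_seq n a \<alpha>s 0 = int n"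
| "i_seq n a \<alpha>s (Suc 0) = int a"
| "i_seq n a \<alpha>s (Suc (Suc u)) = \<alpha>s ! u * i_seq n a \<alpha>s (Suc u) - i_seq n a \<alpha>s u"

text \<open>The remainders \<open>h\<^sub>u\<^sub>,\<^sub>t\<close>, started with \<open>h\<^sub>0\<^sub>,\<^sub>t = t\<close>, and the quotients \<open>d\<^sub>u\<^sub>,\<^sub>t\<close> (for \<open>u \<ge> 1\<close>)
  of the successive division of \<open>t\<close> by \<open>i 1, i 2, \<dots>\<close>.\<close>
fun div_rem :: "(nat \<Rightarrow> int) \<Rightarrow> nat \<Rightarrow> nat \<Rightarrow> int" where
  "div_rem i t 0 = int t"
| "div_rem i t (Suc u) = div_rem i t u mod i (Suc u)"

definition div_quot :: "(nat \<Rightarrow> int) \<Rightarrow> nat \<Rightarrow> nat \<Rightarrow> int" where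
  "div_quot i t u = div_rem i t (u - 1) div i u"

end

theory Submission
  imports Defs "HOL-Library.Product_Plus" "HOL-Library.Set_Algebras"
begin

text \<open>
  Everything is governed by exponents. A power series lies in \<open>R\<close> iff all its exponents lie in
  the monoid \<open>W 0\<close> of pairs \<open>(i, j)\<close> with \<open>i + ja \<equiv> 0 (mod n)\<close>, and it lies in \<open>M\<^sub>t\<close> iff all its
  exponents lie in the class \<open>W t\<close> of pairs with \<open>i + ja \<equiv> t\<close>. With \<open>P = W 0 - {0}\<close>, the maximal
  ideal consists of the series supported on \<open>P\<close>, and \<open>\<mm>\<^sup>kM\<^sub>t\<close> of those supported on \<open>P + \<dots> + P + W
  t\<close>, because these sets of exponents are finitely generated over \<open>W 0\<close>. Lengths and dimensions
  of quotients are therefore numbers of missing exponents (\<open>module_length_series_quot\<close>,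
  \<open>dim_series_quot\<close>).

  An MCM module \<open>M\<^sub>t\<close> is Ulrich iff \<open>\<mu>(M\<^sub>t) = e(M\<^sub>t)\<close>, so the theorem rests on three facts.

  First, \<open>\<mu>(M\<^sub>t) = 1 + d\<^sub>1 + \<dots> + d\<^sub>r\<close> (\<open>card_min_exps\<close>). The exponents of the minimal generators of
  \<open>M\<^sub>t\<close> are \<open>(t, 0)\<close> and, for \<open>t > 0\<close>, those of the module for \<open>t - i\<^sub>u\<close> shifted by \<open>(0, j\<^sub>u)\<close>,
  where \<open>i\<^sub>u\<close> is the largest entry of the i-series with \<open>i\<^sub>u \<le> t\<close> and \<open>j\<^sub>u\<close> is the least positive
  \<open>q\<close> such that \<open>qa mod n \<le> t\<close>. Thus the generators are counted by repeatedly subtracting the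
  largest possible entry of the i-series, which is successive division.

  Second, \<open>e(M\<^sub>t) = e(R)\<close> (\<open>multiplicity_M\<close>): multiplication by a power of \<open>x\<close> embeds \<open>R\<close> into
  \<open>M\<^sub>t\<close> and \<open>M\<^sub>t\<close> into \<open>R\<close>, and under these embeddings the lengths of \<open>M\<^sub>t/\<mm>\<^sup>kM\<^sub>t\<close> and \<open>R/\<mm>\<^sup>k\<close> differ
  by \<open>O(k)\<close>, which vanishes after division by \<open>k\<^sup>2\<close>.

  Third, \<open>M\<^sub>t\<close> is MCM: both the dimension of \<open>R\<close> and the depth of \<open>M\<^sub>t\<close> are \<open>2\<close>. The elements \<open>u =
  x\<^sup>n\<close> and \<open>v = y\<^sup>n\<close> form a regular sequence. Both upper bounds come from one elimination result,
  \<open>elimination_R\<close>: if \<open>c \<in> R\<close> does not vanish on \<open>x = 0\<close>, Weierstrass division by \<open>c\<close> shows that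
  the powers of any \<open>g \<in> R\<close> are linearly dependent over \<open>\<bbbk>[[x]]\<close> modulo \<open>c\<close>, so that \<open>g\<^sup>k (u\<^sup>e +
  gh)\<close> is a multiple of \<open>c\<close>. If \<open>g\<close> is not in a prime ideal containing \<open>c\<close>, or is regular modulo
  \<open>c\<close>, the factor \<open>g\<^sup>k\<close> cancels, and a power of \<open>u\<close> is obtained from \<open>c\<close> and \<open>g\<close>; a power of \<open>v\<close>
  follows (\<open>v_power_in_ideal\<close>).
\<close>

section \<open>The i-series and minimal exponents\<close>

text \<open>This companion of the i-series satisfies the same recursion from the initial values \<open>0,
  1\<close>, so that \<open>i\<^sub>u \<equiv> a j\<^sub>u\<close> modulo \<open>n\<close>; in other words, \<open>x\<close> to the power \<open>i\<^sub>u\<close> and \<open>y\<close> to the power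
  \<open>j\<^sub>u\<close> lie in the same special module.\<close>
fun j_seq :: "int list \<Rightarrow> nat \<Rightarrow> int" where
  "j_seq \<alpha>s 0 = 0"
| "j_seq \<alpha>s (Suc 0) = 1"
| "j_seq \<alpha>s (Suc (Suc u)) = \<alpha>s ! u * j_seq \<alpha>s (Suc u) - j_seq \<alpha>s u"

lemma HJ_fraction_gt_1: "\<alpha>s \<noteq> [] \<Longrightarrow> \<forall>\<alpha>\<in>set \<alpha>s. \<alpha> \<ge> 2 \<Longrightarrow> HJ_fraction \<alpha>s > 1"
proof (induction \<alpha>s rule: HJ_fraction.induct)
  case (3 \<alpha> \<beta> \<gamma>s)
  define x where "x = HJ_fraction (\<beta> # \<gamma>s)"
  have "x > 1" unfolding x_def using 3 by simp
  then have "1 / x < 1" by simp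
  moreover have "rat_of_int \<alpha> \<ge> rat_of_int 2"
    using 3(3) by (intro of_int_le_iff[THEN iffD2]) simp
  ultimately have "1 < rat_of_int \<alpha> - 1 / x" by simp
  then show ?case by (simp add: x_def)
qed auto

lemma i_seq_cong: "int n dvd i_seq n a \<alpha>s u - int a * j_seq \<alpha>s u"
proof (induction \<alpha>s u rule: j_seq.induct)
  case (3 \<alpha>s u)
  have "i_seq n a \<alpha>s (Suc (Suc u)) - int a * j_seq \<alpha>s (Suc (Suc u)) =
     \<alpha>s ! u * (i_seq n a \<alpha>s (Suc u) - int a * j_seq \<alpha>s (Suc u)) - (i_seq n a \<alpha>s u - int a * j_seq \<alpha>s u)"
    by (simp add: algebra_simps)
  then show ?case using 3 by (metis dvd_diff dvd_mult)
qed auto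

lemma i_seq_j_seq_det:
  "i_seq n a \<alpha>s u * j_seq \<alpha>s (Suc u) - i_seq n a \<alpha>s (Suc u) * j_seq \<alpha>s u = int n"
  by (induction u) (auto simp: algebra_simps)

lemma coprime_i_seq:
  assumes "coprime a n"
  shows "coprime (i_seq n a \<alpha>s u) (i_seq n a \<alpha>s (Suc u))"
proof (induction u)
  case (Suc u)
  show ?case
  proof (rule coprimeI)
    fix d assume d: "d dvd i_seq n a \<alpha>s (Suc u)" "d dvd i_seq n a \<alpha>s (Suc (Suc u))"
    then have "d dvd \<alpha>s ! u * i_seq n a \<alpha>s (Suc u) - i_seq n a \<alpha>s (Suc (Suc u))"
      by (meson dvd_diff dvd_mult)
    then have "d dvd i_seq n a \<alpha>s u" by simp
    with d(1) Suc show "is_unit d" using coprime_common_divisor by blast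
  qed
qed (use assms in \<open>simp add: coprime_commute\<close>)

lemma j_seq_less:
  assumes "\<forall>\<alpha>\<in>set \<alpha>s. \<alpha> \<ge> 2" "u \<le> length \<alpha>s"
  shows "0 \<le> j_seq \<alpha>s u \<and> j_seq \<alpha>s u < j_seq \<alpha>s (Suc u)"
  using assms(2)
proof (induction u)
  case (Suc u)
  then have "\<alpha>s ! u \<ge> 2" using assms(1) by (simp add: Suc_le_lessD)
  moreover have "0 \<le> j_seq \<alpha>s (Suc u)" using Suc by linarith
  ultimately have "\<alpha>s ! u * j_seq \<alpha>s (Suc u) \<ge> 2 * j_seq \<alpha>s (Suc u)" by (rule mult_right_mono)
  then have "2 * j_seq \<alpha>s (Suc u) - j_seq \<alpha>s u \<le> j_seq \<alpha>s (Suc (Suc u))" by simp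
  then show ?case using Suc by linarith
qed simp

locale HJ_expansion =
  fixes n a :: nat and \<alpha>s :: "int list"
  assumes a_pos: "1 \<le> a" and a_less: "a < n" and cop: "coprime a n"
    and ne: "\<alpha>s \<noteq> []" and ge2: "\<forall>\<alpha>\<in>set \<alpha>s. \<alpha> \<ge> 2"
    and frac: "of_nat n / of_nat a = HJ_fraction \<alpha>s"
begin

abbreviation "I \<equiv> i_seq n a \<alpha>s"
abbreviation "J \<equiv> j_seq \<alpha>s"

text \<open>The continued fraction of \<open>n/a\<close> has the ratios of consecutive entries as its tails; since
  each tail exceeds \<open>1\<close>, the i-series decreases strictly and stays positive.\<close>
lemma i_seq_ratio:
  assumes "u < length \<alpha>s"
  shows "0 < I (Suc u) \<and> I (Suc u) < I u \<and> of_int (I u) / of_int (I (Suc u)) = HJ_fraction (drop u \<alpha>s)"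
  using assms
proof (induction u)
  case 0
  then show ?case using a_pos a_less frac by simp
next
  case (Suc u)
  define h where "h = HJ_fraction (drop (Suc u) \<alpha>s)"
  have "drop u \<alpha>s = \<alpha>s ! u # drop (Suc u) \<alpha>s" using Suc.prems by (simp add: Cons_nth_drop_Suc)
  moreover have "drop (Suc u) \<alpha>s \<noteq> []" using Suc.prems by simp
  ultimately have "HJ_fraction (drop u \<alpha>s) = of_int (\<alpha>s ! u) - 1 / h"
    unfolding h_def by (cases "drop (Suc u) \<alpha>s") auto
  moreover have h: "h > 1" unfolding h_def
    by (rule HJ_fraction_gt_1) (use Suc.prems ge2 in \<open>auto dest: in_set_dropD\<close>)
  moreover have pos: "rat_of_int (I (Suc u)) > 0" using Suc by simp
  ultimately have "rat_of_int (I u) / of_int (I (Suc u)) = of_int (\<alpha>s ! u) - 1 / h"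
    using Suc by simp
  then have eq: "rat_of_int (I (Suc (Suc u))) * h = of_int (I (Suc u))"
    using h pos by (simp add: field_simps)
  then have "rat_of_int (I (Suc (Suc u))) = of_int (I (Suc u)) / h"
    using h by (simp add: field_simps)
  then have "0 < rat_of_int (I (Suc (Suc u)))" "rat_of_int (I (Suc (Suc u))) < of_int (I (Suc u))"
    using h pos by (simp_all del: i_seq.simps add: divide_less_eq)
  moreover from this have "rat_of_int (I (Suc u)) / of_int (I (Suc (Suc u))) = h"
    using eq by (simp del: i_seq.simps add: field_simps)
  ultimately show ?case unfolding h_def by (simp del: i_seq.simps)
qed

text \<open>The last ratio is the integer \<open>\<alpha>\<^sub>r\<close>, so the last entry divides its predecessor; consecutive
  entries are coprime.\<close>
lemma i_seq_length: "I (length \<alpha>s) = 1"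
proof -
  obtain r where r: "length \<alpha>s = Suc r" using ne by (cases \<alpha>s) auto
  have "drop r \<alpha>s = [\<alpha>s ! r]" using r by (metis Cons_nth_drop_Suc drop_eq_Nil lessI order_refl)
  then have "rat_of_int (I r) / of_int (I (Suc r)) = of_int (\<alpha>s ! r)" "I (Suc r) > 0"
    using i_seq_ratio[of r] r by auto
  then have "rat_of_int (I r) = of_int (\<alpha>s ! r * I (Suc r))" by (simp add: field_simps)
  then have "I r = \<alpha>s ! r * I (Suc r)" using of_int_eq_iff by blast
  then have "coprime (I (Suc r)) 0"
    using coprime_i_seq[OF cop, of \<alpha>s "Suc r"] by simp
  then show ?thesis using \<open>I (Suc r) > 0\<close> r by simp
qed

text \<open>The vectors \<open>(i\<^sub>u, j\<^sub>u)\<close> and \<open>(i\<^sub>u\<^sub>+\<^sub>1, j\<^sub>u\<^sub>+\<^sub>1)\<close> have determinant \<open>n\<close>, hence form a basis of the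
  lattice \<open>{(p, q). p \<equiv> aq (mod n)}\<close>. As the first coordinates decrease and the second ones
  increase, no lattice point with \<open>0 \<le> p < i\<^sub>u\<close> has its second coordinate strictly between \<open>0\<close>
  and \<open>j\<^sub>u\<^sub>+\<^sub>1\<close>.\<close>
lemma i_seq_gap:
  assumes u: "u < length \<alpha>s" and q: "0 < q" "q < J (Suc u)" and p: "0 \<le> p"
    and pq: "int n dvd p - int a * q"
  shows "I u \<le> p"
proof (rule ccontr)
  assume "\<not> I u \<le> p"
  then have less: "p < I u" by simp
  have J: "0 \<le> J u" "J u < J (Suc u)" using j_seq_less[OF ge2, of u] u by auto
  have I: "0 < I (Suc u)" "I (Suc u) < I u" using i_seq_ratio[OF u] by auto
  have det: "I u * J (Suc u) - I (Suc u) * J u = int n" by (rule i_seq_j_seq_det)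
  have dvd: "int n dvd p * J v - q * I v" for v
  proof -
    have "p * J v - q * I v = (p - int a * q) * J v - q * (I v - int a * J v)"
      by (simp add: algebra_simps)
    then show ?thesis using pq i_seq_cong[of n a \<alpha>s v] by (metis dvd_diff dvd_mult dvd_mult2)
  qed
  \<comment> \<open>Cramer's rule: \<open>x\<close> and \<open>- y\<close> are the coordinates of \<open>(p, q)\<close> in this basis.\<close>
  obtain x where x: "p * J (Suc u) - q * I (Suc u) = int n * x" using dvd by (meson dvdE)
  obtain y where y: "p * J u - q * I u = int n * y" using dvd by (meson dvdE)
  have n: "int n > 0" using a_less by simp
  have "(I u * J (Suc u) - I (Suc u) * J u) * p =
      (p * J (Suc u) - q * I (Suc u)) * I u - (p * J u - q * I u) * I (Suc u)"
    by (simp add: algebra_simps)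
  then have "int n * p = int n * (x * I u - y * I (Suc u))"
    unfolding det x y by (simp add: algebra_simps)
  then have p': "p = x * I u - y * I (Suc u)" using n by simp
  have "(I u * J (Suc u) - I (Suc u) * J u) * q =
      (p * J (Suc u) - q * I (Suc u)) * J u - (p * J u - q * I u) * J (Suc u)"
    by (simp add: algebra_simps)
  then have "int n * q = int n * (x * J u - y * J (Suc u))"
    unfolding det x y by (simp add: algebra_simps)
  then have q': "q = x * J u - y * J (Suc u)" using n by simp
  show False
  proof (cases "y \<ge> 0")
    case True
    have "x \<le> y"
    proof (rule ccontr)
      assume "\<not> x \<le> y"
      then have "(y + 1) * I u \<le> x * I u" using I by (intro mult_right_mono) auto
      moreover have "y * I (Suc u) \<le> y * I u" using I True by (intro mult_left_mono) auto
      ultimately show False using less p' by (simp add: algebra_simps)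
    qed
    then have "x * J u \<le> y * J u" using J by (intro mult_right_mono) auto
    also have "\<dots> \<le> y * J (Suc u)" using J True by (intro mult_left_mono) auto
    finally show False using q q' by simp
  next
    case False
    define z where "z = - y - 1"
    have z: "z \<ge> 0" "y = - z - 1" using False by (auto simp: z_def)
    have "- x \<le> z"
    proof (rule ccontr)
      assume "\<not> - x \<le> z"
      then have "(z + 1) * I u \<le> (- x) * I u" using I by (intro mult_right_mono) auto
      moreover have "(z + 1) * I (Suc u) < (z + 1) * I u" using I z by (intro mult_strict_left_mono) auto
      ultimately show False using p p' z by (simp add: algebra_simps)
    qed
    then have "- x * J u \<le> z * J u" using J by (intro mult_right_mono) auto
    also have "\<dots> \<le> z * J (Suc u)" using J z by (intro mult_left_mono) auto
    finally show False using q q' z by (simp add: algebra_simps)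
  qed
qed

end

definition weight_class :: "nat \<Rightarrow> nat \<Rightarrow> nat \<Rightarrow> (nat \<times> nat) set" where
  "weight_class n a t = {(i, j). [i + j * a = t] (mod n)}"

definition invariant_exps :: "nat \<Rightarrow> nat \<Rightarrow> (nat \<times> nat) set" where
  "invariant_exps n a = weight_class n a 0 - {0}"

text \<open>The exponents of the monomials that minimally generate \<open>M\<^sub>t\<close>.\<close>
definition min_exps :: "nat \<Rightarrow> nat \<Rightarrow> nat \<Rightarrow> (nat \<times> nat) set" where
  "min_exps n a t = weight_class n a t - (invariant_exps n a + weight_class n a t)"

lemma weight_class_iff_dvd: "(i, j) \<in> weight_class n a t \<longleftrightarrow> int n dvd int i + int j * int a - int t"
  by (simp add: weight_class_def flip: cong_int_iff) (simp add: cong_iff_dvd_diff)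

lemma weight_class_add:
  "e \<in> weight_class n a s \<Longrightarrow> f \<in> weight_class n a t \<Longrightarrow> e + f \<in> weight_class n a (s + t)"
proof (cases e; cases f)
  fix i j p q assume "e \<in> weight_class n a s" "f \<in> weight_class n a t" "e = (i, j)" "f = (p, q)"
  then have "[(i + j * a) + (p + q * a) = s + t] (mod n)"
    by (auto simp: weight_class_def intro: cong_add)
  moreover have "(i + j * a) + (p + q * a) = (i + p) + (j + q) * a" by (simp add: algebra_simps)
  ultimately show "e + f \<in> weight_class n a (s + t)"
    using \<open>e = _\<close> \<open>f = _\<close> by (simp add: weight_class_def)
qed

lemma weight_class_diff:
  assumes "(i, j) \<in> weight_class n a t" "(p, q) \<in> weight_class n a s" "p \<le> i" "q \<le> j" "s \<le> t"
  shows "(i - p, j - q) \<in> weight_class n a (t - s)"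
proof -
  have "int (i - p) + int (j - q) * int a - int (t - s) =
    (int i + int j * int a - int t) - (int p + int q * int a - int s)"
    using assms by (simp add: of_nat_diff algebra_simps)
  then show ?thesis using assms by (metis dvd_diff weight_class_iff_dvd)
qed

lemma in_min_exps_iff:
  "(i, j) \<in> min_exps n a t \<longleftrightarrow> (i, j) \<in> weight_class n a t \<and>
     (\<forall>p q. (p, q) \<in> weight_class n a 0 \<and> p \<le> i \<and> q \<le> j \<longrightarrow> p = 0 \<and> q = 0)"
proof -
  have "(i, j) \<in> invariant_exps n a + weight_class n a t \<longleftrightarrow>
      (\<exists>p q. (p, q) \<in> weight_class n a 0 \<and> p \<le> i \<and> q \<le> j \<and> \<not> (p = 0 \<and> q = 0))"
    if ij: "(i, j) \<in> weight_class n a t"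
  proof
    assume "(i, j) \<in> invariant_exps n a + weight_class n a t"
    then show "\<exists>p q. (p, q) \<in> weight_class n a 0 \<and> p \<le> i \<and> q \<le> j \<and> \<not> (p = 0 \<and> q = 0)"
      by (fastforce simp: set_plus_def invariant_exps_def zero_prod_def)
  next
    assume "\<exists>p q. (p, q) \<in> weight_class n a 0 \<and> p \<le> i \<and> q \<le> j \<and> \<not> (p = 0 \<and> q = 0)"
    then obtain p q where pq: "(p, q) \<in> weight_class n a 0" "p \<le> i" "q \<le> j" "\<not> (p = 0 \<and> q = 0)" by blast
    then have "(i - p, j - q) \<in> weight_class n a t" using weight_class_diff[OF ij pq(1-3)] by simp
    moreover have "(i, j) = (p, q) + (i - p, j - q)" using pq by simp
    ultimately show "(i, j) \<in> invariant_exps n a + weight_class n a t"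
      using pq set_plus_intro[of "(p, q)" "invariant_exps n a" "(i - p, j - q)"]
      by (auto simp: invariant_exps_def zero_prod_def)
  qed
  then show ?thesis by (auto simp: min_exps_def)
qed

text \<open>Here \<open>q\<close> is thought of as the least positive number with \<open>qa mod n \<le> t\<close>, and \<open>\<delta>\<close> as that
  residue. Below height \<open>q\<close> only \<open>(t, 0)\<close> is minimal. From height \<open>q\<close> on, an exponent is an
  exponent of the class of \<open>t - \<delta>\<close> shifted up by \<open>q\<close>, and minimality does not change: a proper
  reduction of the shifted exponent would land below height \<open>q\<close> and to the left of \<open>t\<close>.\<close>
lemma min_exps_step:
  assumes n: "t < n" and \<delta>: "0 < \<delta>" "\<delta> \<le> t" and q: "0 < q" "(\<delta>, 0) \<in> weight_class n a (q * a)"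
    and gap: "\<And>i j. (i, j) \<in> weight_class n a t \<Longrightarrow> j < q \<Longrightarrow> i \<le> t \<Longrightarrow> (i, j) = (t, 0)"
  shows "min_exps n a t = insert (t, 0) ((\<lambda>(i, j). (i, j + q)) ` min_exps n a (t - \<delta>))"
proof -
  have W0: "(t, 0) \<in> weight_class n a t" for t by (simp add: weight_class_def)
  have \<delta>q: "int n dvd int \<delta> - int q * int a" using q by (simp add: weight_class_iff_dvd)
  have shift: "(i, j + q) \<in> weight_class n a t \<longleftrightarrow> (i, j) \<in> weight_class n a (t - \<delta>)" for i j
  proof -
    have "int i + int (j + q) * int a - int t =
       (int i + int j * int a - int (t - \<delta>)) - (int \<delta> - int q * int a)"
      using \<delta> by (simp add: of_nat_diff algebra_simps)
    then have "int n dvd int i + int (j + q) * int a - int t \<longleftrightarrow>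
        int n dvd int i + int j * int a - int (t - \<delta>)"
      using \<delta>q by (metis dvd_diff diff_add_cancel dvd_add_right_iff add.commute)
    then show ?thesis unfolding weight_class_iff_dvd .
  qed
  have "(i, j) \<in> min_exps n a t \<longleftrightarrow> (i, j) \<in> insert (t, 0) ((\<lambda>(i, j). (i, j + q)) ` min_exps n a (t - \<delta>))"
      for i j
  proof -
    show "(i, j) \<in> min_exps n a t \<longleftrightarrow> (i, j) \<in> insert (t, 0) ((\<lambda>(i, j). (i, j + q)) ` min_exps n a (t - \<delta>))"
    proof
      assume G: "(i, j) \<in> min_exps n a t"
      then have ij: "(i, j) \<in> weight_class n a t" by (simp add: in_min_exps_iff)
      show "(i, j) \<in> insert (t, 0) ((\<lambda>(i, j). (i, j + q)) ` min_exps n a (t - \<delta>))"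
      proof (cases "j < q")
        case True
        have "i \<le> t"
        proof (rule ccontr)
          assume "\<not> i \<le> t"
          then have "(i - t, j) \<in> weight_class n a 0"
            using weight_class_diff[OF ij W0[of t]] by simp
          then have "i - t = 0" using G in_min_exps_iff by (metis diff_le_self order_refl)
          with \<open>\<not> i \<le> t\<close> show False by simp
        qed
        then show ?thesis using gap[OF ij True] by simp
      next
        case False
        then have "(i, j - q) \<in> weight_class n a (t - \<delta>)" using shift[of i "j - q"] ij by simp
        then have "(i, j - q) \<in> min_exps n a (t - \<delta>)"
          using G unfolding in_min_exps_iff by (meson diff_le_self le_trans)
        then show ?thesis using False by (auto intro!: image_eqI[of _ _ "(i, j - q)"])
      qed
    next
      assume "(i, j) \<in> insert (t, 0) ((\<lambda>(i, j). (i, j + q)) ` min_exps n a (t - \<delta>))"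
      then consider "(i, j) = (t, 0)" | j' where "j = j' + q" "(i, j') \<in> min_exps n a (t - \<delta>)" by auto
      then show "(i, j) \<in> min_exps n a t"
      proof cases
        case 1
        have "p = 0" if "[p = 0] (mod n)" "p \<le> t" for p
          using that n by (metis cong_less_modulus_unique_nat le_less_trans bot_nat_0.not_eq_extremum less_zeroE)
        then show ?thesis using 1 W0 by (auto simp: in_min_exps_iff weight_class_def)
      next
        case 2
        then have ij: "(i, j') \<in> weight_class n a (t - \<delta>)" by (simp add: in_min_exps_iff)
        have it: "i \<le> t - \<delta>"
        proof (rule ccontr)
          assume i: "\<not> i \<le> t - \<delta>"
          then have "(i - (t - \<delta>), j') \<in> weight_class n a 0"
            using weight_class_diff[OF ij W0[of "t - \<delta>"]] by simp
          then have "i - (t - \<delta>) = 0" using 2(2) in_min_exps_iff by (metis diff_le_self order_refl)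
          with i show False by simp
        qed
        have ijt: "(i, j) \<in> weight_class n a t" using shift ij 2 by simp
        have "p = 0 \<and> s = 0" if ps: "(p, s) \<in> weight_class n a 0" "p \<le> i" "s \<le> j" for p s
        proof (rule ccontr)
          assume nz: "\<not> (p = 0 \<and> s = 0)"
          have "s > j'" using 2(2) ps nz by (meson in_min_exps_iff not_le)
          moreover have "(i - p, j - s) \<in> weight_class n a t" using weight_class_diff[OF ijt ps] by simp
          ultimately have "(i - p, j - s) = (t, 0)"
            using gap[of "i - p" "j - s"] it 2(1) q by linarith
          then have "i - p = t" by simp
          then show False using it \<delta> by linarith
        qed
        then show ?thesis using ijt by (auto simp: in_min_exps_iff)
      qed
    qed
  qed
  then show ?thesis by (simp only: set_eq_iff split_paired_All) blast
qed

lemma min_exps_0: "min_exps n a 0 = {0}"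
  by (auto simp: in_min_exps_iff zero_prod_def) (auto simp: weight_class_def)

lemma div_rem_below:
  assumes "\<And>w. 1 \<le> w \<Longrightarrow> w < u \<Longrightarrow> int t < i w" "w < u"
  shows "div_rem i t w = int t"
  using assms(2) by (induction w) (use assms(1) in auto)

context HJ_expansion
begin

text \<open>Subtracting the largest entry \<open>i\<^sub>u \<le> t\<close> lowers the quotient \<open>d\<^sub>u\<close> by one and changes no
  other quotient, because both numbers leave the divisions before \<open>u\<close> unchanged.\<close>
lemma div_quot_step:
  assumes u: "1 \<le> u" "u \<le> length \<alpha>s" and t: "I u \<le> int t" "int t < I (u - 1)"
  shows "(\<Sum>w = 1..length \<alpha>s. div_quot I t w) = 1 + (\<Sum>w = 1..length \<alpha>s. div_quot I (t - nat (I u)) w)"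
proof -
  define s where "s = t - nat (I u)"
  have pos: "I u > 0" using i_seq_ratio[of "u - 1"] u by simp
  have s: "int s = int t - I u" using pos t by (simp add: s_def of_nat_diff)
  have dec: "I v \<le> I w" if "w \<le> v" "v \<le> length \<alpha>s" for v w
    using that
  proof (induction v rule: dec_induct)
    case (step v)
    then show ?case using i_seq_ratio[of v] by simp
  qed simp
  have below: "int t < I w" "int s < I w" if "1 \<le> w" "w < u" for w
  proof -
    have "I (u - 1) \<le> I w" using dec[of w "u - 1"] that u by linarith
    then show "int t < I w" "int s < I w" using t s pos by auto
  qed
  have rem_t: "div_rem I t w = int t" and rem_s: "div_rem I s w = int s" if "w < u" for w
    by (rule div_rem_below[OF below(1) that] div_rem_below[OF below(2) that]; assumption)+
  have above: "div_rem I s w = div_rem I t w" if "u \<le> w" for w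
    using that
  proof (induction w rule: dec_induct)
    case base
    obtain v where v: "u = Suc v" using u by (cases u) auto
    show ?case using rem_t[of v] rem_s[of v] s by (simp add: v)
  qed simp
  have quot: "div_quot I t w = div_quot I s w + (if w = u then 1 else 0)" if "1 \<le> w" for w
  proof -
    consider "w < u" | "w = u" | "w > u" by linarith
    then show ?thesis
    proof cases
      case 1
      then show ?thesis using that below[of w] rem_t[of "w - 1"] rem_s[of "w - 1"]
        by (simp add: div_quot_def)
    next
      case 2
      then show ?thesis using rem_t[of "u - 1"] rem_s[of "u - 1"] u pos s
        by (simp add: div_quot_def) (metis add.commute diff_add_cancel div_add_self2 less_irrefl)
    next
      case 3
      then show ?thesis using above[of "w - 1"] by (simp add: div_quot_def)
    qed
  qed
  have "(\<Sum>w = 1..length \<alpha>s. div_quot I t w) =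
      (\<Sum>w = 1..length \<alpha>s. div_quot I s w + (if w = u then 1 else 0))"
    by (intro sum.cong refl quot) simp
  also have "\<dots> = 1 + (\<Sum>w = 1..length \<alpha>s. div_quot I s w)"
    using u by (simp add: sum.distrib sum.delta)
  finally show ?thesis by (simp add: s_def)
qed

lemma sum_div_quot_0: "(\<Sum>w = 1..length \<alpha>s. div_quot I 0 w) = 0"
proof -
  have "div_rem I 0 w = 0" for w by (induction w) auto
  then show ?thesis by (simp add: div_quot_def)
qed

text \<open>The number \<open>q = j\<^sub>u\<close> required by \<open>min_exps_step\<close> is found by \<open>i_seq_gap\<close>, and both sides of
  the equation grow by one in each step.\<close>
theorem card_min_exps:
  assumes "t < n"
  shows "finite (min_exps n a t) \<and> int (card (min_exps n a t)) = 1 + (\<Sum>w = 1..length \<alpha>s. div_quot I t w)"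
  using assms
proof (induction t rule: less_induct)
  case (less t)
  show ?case
  proof (cases "t = 0")
    case True
    then show ?thesis using sum_div_quot_0 by (simp add: min_exps_0)
  next
    case False
    have "I (length \<alpha>s) \<le> int t" using i_seq_length False by simp
    define u where "u = (LEAST u. I u \<le> int t)"
    have u1: "I u \<le> int t" and u2: "u \<le> length \<alpha>s"
      using \<open>I (length \<alpha>s) \<le> int t\<close> by (auto simp: u_def intro: LeastI Least_le)
    have "u \<noteq> 0" using u1 less.prems by (intro notI) simp
    then have u3: "1 \<le> u" "int t < I (u - 1)"
      using not_less_Least[of "u - 1" "\<lambda>u. I u \<le> int t"] by (auto simp: u_def)
    obtain v where v: "u = Suc v" using u3 by (cases u) auto
    have pos: "I u > 0" using i_seq_ratio[of v] u2 v by simp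
    have J: "J u > 0" using j_seq_less[OF ge2, of v] u2 v by simp
    define \<delta> where "\<delta> = nat (I u)"
    define q where "q = nat (J u)"
    have q: "q > 0" "int q = J u" and \<delta>: "\<delta> > 0" "int \<delta> = I u" "\<delta> \<le> t"
      using pos J u1 by (auto simp: q_def \<delta>_def)
    have "(\<delta>, 0) \<in> weight_class n a (q * a)"
      using i_seq_cong[of n a \<alpha>s u] q \<delta> by (simp add: weight_class_iff_dvd mult.commute)
    moreover have "(i, j) = (t, 0)" if ij: "(i, j) \<in> weight_class n a t" "j < q" "i \<le> t" for i j
    proof -
      have d: "int n dvd (int t - int i) - int a * int j"
        using ij(1) unfolding weight_class_iff_dvd
        by (metis (no_types, opaque_lifting) diff_diff_eq dvd_minus_iff minus_diff_eq mult.commute)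
      show ?thesis
      proof (cases "j = 0")
        case True
        then have "int n dvd int t - int i" using d by simp
        then have "int t - int i = 0"
          using less.prems ij(3) zdvd_imp_le[of "int n" "int t - int i"] by linarith
        then show ?thesis using True by simp
      next
        case False
        have "I v \<le> int t - int i"
          by (rule i_seq_gap[of v "int j"]) (use u2 v False ij q d in auto)
        then show ?thesis using u3 v by simp
      qed
    qed
    ultimately have G: "min_exps n a t = insert (t, 0) ((\<lambda>(i, j). (i, j + q)) ` min_exps n a (t - \<delta>))"
      using less.prems \<delta> q by (intro min_exps_step) auto
    have IH: "finite (min_exps n a (t - \<delta>))"
       "int (card (min_exps n a (t - \<delta>))) = 1 + (\<Sum>w = 1..length \<alpha>s. div_quot I (t - \<delta>) w)"
      using less.IH[of "t - \<delta>"] less.prems \<delta> by auto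
    have "card (min_exps n a t) = Suc (card (min_exps n a (t - \<delta>)))"
      unfolding G using IH(1) q
      by (subst card_insert_disjoint) (auto intro!: card_image simp: inj_on_def)
    then show ?thesis using IH div_quot_step[OF u3(1) u2 u1 u3(2)] G by (simp add: \<delta>_def)
  qed
qed

end

section \<open>Power series with prescribed support\<close>

text \<open>Infinite sums are allowed: this is the completion of the span of the monomials with
  exponents in \<open>E\<close>.\<close>
definition series :: "(nat \<times> nat) set \<Rightarrow> 'k::field fps fps set" where
  "series E = {f. \<forall>i j. f $ j $ i \<noteq> 0 \<longrightarrow> (i, j) \<in> E}"

lemma seriesD: "f \<in> series E \<Longrightarrow> (i, j) \<notin> E \<Longrightarrow> f $ j $ i = 0"
  by (auto simp: series_def)

lemma fps2_eqI: "(\<And>i j. f $ j $ i = g $ j $ i) \<Longrightarrow> f = (g :: 'k::field fps fps)"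
  by (simp add: fps_eq_iff)

lemma fps2_mult_nth:
  "(f * g) $ j $ i = (\<Sum>q\<le>j. \<Sum>p\<le>i. f $ q $ p * g $ (j - q) $ (i - p))"
  for f g :: "'k::field fps fps"
  by (simp add: fps_mult_nth fps_sum_nth atLeast0AtMost)

lemma monom_xy_mult_nth:
  "(monom_xy p q * f) $ j $ i = (if p \<le> i \<and> q \<le> j then f $ (j - q) $ (i - p) else 0)"
  for f :: "'k::field fps fps"
  by (auto simp: monom_xy_def mult.assoc fps_X_power_mult_nth fps_const_power fps_mult_left_const_nth)

lemma monom_xy_nth: "(monom_xy p q :: 'k::field fps fps) $ j $ i = (if i = p \<and> j = q then 1 else 0)"
proof -
  have "(monom_xy p q * (1 :: 'k fps fps)) $ j $ i = (if i = p \<and> j = q then 1 else 0)"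
    unfolding monom_xy_mult_nth by (auto simp: fps_one_nth)
  then show ?thesis by simp
qed

lemma monom_xy_add: "monom_xy (i + p) (j + q) = monom_xy i j * (monom_xy p q :: 'k::field fps fps)"
  by (simp add: monom_xy_def power_add mult_ac)

lemma monom_xy_power: "monom_xy i j ^ k = (monom_xy (i * k) (j * k) :: 'k::field fps fps)"
  by (simp add: monom_xy_def power_mult_distrib flip: power_mult)

lemma const_xy_mult_nth: "(const_xy c * f) $ j $ i = c * f $ j $ i"
  by (simp add: const_xy_def)

lemma series_0 [simp]: "0 \<in> series E"
  and series_add: "f \<in> series E \<Longrightarrow> g \<in> series E \<Longrightarrow> f + g \<in> series E"
  and series_uminus: "f \<in> series E \<Longrightarrow> - f \<in> series E"
  and series_diff: "f \<in> series E \<Longrightarrow> g \<in> series E \<Longrightarrow> f - g \<in> series E"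
  and series_const_mult: "f \<in> series E \<Longrightarrow> const_xy c * f \<in> series E"
  by (auto simp: series_def const_xy_mult_nth) (metis add_0 | metis diff_0_right)+

lemma series_sum: "(\<And>x. x \<in> X \<Longrightarrow> h x \<in> series E) \<Longrightarrow> sum h X \<in> series E"
  by (induction X rule: infinite_finite_induct) (auto intro: series_add)

lemma series_mono: "E \<subseteq> F \<Longrightarrow> series E \<subseteq> series F"
  by (auto simp: series_def)

lemma monom_xy_series [simp]: "monom_xy i j \<in> (series E :: 'k::field fps fps set) \<longleftrightarrow> (i, j) \<in> E"
  by (auto simp: series_def monom_xy_nth)

lemma series_mult:
  assumes "f \<in> series E" "g \<in> series F"
  shows "f * g \<in> (series (E + F) :: 'k::field fps fps set)"
  unfolding series_def
proof (intro CollectI allI impI)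
  fix i j assume "(f * g) $ j $ i \<noteq> 0"
  then obtain q p where "q \<le> j" "p \<le> i" "f $ q $ p * g $ (j - q) $ (i - p) \<noteq> 0"
    unfolding fps2_mult_nth by (metis (no_types, lifting) atMost_iff sum.neutral)
  then have "(p, q) \<in> E" "(i - p, j - q) \<in> F" "(i, j) = (p, q) + (i - p, j - q)"
    using assms by (auto simp: series_def)
  then show "(i, j) \<in> E + F" by (metis set_plus_intro)
qed

definition restrict_series :: "(nat \<times> nat) set \<Rightarrow> 'k::field fps fps \<Rightarrow> 'k fps fps" where
  "restrict_series E f = Abs_fps (\<lambda>j. Abs_fps (\<lambda>i. if (i, j) \<in> E then f $ j $ i else 0))"

lemma restrict_series_nth [simp]:
  "restrict_series E f $ j $ i = (if (i, j) \<in> E then f $ j $ i else 0)"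
  by (simp add: restrict_series_def)

lemma restrict_series_in: "restrict_series E f \<in> series E"
  by (auto simp: series_def)

lemma restrict_series_id: "f \<in> series E \<Longrightarrow> restrict_series E f = f"
  by (rule fps2_eqI) (simp add: seriesD)

text \<open>Assign to every exponent \<open>e \<in> E\<close> one \<open>\<phi> e \<in> F\<close> below it, and collect the terms of \<open>f\<close> with
  the same \<open>\<phi> e\<close>. This makes finitely many generators suffice for infinite series.\<close>
lemma series_decomposition:
  assumes F: "finite F" "E \<subseteq> F + W" and f: "f \<in> (series E :: 'k::field fps fps set)"
  shows "\<exists>b. (\<forall>e. b e \<in> series W) \<and> f = (\<Sum>e\<in>F. monom_xy (fst e) (snd e) * b e)"
proof -
  have "\<forall>e\<in>E. \<exists>d\<in>F. \<exists>w\<in>W. e = d + w" using F(2) by (auto simp: set_plus_def)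
  then obtain \<phi> where \<phi>: "\<And>e. e \<in> E \<Longrightarrow> \<phi> e \<in> F \<and> (\<exists>w\<in>W. e = \<phi> e + w)" by metis
  define b :: "nat \<times> nat \<Rightarrow> 'k fps fps" where "b e = Abs_fps (\<lambda>j. Abs_fps (\<lambda>i.
     if (i, j) \<in> W \<and> \<phi> (e + (i, j)) = e then f $ (snd e + j) $ (fst e + i) else 0))" for e
  have b: "b e \<in> series W" for e by (auto simp: b_def series_def)
  have "f $ j $ i = (\<Sum>e\<in>F. monom_xy (fst e) (snd e) * b e) $ j $ i" for i j
  proof -
    have "(monom_xy (fst e) (snd e) * b e) $ j $ i = (if e = \<phi> (i, j) then f $ j $ i else 0)" for e
    proof (cases "(i, j) \<in> E")
      case True
      then obtain w where w: "w \<in> W" "(i, j) = \<phi> (i, j) + w" using \<phi> by blast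
      show ?thesis
      proof (cases "e = \<phi> (i, j)")
        case True
        then have e: "(i, j) = e + w" using w by simp
        then have "fst e \<le> i" "snd e \<le> j" "w = (i - fst e, j - snd e)"
          by (cases e; cases w; simp)+
        then have "(i - fst e, j - snd e) \<in> W" "\<phi> (e + (i - fst e, j - snd e)) = e"
          using w(1) e True by metis+
        then have "b e $ (j - snd e) $ (i - fst e) = f $ (snd e + (j - snd e)) $ (fst e + (i - fst e))"
          by (simp add: b_def)
        then show ?thesis using True \<open>fst e \<le> i\<close> \<open>snd e \<le> j\<close>
          by (simp add: monom_xy_mult_nth)
      next
        case False
        then show ?thesis by (cases e) (auto simp: monom_xy_mult_nth b_def)
      qed
    next
      case False
      then have "f $ j $ i = 0" using f by (auto simp: series_def)
      then show ?thesis by (cases e) (auto simp: monom_xy_mult_nth b_def)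
    qed
    then have "(\<Sum>e\<in>F. monom_xy (fst e) (snd e) * b e) $ j $ i = (\<Sum>e\<in>F. if e = \<phi> (i, j) then f $ j $ i else 0)"
      by (simp add: fps_sum_nth)
    also have "\<dots> = f $ j $ i"
    proof (cases "(i, j) \<in> E")
      case True
      then show ?thesis using \<phi> F(1) by (simp add: sum.delta')
    next
      case False
      then have "f $ j $ i = 0" using f by (auto simp: series_def)
      then show ?thesis by (intro trans[OF sum.neutral]) auto
    qed
    finally show ?thesis by simp
  qed
  then have "f = (\<Sum>e\<in>F. monom_xy (fst e) (snd e) * b e)" by (rule fps2_eqI)
  with b show ?thesis by blast
qed

lemma series_subsetI:
  assumes F: "finite F" "E \<subseteq> F + W" and N: "0 \<in> N" "\<And>f g. f \<in> N \<Longrightarrow> g \<in> N \<Longrightarrow> f + g \<in> N"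
    and gen: "\<And>i j b. (i, j) \<in> F \<Longrightarrow> b \<in> series W \<Longrightarrow> monom_xy i j * b \<in> N"
  shows "(series E :: 'k::field fps fps set) \<subseteq> N"
proof
  fix f :: "'k fps fps" assume "f \<in> series E"
  from series_decomposition[OF F this] obtain b
    where b: "\<And>e. b e \<in> series W" "f = (\<Sum>e\<in>F. monom_xy (fst e) (snd e) * b e)" by blast
  have "sum h X \<in> N" if "\<And>x. x \<in> X \<Longrightarrow> h x \<in> N" for h and X :: "(nat \<times> nat) set"
    using that by (induction X rule: infinite_finite_induct) (auto intro: N)
  then show "f \<in> N" unfolding b(2) using gen b(1) by auto
qed

section \<open>Exponents of the powers of the maximal ideal\<close>

text \<open>The combinatorial shadow of a finitely generated module over the series supported on \<open>W\<close>.\<close>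
definition fg_exps :: "(nat \<times> nat) set \<Rightarrow> (nat \<times> nat) set \<Rightarrow> bool" where
  "fg_exps W E \<longleftrightarrow> W + E \<subseteq> E \<and> (\<exists>F. finite F \<and> F \<subseteq> E \<and> E \<subseteq> F + W)"

lemma fg_exps_plus:
  assumes "fg_exps W D" "fg_exps W E"
  shows "fg_exps W (D + E)"
proof -
  obtain F G where FG: "finite F" "F \<subseteq> D" "D \<subseteq> F + W" "finite G" "G \<subseteq> E" "E \<subseteq> G + W"
    using assms by (auto simp: fg_exps_def)
  have WE: "W + E \<subseteq> E" and WD: "W + D \<subseteq> D" using assms by (auto simp: fg_exps_def)
  have "D + E \<subseteq> D + (G + W)" using FG by (intro set_plus_mono2) auto
  also have "\<dots> = G + (W + D)" by (simp add: ac_simps)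
  also have "\<dots> \<subseteq> G + D" using WD by (intro set_plus_mono2) auto
  also have "\<dots> \<subseteq> G + (F + W)" using FG by (intro set_plus_mono2) auto
  finally have "D + E \<subseteq> (F + G) + W" by (simp add: ac_simps)
  moreover have "finite (F + G)" using FG by (simp add: finite_set_plus)
  moreover have "F + G \<subseteq> D + E" using FG by (intro set_plus_mono2)
  moreover have "W + (D + E) \<subseteq> D + E"
    using set_plus_mono2[OF WD order_refl[of E]] by (simp add: ac_simps)
  ultimately show ?thesis unfolding fg_exps_def by blast
qed

lemma zero_in_weight_class: "0 \<in> weight_class n a 0"
  by (simp add: weight_class_def zero_prod_def)

lemma weight_class_0_plus: "weight_class n a 0 + weight_class n a t = weight_class n a t"
proof
  show "weight_class n a 0 + weight_class n a t \<subseteq> weight_class n a t"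
    using weight_class_add[of _ n a 0 _ t] by (auto elim!: set_plus_elim)
  show "weight_class n a t \<subseteq> weight_class n a 0 + weight_class n a t"
    using zero_in_weight_class set_zero_plus2 by blast
qed

lemma fg_weight_class:
  assumes "n > 0"
  shows "fg_exps (weight_class n a 0) (weight_class n a t)"
proof -
  let ?F = "{(i, j) \<in> weight_class n a t. i < n \<and> j < n}"
  have "finite ?F" by (rule finite_subset[of _ "{..<n} \<times> {..<n}"]) auto
  moreover have "weight_class n a t \<subseteq> ?F + weight_class n a 0"
  proof clarify
    fix i j assume ij: "(i, j) \<in> weight_class n a t"
    have w: "(i - i mod n, j - j mod n) \<in> weight_class n a 0"
      by (simp add: weight_class_def minus_mod_eq_mult_div cong_0_iff)
    have "(i - (i - i mod n), j - (j - j mod n)) \<in> weight_class n a (t - 0)"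
      by (rule weight_class_diff[OF ij w]) auto
    then have "(i mod n, j mod n) \<in> ?F" using assms by simp
    moreover have "(i, j) = (i mod n, j mod n) + (i - i mod n, j - j mod n)" by simp
    ultimately show "(i, j) \<in> ?F + weight_class n a 0" using w by (metis (no_types, lifting) set_plus_intro)
  qed
  ultimately show ?thesis
    unfolding fg_exps_def weight_class_0_plus by (intro conjI exI[of _ ?F]) auto
qed

lemma invariant_exps_ideal: "weight_class n a 0 + invariant_exps n a \<subseteq> invariant_exps n a"
proof
  fix x assume "x \<in> weight_class n a 0 + invariant_exps n a"
  then obtain w e where "x = w + e" "w \<in> weight_class n a 0" "e \<in> invariant_exps n a"
    by (auto elim!: set_plus_elim)
  then show "x \<in> invariant_exps n a"
    using weight_class_add[of w n a 0 e 0] by (cases w; cases e) (auto simp: invariant_exps_def zero_prod_def)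
qed

lemma fg_invariant_exps:
  assumes "n > 0"
  shows "fg_exps (weight_class n a 0) (invariant_exps n a)"
proof -
  let ?F = "{(i, j) \<in> invariant_exps n a. i \<le> n \<and> j \<le> n}"
  have "finite ?F" by (rule finite_subset[of _ "{..n} \<times> {..n}"]) auto
  moreover have "invariant_exps n a \<subseteq> ?F + weight_class n a 0"
  proof clarify
    fix i j assume ij: "(i, j) \<in> invariant_exps n a"
    then have W: "(i, j) \<in> weight_class n a 0" by (simp add: invariant_exps_def)
    \<comment> \<open>Reduce both coordinates modulo \<open>n\<close>, but stop at \<open>n\<close> if both residues vanish.\<close>
    define p where "p = (if i < n then i else if i mod n = 0 \<and> j mod n = 0 then n else i mod n)"
    define q where "q = (if j < n then j else if i mod n = 0 \<and> j mod n = 0 then n else j mod n)"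
    have "n dvd i - p" "n dvd j - q"
      unfolding p_def q_def
      by (auto simp: dvd_minus_mod mod_eq_0_iff_dvd intro!: dvd_diff_nat)
    then have w: "(i - p, j - q) \<in> weight_class n a 0"
      by (auto simp: weight_class_def cong_0_iff)
    have le: "p \<le> i" "q \<le> j" "p \<le> n" "q \<le> n" using assms by (auto simp: p_def q_def less_imp_le)
    have "(i - (i - p), j - (j - q)) \<in> weight_class n a (0 - 0)"
      by (rule weight_class_diff[OF W w]) auto
    then have "(p, q) \<in> weight_class n a 0" using le by simp
    moreover have "(p, q) \<noteq> 0" using ij assms
      by (auto simp: p_def q_def invariant_exps_def zero_prod_def split: if_splits)
    ultimately have "(p, q) \<in> ?F" using le by (simp add: invariant_exps_def)
    moreover have "(i, j) = (p, q) + (i - p, j - q)" using le by simp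
    ultimately show "(i, j) \<in> ?F + weight_class n a 0" using w by (metis (no_types, lifting) set_plus_intro)
  qed
  ultimately show ?thesis
    unfolding fg_exps_def using invariant_exps_ideal by (intro conjI exI[of _ ?F]) auto
qed

text \<open>The exponents of \<open>\<mm>\<^sup>kM\<^sub>t\<close>.\<close>
definition power_exps :: "nat \<Rightarrow> nat \<Rightarrow> nat \<Rightarrow> nat \<Rightarrow> (nat \<times> nat) set" where
  "power_exps n a k t = (((+) (invariant_exps n a)) ^^ k) (weight_class n a t)"

lemma power_exps_0: "power_exps n a 0 t = weight_class n a t"
  and power_exps_Suc: "power_exps n a (Suc k) t = invariant_exps n a + power_exps n a k t"
  by (simp_all add: power_exps_def)

lemma power_exps_plus: "power_exps n a k 0 + weight_class n a t = power_exps n a k t"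
  by (induction k) (simp_all add: power_exps_0 power_exps_Suc weight_class_0_plus add.assoc)

lemma fg_power_exps: "n > 0 \<Longrightarrow> fg_exps (weight_class n a 0) (power_exps n a k t)"
  by (induction k) (simp_all add: power_exps_0 power_exps_Suc fg_weight_class fg_invariant_exps fg_exps_plus)

lemma power_exps_subset: "power_exps n a k t \<subseteq> weight_class n a t"
proof (induction k)
  case (Suc k)
  have "invariant_exps n a + power_exps n a k t \<subseteq> weight_class n a 0 + weight_class n a t"
    using Suc by (intro set_plus_mono2) (auto simp: invariant_exps_def)
  then show ?case by (simp add: power_exps_Suc weight_class_0_plus)
qed (simp add: power_exps_0)

lemma power_exps_degree: "(i, j) \<in> power_exps n a k t \<Longrightarrow> k \<le> i + j"
proof (induction k arbitrary: i j)
  case (Suc k)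
  then obtain p q p' q' where "(p, q) \<in> invariant_exps n a" "(p', q') \<in> power_exps n a k t" "i = p + p'" "j = q + q'"
    by (auto simp: power_exps_Suc elim!: set_plus_elim)
  moreover from this have "p + q > 0" by (auto simp: invariant_exps_def zero_prod_def)
  ultimately show ?case using Suc.IH[of p' q'] by linarith
qed simp

lemma in_power_exps:
  assumes "n > 0" "(i, j) \<in> weight_class n a t"
  shows "k * n \<le> i \<Longrightarrow> (i, j) \<in> power_exps n a k t"
    and "k * n \<le> j \<Longrightarrow> (i, j) \<in> power_exps n a k t"
proof -
  have x: "(i, j) \<in> power_exps n a k t" if "k * n \<le> i" "(i, j) \<in> weight_class n a t" for i j
    using that
  proof (induction k arbitrary: i)
    case (Suc k)
    have n: "(n, 0) \<in> invariant_exps n a" using assms(1)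
      by (simp add: invariant_exps_def zero_prod_def weight_class_def cong_0_iff)
    have "(i - n, j - 0) \<in> weight_class n a (t - 0)"
      by (rule weight_class_diff) (use Suc.prems n in \<open>auto simp: invariant_exps_def\<close>)
    then have "(i - n, j) \<in> power_exps n a k t" using Suc.prems by (intro Suc.IH) auto
    then have "(n, 0) + (i - n, j) \<in> power_exps n a (Suc k) t"
      unfolding power_exps_Suc using n by (rule_tac set_plus_intro)
    then show ?case using Suc.prems by simp
  qed (simp add: power_exps_0)
  have y: "(i, j) \<in> power_exps n a k t" if "k * n \<le> j" "(i, j) \<in> weight_class n a t" for i j
    using that
  proof (induction k arbitrary: j)
    case (Suc k)
    have n: "(0, n) \<in> invariant_exps n a" using assms(1)
      by (simp add: invariant_exps_def zero_prod_def weight_class_def cong_0_iff)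
    have "(i - 0, j - n) \<in> weight_class n a (t - 0)"
      by (rule weight_class_diff) (use Suc.prems n in \<open>auto simp: invariant_exps_def\<close>)
    then have "(i, j - n) \<in> power_exps n a k t" using Suc.prems by (intro Suc.IH) auto
    then have "(0, n) + (i, j - n) \<in> power_exps n a (Suc k) t"
      unfolding power_exps_Suc using n by (rule_tac set_plus_intro)
    then show ?case using Suc.prems by simp
  qed (simp add: power_exps_0)
  show "k * n \<le> i \<Longrightarrow> (i, j) \<in> power_exps n a k t" "k * n \<le> j \<Longrightarrow> (i, j) \<in> power_exps n a k t"
    using x y assms(2) by auto
qed

lemma finite_codim_power_exps:
  assumes "n > 0"
  shows "finite (weight_class n a t - power_exps n a k t)"
proof (rule finite_subset)
  show "weight_class n a t - power_exps n a k t \<subseteq> {..<k * n} \<times> {..<k * n}"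
    using in_power_exps[OF assms] by (auto simp: not_le[symmetric])
qed simp

text \<open>Multiplication by \<open>x\<^sup>d\<close> maps \<open>M\<^sub>s\<close> into \<open>M\<^sub>t\<close> and \<open>\<mm>\<^sup>kM\<^sub>s\<close> into \<open>\<mm>\<^sup>kM\<^sub>t\<close>. The exponents of \<open>M\<^sub>t\<close>
  that it misses lie in \<open>d\<close> columns, and in each column at most the lowest \<open>kn\<close> are outside
  \<open>\<mm>\<^sup>kM\<^sub>t\<close>, since \<open>y\<^sup>n \<in> \<mm>\<close>.\<close>
lemma card_codim_compare:
  assumes n: "n > 0" and sd: "[s + d = t] (mod n)"
  shows "card (weight_class n a t - power_exps n a k t) \<le>
         card (weight_class n a s - power_exps n a k s) + d * (k * n)"
proof -
  let ?D = "\<lambda>t. weight_class n a t - power_exps n a k t"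
  have d: "(d, 0) \<in> weight_class n a d" by (simp add: weight_class_def)
  have eq: "weight_class n a t = weight_class n a (s + d)"
    using sd by (auto simp: weight_class_def intro: cong_trans cong_sym)
  have peq: "power_exps n a k t = power_exps n a k (s + d)" by (simp add: power_exps_def eq)
  have shift: "(i + d, j) \<in> weight_class n a t \<longleftrightarrow> (i, j) \<in> weight_class n a s" for i j
    by (simp add: eq weight_class_iff_dvd algebra_simps)
  have pshift: "(i + d, j) \<in> power_exps n a k t" if "(i, j) \<in> power_exps n a k s" for i j
  proof -
    have "(i, j) + (d, 0) \<in> power_exps n a k s + {(d, 0)}" using that by (intro set_plus_intro) auto
    also have "\<dots> = power_exps n a k 0 + (weight_class n a s + {(d, 0)})"
      by (simp add: power_exps_plus flip: add.assoc)
    also have "\<dots> \<subseteq> power_exps n a k 0 + weight_class n a t"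
      unfolding eq using weight_class_add[OF _ d] by (intro set_plus_mono2) (auto elim!: set_plus_elim)
    finally show ?thesis by (simp add: power_exps_plus)
  qed
  have "?D t \<subseteq> (\<lambda>(i, j). (i + d, j)) ` ?D s \<union> {..<d} \<times> {..<k * n}"
  proof (rule subsetI, unfold split_paired_all)
    fix i j assume "(i, j) \<in> ?D t"
    then have ij: "(i, j) \<in> weight_class n a t" "(i, j) \<notin> power_exps n a k t" by auto
    have j: "j < k * n" using in_power_exps(2)[OF n ij(1)] ij(2) by (meson not_le)
    show "(i, j) \<in> (\<lambda>(i, j). (i + d, j)) ` ?D s \<union> {..<d} \<times> {..<k * n}"
    proof (cases "d \<le> i")
      case False
      then show ?thesis using j by simp
    next
      case True
    then have "(i - d, j) \<in> ?D s" using ij shift[of "i - d" j] pshift[of "i - d" j] by auto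
    then have "(i - d + d, j) \<in> (\<lambda>(i, j). (i + d, j)) ` ?D s" by (intro image_eqI[of _ _ "(i - d, j)"]) auto
    then show ?thesis using True by simp
    qed
  qed
  then have "card (?D t) \<le> card ((\<lambda>(i, j). (i + d, j)) ` ?D s \<union> {..<d} \<times> {..<k * n})"
    using finite_codim_power_exps[OF n] by (intro card_mono) auto
  also have "\<dots> \<le> card ((\<lambda>(i, j). (i + d, j)) ` ?D s) + card ({..<d} \<times> {..<k * n})"
    by (rule card_Un_le)
  also have "\<dots> \<le> card (?D s) + d * (k * n)"
    using finite_codim_power_exps[OF n] by (intro add_mono card_image_le) (auto simp: card_cartesian_product)
  finally show ?thesis .
qed

section \<open>Quotients of monomial modules: length and dimension\<close>

definition series_module :: "(nat \<times> nat) set \<Rightarrow> ('k::field fps fps, 'k fps fps) module" where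
  "series_module E = (ring_as_module ring_S)\<lparr>carrier := series E\<rparr>"

lemma series_module_simps [simp]:
  "carrier (series_module E) = series E"
  "\<zero>\<^bsub>series_module E\<^esub> = 0"
  "x \<oplus>\<^bsub>series_module E\<^esub> y = x + y"
  "r \<odot>\<^bsub>series_module E\<^esub> x = r * x"
  by (simp_all add: series_module_def ring_as_module_def ring_S_def)

lemma ring_S_simps [simp]:
  "carrier ring_S = UNIV" "\<zero>\<^bsub>ring_S\<^esub> = 0" "\<one>\<^bsub>ring_S\<^esub> = 1" "x \<oplus>\<^bsub>ring_S\<^esub> y = x + y" "x \<otimes>\<^bsub>ring_S\<^esub> y = x * y"
  by (simp_all add: ring_S_def)

text \<open>The results are needed both over \<open>R\<close> and over the field of constants.\<close>
locale coeff_ring =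
  fixes C :: "'k::field fps fps set"
  assumes zero: "0 \<in> C" and one: "1 \<in> C"
    and add: "\<And>f g. f \<in> C \<Longrightarrow> g \<in> C \<Longrightarrow> f + g \<in> C"
    and mult: "\<And>f g. f \<in> C \<Longrightarrow> g \<in> C \<Longrightarrow> f * g \<in> C"
    and uminus: "\<And>f. f \<in> C \<Longrightarrow> - f \<in> C"
    and const: "\<And>c. const_xy c \<in> C"
begin

abbreviation "R \<equiv> ring_S\<lparr>carrier := C\<rparr>"

lemma ring_simps [simp]:
  "carrier R = C" "\<zero>\<^bsub>R\<^esub> = 0" "\<one>\<^bsub>R\<^esub> = 1" "x \<oplus>\<^bsub>R\<^esub> y = x + y" "x \<otimes>\<^bsub>R\<^esub> y = x * y"
  by simp_all

lemma cring_R: "cring R"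
proof (rule cringI)
  show "abelian_group R"
    by (rule abelian_groupI) (auto simp: zero add algebra_simps intro: bexI[of _ "- x" for x] uminus)
  show "comm_monoid R"
    by (rule comm_monoidI) (auto simp: one mult mult_ac)
qed (auto simp: algebra_simps)

definition stable :: "(nat \<times> nat) set \<Rightarrow> bool" where
  "stable E \<longleftrightarrow> (\<forall>c\<in>C. \<forall>f\<in>series E. c * f \<in> series E)"

lemma stableD: "stable E \<Longrightarrow> c \<in> C \<Longrightarrow> f \<in> series E \<Longrightarrow> c * f \<in> series E"
  by (simp add: stable_def)

lemma module_series:
  assumes "stable E"
  shows "module R (series_module E)"
proof (rule moduleI)
  show "abelian_group (series_module E)"
    by (rule abelian_groupI)
      (auto simp: series_add algebra_simps intro: bexI[of _ "- x" for x] series_uminus)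
qed (auto simp: cring_R algebra_simps assms stableD)

lemma submodule_iff:
  assumes "stable E" and "N \<subseteq> series E"
  shows "submodule R N (series_module E) \<longleftrightarrow>
    0 \<in> N \<and> (\<forall>f\<in>N. \<forall>g\<in>N. f + g \<in> N) \<and> (\<forall>c\<in>C. \<forall>f\<in>N. c * f \<in> N)"
  using assms(2) by (auto simp: submodule_def module_series[OF assms(1)])

lemma submodule_series:
  assumes "stable E" "stable D" "D \<subseteq> E"
  shows "submodule R (series D) (series_module E)"
  using series_mono[OF assms(3)] by (subst submodule_iff) (auto simp: assms series_add stableD)

definition coset :: "(nat \<times> nat) set \<Rightarrow> 'k fps fps \<Rightarrow> 'k fps fps set" where
  "coset D x = {h + x | h. h \<in> series D}"

lemma coset_eq_iff: "coset D x = coset D y \<longleftrightarrow> x - y \<in> series D"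
proof
  assume "coset D x = coset D y"
  moreover have "x \<in> coset D x" by (auto simp: coset_def intro!: exI[of _ 0])
  ultimately obtain h where "h \<in> series D" "x = h + y" by (auto simp: coset_def)
  then show "x - y \<in> series D" by simp
next
  assume d: "x - y \<in> series D"
  have "z \<in> coset D x \<longleftrightarrow> z \<in> coset D y" for z
  proof -
    have "z \<in> coset D w \<longleftrightarrow> z - w \<in> series D" for w
      by (auto simp: coset_def intro!: exI[of _ "z - w"])
    moreover have "z - x \<in> series D \<longleftrightarrow> z - y \<in> series D"
      using d series_add[of "z - x" D "x - y"] series_diff[of "z - y" D "x - y"] by auto
    ultimately show ?thesis by simp
  qed
  then show "coset D x = coset D y" by blast
qed

context
  fixes A D :: "(nat \<times> nat) set"
  assumes stA: "stable A" and stD: "stable D" and DA: "D \<subseteq> A"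
begin

abbreviation "series_quot \<equiv> quot_module (series_module A) (series D)"

lemma a_r_coset: "series D +>\<^bsub>series_module A\<^esub> x = coset D x"
  by (auto simp: a_r_coset_def' coset_def)

lemma quot_carrier: "carrier series_quot = coset D ` series A"
  by (auto simp: quot_module_def A_RCOSETS_def' a_r_coset)

lemma quot_zero: "\<zero>\<^bsub>series_quot\<^esub> = coset D 0"
  by (auto simp: quot_module_def coset_def)

lemma quot_add: "coset D x \<oplus>\<^bsub>series_quot\<^esub> coset D y = coset D (x + y)"
proof -
  have "coset D x \<oplus>\<^bsub>series_quot\<^esub> coset D y = (\<Union>h\<in>coset D x. \<Union>k\<in>coset D y. {h + k})"
    by (simp add: quot_module_def set_add_def set_mult_def series_module_def ring_as_module_def ring_S_def)
  also have "\<dots> = coset D (x + y)"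
  proof (intro equalityI subsetI)
    fix z assume "z \<in> (\<Union>h\<in>coset D x. \<Union>k\<in>coset D y. {h + k})"
    then obtain h k where "h \<in> series D" "k \<in> series D" "z = (h + x) + (k + y)" by (auto simp: coset_def)
    then show "z \<in> coset D (x + y)"
      by (auto simp: coset_def series_add intro!: exI[of _ "h + k"])
  next
    fix z assume "z \<in> coset D (x + y)"
    then obtain h where h: "h \<in> series D" "z = h + (x + y)" by (auto simp: coset_def)
    then have "h + x \<in> coset D x" "0 + y \<in> coset D y" "z = (h + x) + (0 + y)"
      using series_0 by (auto simp: coset_def simp del: add_0)
    then show "z \<in> (\<Union>h\<in>coset D x. \<Union>k\<in>coset D y. {h + k})" by blast
  qed
  finally show ?thesis .
qed

lemma quot_smult: "c \<in> C \<Longrightarrow> x \<in> series A \<Longrightarrow> c \<odot>\<^bsub>series_quot\<^esub> coset D x = coset D (c * x)"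
  using quot_module_smult_coset[OF module_series[OF stA] submodule_series[OF stA stD DA], of c x]
  by (simp add: a_r_coset)

lemma module_quot: "module R series_quot"
  by (rule quot_module_is_module[OF module_series[OF stA] submodule_series[OF stA stD DA]])

lemma quot_finsum:
  assumes "finite X" "g ` X \<subseteq> series A"
  shows "finsum series_quot (\<lambda>i. coset D (g i)) X = coset D (\<Sum>i\<in>X. g i)"
proof -
  interpret Q: module R series_quot by (rule module_quot)
  show ?thesis using assms
  proof (induction X rule: finite_induct)
    case empty
    then show ?case by (simp add: quot_zero)
  next
    case (insert x X)
    have "finsum series_quot (\<lambda>i. coset D (g i)) (insert x X) = coset D (g x) \<oplus>\<^bsub>series_quot\<^esub> finsum series_quot (\<lambda>i. coset D (g i)) X"
      by (rule Q.finsum_insert) (use insert in \<open>auto simp: quot_carrier\<close>)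
    then show ?case using insert by (simp add: quot_add)
  qed
qed

definition pullback :: "'k fps fps set set \<Rightarrow> 'k fps fps set" where
  "pullback N = {f \<in> series A. coset D f \<in> N}"

lemma pullback_submodule:
  assumes "submodule R N series_quot"
  shows "f \<in> pullback N \<Longrightarrow> g \<in> pullback N \<Longrightarrow> f + g \<in> pullback N"
    and "c \<in> C \<Longrightarrow> f \<in> pullback N \<Longrightarrow> c * f \<in> pullback N"
    and "series D \<subseteq> pullback N"
proof -
  interpret N: submodule R N series_quot by (rule assms)
  show "f + g \<in> pullback N" if "f \<in> pullback N" "g \<in> pullback N"
  proof -
    have "coset D f \<oplus>\<^bsub>series_quot\<^esub> coset D g \<in> N" using that by (intro N.m_closed) (simp_all add: pullback_def)
    then show ?thesis using that unfolding quot_add by (simp add: pullback_def series_add)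
  qed
  show "c * f \<in> pullback N" if "c \<in> C" "f \<in> pullback N"
  proof -
    have "c \<odot>\<^bsub>series_quot\<^esub> coset D f \<in> N" using that by (intro N.smult_closed) (simp_all add: pullback_def)
    then show ?thesis using that by (simp add: pullback_def quot_smult stableD[OF stA])
  qed
  show "series D \<subseteq> pullback N"
  proof
    fix f :: "'k fps fps" assume f: "f \<in> series D"
    then have "coset D f = \<zero>\<^bsub>series_quot\<^esub>" by (simp add: coset_eq_iff quot_zero)
    moreover have "f \<in> series A" using f series_mono[OF DA] by blast
    ultimately show "f \<in> pullback N" using N.zero_closed unfolding pullback_def by simp
  qed
qed

lemma pullback_strict:
  assumes "submodule R N' series_quot" "N \<subset> N'"
  shows "pullback N \<subset> pullback N'"
proof -
  interpret N': submodule R N' series_quot by (rule assms)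
  obtain x where x: "x \<in> N'" "x \<notin> N" using assms by blast
  then have "x \<in> carrier series_quot" using N'.subset by blast
  then obtain f where "f \<in> series A" "x = coset D f" unfolding quot_carrier by blast
  then have "f \<in> pullback N'" "f \<notin> pullback N" using x by (simp_all add: pullback_def)
  moreover have "pullback N \<subseteq> pullback N'" using assms(2) unfolding pullback_def by blast
  ultimately show ?thesis by blast
qed

lemma submodule_quot_series:
  assumes "stable B" "D \<subseteq> B" "B \<subseteq> A"
  shows "submodule R (coset D ` series B) series_quot"
proof (rule submodule.intro)
  show "module R series_quot" by (rule module_quot)
  show "coset D ` series B \<subseteq> carrier series_quot"
    unfolding quot_carrier using series_mono[OF assms(3)] by (rule image_mono)
  show "\<zero>\<^bsub>series_quot\<^esub> \<in> coset D ` series B" unfolding quot_zero by (intro imageI series_0)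
  show "v \<oplus>\<^bsub>series_quot\<^esub> w \<in> coset D ` series B" if vw: "v \<in> coset D ` series B" "w \<in> coset D ` series B" for v w
  proof -
    obtain f g :: "'k fps fps" where "f \<in> series B" "g \<in> series B" "v = coset D f" "w = coset D g"
      using vw unfolding image_iff by metis
    then show ?thesis by (simp only: quot_add) (intro imageI series_add)
  qed
  show "c \<odot>\<^bsub>series_quot\<^esub> v \<in> coset D ` series B" if cv: "c \<in> carrier R" "v \<in> coset D ` series B" for c v
  proof -
    obtain f :: "'k fps fps" where f: "f \<in> series B" "v = coset D f" using cv unfolding image_iff by metis
    then have "f \<in> series A" using series_mono[OF assms(3)] by blast
    then have "c \<odot>\<^bsub>series_quot\<^esub> v = coset D (c * f)" using cv f by (simp add: quot_smult)
    then show ?thesis using cv f stableD[OF assms(1)] by simp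
  qed
qed

lemma quot_series_strict:
  assumes "D \<subseteq> B" "B \<subset> B'" "B' \<subseteq> A"
  shows "coset D ` series B \<subset> coset D ` series B'"
proof -
  obtain i j where e: "(i, j) \<in> B'" "(i, j) \<notin> B" using assms by auto
  have "coset D (monom_xy i j) \<notin> coset D ` series B"
  proof
    assume "coset D (monom_xy i j) \<in> coset D ` series B"
    then obtain f :: "'k fps fps" where f: "f \<in> series B" "monom_xy i j - f \<in> series D"
      unfolding image_iff coset_eq_iff by blast
    then have "(monom_xy i j - f) + f \<in> series B"
      using series_mono[OF assms(1)] by (blast intro: series_add)
    then show False using e by simp
  qed
  moreover have "coset D (monom_xy i j) \<in> coset D ` series B'" using e by simp
  moreover have "coset D ` series B \<subseteq> coset D ` series B'"
    using assms(2) by (intro image_mono series_mono) auto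
  ultimately show ?thesis by blast
qed

end
end

text \<open>The encoding of pairs as natural numbers serves as an arbitrary linear order of the
  exponents.\<close>
definition leading_exps :: "(nat \<times> nat) set \<Rightarrow> 'k::field fps fps set \<Rightarrow> (nat \<times> nat) set" where
  "leading_exps X U = {e \<in> X. \<exists>f\<in>U. f $ snd e $ fst e \<noteq> 0 \<and>
     (\<forall>e'\<in>X. prod_encode e' < prod_encode e \<longrightarrow> f $ snd e' $ fst e' = 0)}"

text \<open>Gaussian elimination: if the leading exponents agree, an element of the larger space can
  be reduced by the smaller one, one exponent at a time, until it vanishes on \<open>X\<close>.\<close>
lemma leading_exps_strict:
  fixes U U' :: "'k::field fps fps set"
  assumes X: "finite X" and U: "U \<subset> U'"
    and add: "\<And>f g. f \<in> U \<Longrightarrow> g \<in> U \<Longrightarrow> f + g \<in> U" "\<And>f g. f \<in> U' \<Longrightarrow> g \<in> U' \<Longrightarrow> f + g \<in> U'"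
    and const: "\<And>c f. f \<in> U \<Longrightarrow> const_xy c * f \<in> U" "\<And>c f. f \<in> U' \<Longrightarrow> const_xy c * f \<in> U'"
    and vanish: "\<And>f. f \<in> U' \<Longrightarrow> \<forall>e\<in>X. f $ snd e $ fst e = 0 \<Longrightarrow> f \<in> U"
  shows "leading_exps X U \<subset> leading_exps X U'"
proof -
  have "leading_exps X U \<subseteq> leading_exps X U'" using U unfolding leading_exps_def by blast
  moreover have "leading_exps X U \<noteq> leading_exps X U'"
  proof
    assume eq: "leading_exps X U = leading_exps X U'"
    obtain M where M: "\<And>e. e \<in> X \<Longrightarrow> prod_encode e < M"
      using finite_nat_set_iff_bounded[of "prod_encode ` X"] X by auto
    \<comment> \<open>Downward induction on the position \<open>m\<close> below which \<open>f\<close> vanishes.\<close>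
    have "f \<in> U" if "f \<in> U'" "\<forall>e\<in>X. prod_encode e < m \<longrightarrow> f $ snd e $ fst e = 0" for m f
      using that
    proof (induction "M - m" arbitrary: m f rule: less_induct)
      case less
      show ?case
      proof (cases "M \<le> m")
        case True
        then show ?thesis using vanish[OF less.prems(1)] less.prems(2) M by fastforce
      next
        case False
        show ?thesis
        proof (cases "\<exists>e\<in>X. prod_encode e = m \<and> f $ snd e $ fst e \<noteq> 0")
          case True
          then obtain e where e: "e \<in> X" "prod_encode e = m" "f $ snd e $ fst e \<noteq> 0" by blast
          then have "e \<in> leading_exps X U'" using less.prems unfolding leading_exps_def by blast
          then obtain g where g: "g \<in> U" "g $ snd e $ fst e \<noteq> 0"
              "\<forall>e'\<in>X. prod_encode e' < m \<longrightarrow> g $ snd e' $ fst e' = 0"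
            using eq e(2) unfolding leading_exps_def by blast
          define c where "c = f $ snd e $ fst e / g $ snd e $ fst e"
          have "f + const_xy (- c) * g \<in> U"
          proof (rule less.hyps[of "Suc m"])
            show "f + const_xy (- c) * g \<in> U'" using g(1) U less.prems(1) by (intro add const) auto
            show "\<forall>e'\<in>X. prod_encode e' < Suc m \<longrightarrow> (f + const_xy (- c) * g) $ snd e' $ fst e' = 0"
            proof (intro ballI impI)
              fix e' assume e': "e' \<in> X" "prod_encode e' < Suc m"
              show "(f + const_xy (- c) * g) $ snd e' $ fst e' = 0"
              proof (cases "prod_encode e' = m")
                case True
                then have "e' = e" using e(2) by (metis prod_encode_inverse)
                then show ?thesis using g(2) by (simp add: const_xy_mult_nth c_def)
              next
                case False
                then show ?thesis using e' g(3) less.prems(2) by (simp add: const_xy_mult_nth)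
              qed
            qed
          qed (use False in simp)
          then have "(f + const_xy (- c) * g) + const_xy c * g \<in> U" 
            using g(1) by (rule add(1)[OF _ const(1)])
          moreover have "(f + const_xy (- c) * g) + const_xy c * g = f"
            by (rule fps2_eqI) (simp add: const_xy_mult_nth)
          ultimately show ?thesis by argo
        next
          case no: False
          show ?thesis
            by (rule less.hyps[of "Suc m"]) (use no less.prems False in \<open>auto simp: less_Suc_eq\<close>)
        qed
      qed
    qed
    from this[of _ 0] have "U' \<subseteq> U" by auto
    with U show False by blast
  qed
  ultimately show ?thesis by blast
qed

text \<open>Adding the missing exponents in order of decreasing degree keeps the set closed under \<open>W\<close>,
  as adding a nonzero exponent raises the degree.\<close>
lemma exps_chain:
  fixes A D W :: "(nat \<times> nat) set"
  assumes "finite (A - D)" "D \<subseteq> A" "W + A \<subseteq> A" "W + D \<subseteq> D"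
  shows "\<exists>B. B 0 = D \<and> (\<forall>i\<le>card (A - D). W + B i \<subseteq> B i \<and> D \<subseteq> B i \<and> B i \<subseteq> A) \<and>
    (\<forall>i<card (A - D). B i \<subset> B (Suc i))"
  using assms
proof (induction "card (A - D)" arbitrary: D)
  case 0
  then show ?case by (intro exI[of _ "\<lambda>_. D"]) simp
next
  case (Suc c)
  define deg where "deg e = fst e + snd e" for e :: "nat \<times> nat"
  have "A - D \<noteq> {}" using Suc by auto
  then obtain e where e: "e \<in> A - D" "\<And>e'. e' \<in> A - D \<Longrightarrow> deg e' \<le> deg e"
  proof -
    have "Max (deg ` (A - D)) \<in> deg ` (A - D)"
      using Suc.prems(1) \<open>A - D \<noteq> {}\<close> by (intro Max_in) auto
    then obtain e where "e \<in> A - D" "deg e = Max (deg ` (A - D))" by (metis imageE)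
    then show ?thesis using Suc.prems(1) by (intro that[of e]) (auto intro!: Max_ge)
  qed
  have "w + e \<in> insert e D" if "w \<in> W" for w
  proof (cases "w + e \<in> D \<or> w + e = e")
    case False
    have "w + e \<in> A" using that e(1) Suc.prems(3) by (auto intro: subsetD set_plus_intro)
    then have "deg (w + e) \<le> deg e" using e(2) False by blast
    then have "w = 0" by (cases w; cases e) (simp add: deg_def zero_prod_def)
    then show ?thesis by simp
  qed auto
  then have WD: "W + insert e D \<subseteq> insert e D" using Suc.prems(4) by (fastforce simp: set_plus_def)
  have A: "A - D = insert e (A - insert e D)" using e(1) by auto
  have c: "card (A - insert e D) = c"
    using Suc.hyps(2) Suc.prems(1) unfolding A by (subst (asm) card_insert_disjoint) auto
  obtain B where B: "B 0 = insert e D"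
     "\<forall>i\<le>c. W + B i \<subseteq> B i \<and> insert e D \<subseteq> B i \<and> B i \<subseteq> A" "\<forall>i<c. B i \<subset> B (Suc i)"
    using Suc.hyps(1)[of "insert e D"] Suc.prems e(1) WD c by (auto simp: finite_subset)
  define B' where "B' i = (case i of 0 \<Rightarrow> D | Suc j \<Rightarrow> B j)" for i
  have "W + B' i \<subseteq> B' i \<and> D \<subseteq> B' i \<and> B' i \<subseteq> A" if "i \<le> Suc c" for i
    using that B(2) Suc.prems by (cases i) (auto simp: B'_def)
  moreover have "B' i \<subset> B' (Suc i)" if "i < Suc c" for i
    using that B(1,3) e(1) by (cases i) (auto simp: B'_def)
  ultimately show ?case unfolding Suc.hyps(2)[symmetric]
    by (intro exI[of _ B']) (simp add: B'_def)
qed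

lemma coeff_ring_series:
  assumes "0 \<in> W" "W + W \<subseteq> W"
  shows "coeff_ring (series W)"
proof
  show one: "1 \<in> series W"
  proof -
    have "monom_xy 0 0 \<in> series W" using assms(1) by (simp add: zero_prod_def)
    then show ?thesis by (simp add: monom_xy_def)
  qed
  show "const_xy c \<in> series W" for c using series_const_mult[OF one, of c] by simp
  show "f * g \<in> series W" if "f \<in> series W" "g \<in> series W" for f g
    using series_mult[OF that] series_mono[OF assms(2)] by blast
qed (auto simp: series_add series_uminus)

lemma stable_series:
  fixes W :: "(nat \<times> nat) set"
  assumes "0 \<in> W" "W + W \<subseteq> W" "W + E \<subseteq> E"
  shows "coeff_ring.stable (series W :: 'k::field fps fps set) E"
proof -
  interpret coeff_ring "series W :: 'k fps fps set" by (rule coeff_ring_series[OF assms(1,2)])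
  show ?thesis unfolding stable_def using series_mult series_mono[OF assms(3)] by blast
qed

text \<open>The chain of \<open>exps_chain\<close> has this length, and along any chain of submodules the set of
  leading exponents outside \<open>D\<close> grows strictly.\<close>
theorem module_length_series_quot:
  fixes A D W :: "(nat \<times> nat) set"
  assumes W: "0 \<in> W" "W + W \<subseteq> W" and A: "W + A \<subseteq> A" and D: "W + D \<subseteq> D" "D \<subseteq> A" and fin: "finite (A - D)"
  shows "module_length (ring_S\<lparr>carrier := series W :: 'k::field fps fps set\<rparr>)
           (quot_module (series_module A) (series D)) = enat (card (A - D))"
proof -
  interpret coeff_ring "series W :: 'k fps fps set" by (rule coeff_ring_series[OF W])
  have stA: "stable A" and stD: "stable D" using W A D by (auto intro: stable_series)
  let ?Q = "quot_module (series_module A) (series D :: 'k fps fps set)"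
  let ?S = "{k. \<exists>N :: nat \<Rightarrow> 'k fps fps set set.
     (\<forall>i\<le>k. submodule R (N i) ?Q) \<and> (\<forall>i<k. N i \<subset> N (Suc i))}"
  have upper: "k \<le> card (A - D)" if "k \<in> ?S" for k
  proof -
    from that obtain N :: "nat \<Rightarrow> 'k fps fps set set"
      where N: "\<And>i. i \<le> k \<Longrightarrow> submodule R (N i) ?Q" "\<And>i. i < k \<Longrightarrow> N i \<subset> N (Suc i)" by blast
    let ?U = "\<lambda>i. pullback A D (N i)"
    have "leading_exps (A - D) (?U i) \<subset> leading_exps (A - D) (?U (Suc i))" if "i < k" for i
    proof (rule leading_exps_strict)
      have Ni: "submodule R (N i) ?Q" "submodule R (N (Suc i)) ?Q" using N(1) that by auto
      note p = pullback_submodule[OF stA stD D(2) Ni(1)]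
      note p' = pullback_submodule[OF stA stD D(2) Ni(2)]
      show "?U i \<subset> ?U (Suc i)" by (rule pullback_strict[OF stA stD D(2) Ni(2) N(2)[OF that]])
      show "f + g \<in> ?U i" if "f \<in> ?U i" "g \<in> ?U i" for f g using p(1) that by blast
      show "f + g \<in> ?U (Suc i)" if "f \<in> ?U (Suc i)" "g \<in> ?U (Suc i)" for f g using p'(1) that by blast
      show "const_xy c * f \<in> ?U i" if "f \<in> ?U i" for c f using p(2) const that by blast
      show "const_xy c * f \<in> ?U (Suc i)" if "f \<in> ?U (Suc i)" for c f using p'(2) const that by blast
      show "f \<in> ?U i" if "f \<in> ?U (Suc i)" "\<forall>e\<in>A - D. f $ snd e $ fst e = 0" for f
      proof -
        have "f \<in> series A" using that(1) by (simp add: pullback_def[OF stA stD D(2)])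
        then have "f \<in> series D" using that(2) by (force simp: series_def)
        then show ?thesis using p(3) by blast
      qed
    qed (rule fin)
    then have "i \<le> card (leading_exps (A - D) (?U i))" if "i \<le> k" for i
      using that
    proof (induction i)
      case (Suc i)
      have "finite (leading_exps (A - D) (?U (Suc i)))"
        using fin by (rule finite_subset[rotated]) (auto simp: leading_exps_def)
      then have "card (leading_exps (A - D) (?U i)) < card (leading_exps (A - D) (?U (Suc i)))"
        using Suc.prems by (intro psubset_card_mono Suc.prems(1)) (simp_all add: Suc(1) Suc_le_eq Suc.prems \<open>\<And>i. i < k \<Longrightarrow> leading_exps (A - D) (?U i) \<subset> leading_exps (A - D) (?U (Suc i))\<close>)
      then show ?case using Suc by simp
    qed simp
    moreover have "card (leading_exps (A - D) (?U k)) \<le> card (A - D)"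
      using fin by (intro card_mono) (auto simp: leading_exps_def)
    ultimately show ?thesis by (meson le_trans order_refl)
  qed
  have "card (A - D) \<in> ?S"
  proof -
    obtain B where B: "\<forall>i\<le>card (A - D). W + B i \<subseteq> B i \<and> D \<subseteq> B i \<and> B i \<subseteq> A"
      "\<forall>i<card (A - D). B i \<subset> B (Suc i)"
      using exps_chain[OF fin D(2) A D(1)] by blast
    have "submodule R (coset D ` series (B i)) ?Q" if "i \<le> card (A - D)" for i
      using B(1) that by (intro submodule_quot_series stA stD D(2) stable_series W) auto
    moreover have "coset D ` series (B i) \<subset> coset D ` series (B (Suc i))" if "i < card (A - D)" for i
      using B that by (intro quot_series_strict[OF stA stD D(2)]) (auto simp: Suc_le_eq)
    ultimately show ?thesis by (intro CollectI exI[of _ "\<lambda>i. coset D ` series (B i)"]) blast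
  qed
  then have "Sup (enat ` ?S) = enat (card (A - D))"

  proof (intro antisym Sup_least Sup_upper)
    fix x assume "x \<in> enat ` ?S"
    then obtain k where "x = enat k" "k \<in> ?S" by (rule imageE)
    then show "x \<le> enat (card (A - D))" using upper[of k] by (simp only: enat_ord_simps)
  qed (rule imageI)
  then show ?thesis by (simp only: module_length_def)
qed

lemma coeff_ring_const: "coeff_ring (range (const_xy :: 'k::field \<Rightarrow> _))"
proof
  show "0 \<in> range (const_xy :: 'k \<Rightarrow> _)" by (rule image_eqI[of _ _ 0]) (simp_all add: const_xy_def)
  show "1 \<in> range (const_xy :: 'k \<Rightarrow> _)" by (rule image_eqI[of _ _ 1]) (simp_all add: const_xy_def)
  fix f g :: "'k fps fps" assume "f \<in> range const_xy" "g \<in> range const_xy"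
  then obtain c d where cd: "f = const_xy c" "g = const_xy d" by blast
  show "f + g \<in> range const_xy" using cd by (intro image_eqI[of _ _ "c + d"]) (simp_all add: const_xy_def)
  show "f * g \<in> range const_xy" using cd by (intro image_eqI[of _ _ "c * d"]) (simp_all add: const_xy_def)
  show "- f \<in> range const_xy" using cd by (intro image_eqI[of _ _ "- c"]) (simp_all add: const_xy_def)
qed auto

lemma field_field_k: "field (field_k :: 'k::field fps fps ring)"
proof -
  interpret coeff_ring "range (const_xy :: 'k \<Rightarrow> _)" by (rule coeff_ring_const)
  interpret cring R by (rule cring_R)
  show ?thesis unfolding field_k_def
  proof (rule cring_fieldI2)
    show "\<zero>\<^bsub>R\<^esub> \<noteq> \<one>\<^bsub>R\<^esub>" by simp
    fix f assume "f \<in> carrier R" "f \<noteq> \<zero>\<^bsub>R\<^esub>"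
    then obtain c where c: "f = const_xy c" "c \<noteq> 0" by (auto simp: const_xy_def)
    then have "f * const_xy (inverse c) = 1" by (simp add: const_xy_def)
    then show "\<exists>g\<in>carrier R. f \<otimes>\<^bsub>R\<^esub> g = \<one>\<^bsub>R\<^esub>" by auto
  qed
qed

text \<open>The classes of the monomials with exponents in \<open>A - D\<close> form a basis.\<close>
theorem dim_series_quot:
  fixes A D :: "(nat \<times> nat) set"
  assumes DA: "D \<subseteq> A" and fin: "finite (A - D)"
  shows "vectorspace.dim field_k (quot_module (series_module A) (series D :: 'k::field fps fps set)) = card (A - D)"
proof -
  interpret coeff_ring "range (const_xy :: 'k \<Rightarrow> _)" by (rule coeff_ring_const)
  have st: "stable E" for E by (auto simp: stable_def series_const_mult)
  let ?Q = "quot_module (series_module A) (series D :: 'k fps fps set)"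
  note quot = quot_carrier[OF st st DA] quot_zero[OF st st DA] quot_add[OF st st DA] quot_smult[OF st st DA]
  have RK: "R = field_k" by (simp add: field_k_def)
  interpret Q: vectorspace R ?Q
    using module_quot[OF st st DA] field_field_k unfolding RK by (simp add: vectorspace_def)
  define b :: "nat \<times> nat \<Rightarrow> 'k fps fps set" where "b e = coset D (monom_xy (fst e) (snd e))" for e
  have b_in: "b e \<in> carrier ?Q" if "e \<in> A" for e
    using that by (simp add: b_def quot)
  have inj: "inj_on b (A - D)"
  proof (rule inj_onI)
    fix e e' assume e: "e \<in> A - D" "e' \<in> A - D" "b e = b e'"
    show "e = e'"
    proof (rule ccontr)
      assume "e \<noteq> e'"
      moreover have "(monom_xy (fst e) (snd e) - monom_xy (fst e') (snd e') :: 'k fps fps) \<in> series D"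
        using e(3) by (simp add: b_def coset_eq_iff)
      ultimately have "(monom_xy (fst e) (snd e) - monom_xy (fst e') (snd e') :: 'k fps fps) $ snd e $ fst e = 0"
        using e(1) by (intro seriesD) auto
      then show False using \<open>e \<noteq> e'\<close> by (auto simp: monom_xy_nth prod_eq_iff split: if_splits)
    qed
  qed
  let ?B = "b ` (A - D)"
  have lc: "Q.lincomb (\<lambda>C. const_xy (c C)) ?B =
      coset D (\<Sum>e\<in>A - D. const_xy (c (b e)) * monom_xy (fst e) (snd e))" for c :: "_ \<Rightarrow> 'k"
  proof -
    have "Q.lincomb (\<lambda>C. const_xy (c C)) ?B = finsum ?Q (\<lambda>e. const_xy (c (b e)) \<odot>\<^bsub>?Q\<^esub> b e) (A - D)"
      unfolding Q.lincomb_def by (rule Q.finsum_reindex) (auto intro!: inj Q.smult_closed b_in)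
    also have "\<dots> = finsum ?Q (\<lambda>e. coset D (const_xy (c (b e)) * monom_xy (fst e) (snd e))) (A - D)"
      by (rule Q.finsum_cong') (auto simp: b_def quot intro!: imageI series_const_mult)
    also have "\<dots> = coset D (\<Sum>e\<in>A - D. const_xy (c (b e)) * monom_xy (fst e) (snd e))"
      by (rule quot_finsum[OF st st DA fin]) (auto intro!: series_const_mult)
    finally show ?thesis .
  qed
  have coeff: "(\<Sum>e\<in>A - D. const_xy (c e) * monom_xy (fst e) (snd e)) $ j $ i =
      (if (i, j) \<in> A - D then c (i, j) else 0)" for c :: "_ \<Rightarrow> 'k" and i j
  proof -
    have "(\<Sum>e\<in>A - D. const_xy (c e) * monom_xy (fst e) (snd e)) $ j $ i =
        (\<Sum>e\<in>A - D. if e = (i, j) then c e else 0)"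
      unfolding fps_sum_nth by (intro sum.cong refl) (auto simp: const_xy_mult_nth monom_xy_nth)
    then show ?thesis using fin by (simp add: sum.delta)
  qed
  have "Q.basis ?B"
    unfolding Q.basis_def
  proof (intro conjI)
    show "\<not> Q.lin_dep ?B"
    proof (rule Q.finite_lin_indpt2)
      fix x assume x: "x \<in> ?B \<rightarrow> carrier R" "Q.lincomb x ?B = \<zero>\<^bsub>?Q\<^esub>"
      define c where "c C = (SOME d. x C = const_xy d)" for C
      have c: "x C = const_xy (c C)" if "C \<in> ?B" for C
        unfolding c_def by (rule someI_ex) (use x(1) that in auto)
      have "Q.lincomb x ?B = Q.lincomb (\<lambda>C. const_xy (c C)) ?B"
        by (rule Q.lincomb_cong) (auto simp: c intro: b_in)
      then have "(\<Sum>e\<in>A - D. const_xy (c (b e)) * monom_xy (fst e) (snd e)) \<in> series D"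
        using x(2) series_uminus[of "- sum _ _"] unfolding lc quot(2) by (fastforce simp: coset_eq_iff)
      then have "c (b e) = 0" if "e \<in> A - D" for e
        using seriesD[of "\<Sum>e\<in>A - D. const_xy (c (b e)) * monom_xy (fst e) (snd e)" D "fst e" "snd e"]
          that coeff[of "\<lambda>e. c (b e)" "snd e" "fst e"] by auto
      then show "\<forall>v\<in>?B. x v = \<zero>\<^bsub>R\<^esub>" using c by (auto simp: const_xy_def)
    qed (use fin b_in in auto)
    show "Q.span ?B = carrier ?Q"
    proof
      show "Q.span ?B \<subseteq> carrier ?Q" by (rule Q.span_is_subset2) (auto intro: b_in)
      show "carrier ?Q \<subseteq> Q.span ?B"
      proof
        fix z assume "z \<in> carrier ?Q"
        then obtain f where f: "f \<in> series A" "z = coset D f" by (auto simp: quot)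
        define c where "c C = (let e = inv_into (A - D) b C in f $ snd e $ fst e)" for C
        have c: "c (b e) = f $ snd e $ fst e" if "e \<in> A - D" for e
          using inj that by (simp add: c_def)
        have "f - (\<Sum>e\<in>A - D. const_xy (c (b e)) * monom_xy (fst e) (snd e)) \<in> series D"
          unfolding series_def
        proof (intro CollectI allI impI)
          fix i j assume "(f - (\<Sum>e\<in>A - D. const_xy (c (b e)) * monom_xy (fst e) (snd e))) $ j $ i \<noteq> 0"
          then have nz: "f $ j $ i \<noteq> (if (i, j) \<in> A - D then c (b (i, j)) else 0)"
            by (simp add: coeff[of "\<lambda>e. c (b e)"])
          then have "(i, j) \<notin> A - D" using c[of "(i, j)"] by (auto split: if_splits)
          moreover from this have "(i, j) \<in> A" using nz f(1) by (auto simp: series_def)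
          ultimately show "(i, j) \<in> D" by simp
        qed
        then have "z = Q.lincomb (\<lambda>C. const_xy (c C)) ?B" unfolding f(2) lc by (simp add: coset_eq_iff)
        then show "z \<in> Q.span ?B" using fin unfolding Q.span_def by auto
      qed
    qed
  qed (auto intro: b_in)
  then have "Q.dim = card ?B" using fin by (intro Q.dim_basis) auto
  then show ?thesis using inj by (simp add: card_image RK)
qed

section \<open>The invariant ring and its modules\<close>

context coeff_ring
begin

lemma ideal_iff:
  "ideal N R \<longleftrightarrow> N \<subseteq> C \<and> 0 \<in> N \<and> (\<forall>f\<in>N. \<forall>g\<in>N. f + g \<in> N) \<and> (\<forall>c\<in>C. \<forall>f\<in>N. c * f \<in> N)"
proof
  assume "ideal N R"
  then interpret I: ideal N R .
  have sub: "additive_subgroup N R" by (rule I.additive_subgroup_axioms)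
  show "N \<subseteq> C \<and> 0 \<in> N \<and> (\<forall>f\<in>N. \<forall>g\<in>N. f + g \<in> N) \<and> (\<forall>c\<in>C. \<forall>f\<in>N. c * f \<in> N)"
    using I.a_subset I.I_l_closed additive_subgroup.zero_closed[OF sub] additive_subgroup.a_closed[OF sub]
    by auto
next
  assume N: "N \<subseteq> C \<and> 0 \<in> N \<and> (\<forall>f\<in>N. \<forall>g\<in>N. f + g \<in> N) \<and> (\<forall>c\<in>C. \<forall>f\<in>N. c * f \<in> N)"
  interpret cring R by (rule cring_R)
  have minus: "\<ominus>\<^bsub>R\<^esub> f = - f" if "f \<in> C" for f
    by (rule minus_equality) (use that in \<open>auto simp: uminus\<close>)
  have neg: "- f \<in> N" if "f \<in> N" for f
    using N that uminus[OF one] by (metis mult_minus1)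
  show "ideal N R"
  proof (rule idealI)
    show "subgroup N (add_monoid R)"
      by (rule add.subgroupI) (use N neg minus in \<open>auto simp flip: a_inv_def\<close>)
    show "f \<otimes>\<^bsub>R\<^esub> c \<in> N" if "f \<in> N" "c \<in> carrier R" for f c
      using N that by (simp add: mult.commute[of f])
  qed (use N ring_axioms in auto)
qed

lemma span_subset:
  assumes "stable E" "X \<subseteq> series E" "X \<subseteq> N" "N \<subseteq> series E" "0 \<in> N"
    "\<And>f g. f \<in> N \<Longrightarrow> g \<in> N \<Longrightarrow> f + g \<in> N" "\<And>c f. c \<in> C \<Longrightarrow> f \<in> N \<Longrightarrow> c * f \<in> N"
  shows "module.span R (series_module E) X \<subseteq> N"
  using assms by (intro module.span_is_subset module_series) (auto simp: submodule_iff)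

lemma span_closed:
  assumes "stable E" "X \<subseteq> series E"
  shows "X \<subseteq> module.span R (series_module E) X"
    and "module.span R (series_module E) X \<subseteq> series E"
    and "0 \<in> module.span R (series_module E) X"
    and "f \<in> module.span R (series_module E) X \<Longrightarrow> g \<in> module.span R (series_module E) X \<Longrightarrow>
         f + g \<in> module.span R (series_module E) X"
    and "c \<in> C \<Longrightarrow> f \<in> module.span R (series_module E) X \<Longrightarrow> c * f \<in> module.span R (series_module E) X"
proof -
  interpret M: module R "series_module E" by (rule module_series[OF assms(1)])
  show "X \<subseteq> M.span X" using assms(2) by (intro M.in_own_span) simp
  show sub: "M.span X \<subseteq> series E" using M.span_is_subset2[of X] assms(2) by simp
  have "submodule R (M.span X) (series_module E)" using assms(2) by (intro M.span_is_submodule) simp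
  then show "0 \<in> M.span X" "f \<in> M.span X \<Longrightarrow> g \<in> M.span X \<Longrightarrow> f + g \<in> M.span X"
    "c \<in> C \<Longrightarrow> f \<in> M.span X \<Longrightarrow> c * f \<in> M.span X"
    unfolding submodule_iff[OF assms(1) sub] by blast+
qed

end

locale cyclic_action =
  fixes n a :: nat and \<zeta> :: "'k::field"
  assumes prim: "primitive_root_of_unity n \<zeta>"
begin

abbreviation "W \<equiv> weight_class n a"
abbreviation "P \<equiv> invariant_exps n a"

lemma n_pos: "n > 0"
  using prim by (simp add: primitive_root_of_unity_def)

lemma root_power_eq_1_iff: "\<zeta> ^ m = 1 \<longleftrightarrow> n dvd m"
proof
  have \<zeta>n: "\<zeta> ^ n = 1" using prim by (simp add: primitive_root_of_unity_def)
  have "\<zeta> ^ m = (\<zeta> ^ n) ^ (m div n) * \<zeta> ^ (m mod n)"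
    by (simp flip: power_mult power_add)
  then have *: "\<zeta> ^ m = \<zeta> ^ (m mod n)" using \<zeta>n by simp
  show "n dvd m" if "\<zeta> ^ m = 1"
  proof (rule ccontr)
    assume "\<not> n dvd m"
    then have "0 < m mod n" "m mod n < n" using n_pos by (auto simp: mod_eq_0_iff_dvd intro: gr0I)
    then show False using prim * that by (simp add: primitive_root_of_unity_def)
  qed
  show "\<zeta> ^ m = 1" if "n dvd m" using * that by simp
qed

lemma carrier_ring_R: "carrier (ring_R \<zeta> a) = series (W 0)"
proof -
  have sig: "sigma \<zeta> a f = f \<longleftrightarrow> f \<in> series (W 0)" for f
  proof -
    have "sigma \<zeta> a f = f \<longleftrightarrow> (\<forall>j i. \<zeta> ^ (i + j * a) * f $ j $ i = f $ j $ i)"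
      by (simp add: sigma_def fps_eq_iff power_add power_mult mult.commute[of _ a])
    also have "\<dots> \<longleftrightarrow> (\<forall>j i. f $ j $ i \<noteq> 0 \<longrightarrow> n dvd i + j * a)"
      by (simp flip: root_power_eq_1_iff) metis
    also have "\<dots> \<longleftrightarrow> f \<in> series (W 0)"
      by (auto simp: series_def weight_class_def cong_0_iff)
    finally show ?thesis .
  qed
  have "(\<forall>g\<in>group_G \<zeta> a. g f = f) \<longleftrightarrow> sigma \<zeta> a f = f" for f
  proof
    assume "\<forall>g\<in>group_G \<zeta> a. g f = f"
    moreover have "sigma \<zeta> a ^^ 1 \<in> group_G \<zeta> a" unfolding group_G_def by (rule rangeI)
    ultimately have "(sigma \<zeta> a ^^ 1) f = f" by blast
    then show "sigma \<zeta> a f = f" by simp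
  next
    assume *: "sigma \<zeta> a f = f"
    have "(sigma \<zeta> a ^^ k) f = f" for k by (induction k) (simp_all add: *)
    then show "\<forall>g\<in>group_G \<zeta> a. g f = f" by (auto simp: group_G_def)
  qed
  then show ?thesis using sig by (auto simp: ring_R_def)
qed

lemma W0_plus: "W 0 + W t \<subseteq> W t" by (simp add: weight_class_0_plus)

sublocale coeff_ring "series (W 0) :: 'k fps fps set"
  by (rule coeff_ring_series[OF zero_in_weight_class W0_plus])

lemma ring_R_eq: "ring_R \<zeta> a = R"
  using carrier_ring_R by (simp add: ring_R_def)

lemma stableI: "W 0 + E \<subseteq> E \<Longrightarrow> stable E"
  by (rule stable_series[OF zero_in_weight_class W0_plus])

lemma stable_W: "stable (W t)" by (rule stableI[OF W0_plus])

lemma stable_S: "stable UNIV" by (rule stableI) simp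

lemma fg_imp_stable: "fg_exps (W 0) E \<Longrightarrow> stable E"
  by (rule stableI) (simp add: fg_exps_def)

lemma ring_S_module: "ring_as_module ring_S = series_module UNIV"
  by (simp add: series_module_def ring_as_module_def series_def ring_S_def)

text \<open>A monomial submodule is contained in every submodule that contains its monomials, although
  its elements are infinite series: by finite generation, finitely many monomials with
  coefficients in \<open>R\<close> give all of them.\<close>
lemma generated_series:
  assumes E: "fg_exps (W 0) E" and X: "\<And>i j. (i, j) \<in> E \<Longrightarrow> monom_xy i j \<in> N"
    and N: "0 \<in> N" "\<And>f g. f \<in> N \<Longrightarrow> g \<in> N \<Longrightarrow> f + g \<in> N"
      "\<And>c f. c \<in> series (W 0) \<Longrightarrow> f \<in> N \<Longrightarrow> c * f \<in> N"
  shows "series E \<subseteq> (N :: 'k fps fps set)"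
proof -
  obtain F where F: "finite F" "F \<subseteq> E" "E \<subseteq> F + W 0" using E by (auto simp: fg_exps_def)
  show ?thesis
    by (rule series_subsetI[OF F(1,3) N(1,2)]) (use F(2) X N(3) in \<open>auto simp: mult.commute[of "monom_xy _ _"]\<close>)
qed

lemma module_M_eq: "module_M n \<zeta> a t = series_module (W t)"
proof -
  let ?X = "{monom_xy i j | i j. [i + j * a = t] (mod n)} :: 'k fps fps set"
  let ?N = "module.span R (series_module UNIV) ?X"
  have X: "?X \<subseteq> series (W t)" by (auto simp: weight_class_def)
  have U: "?X \<subseteq> series UNIV" by (simp add: series_def)
  have "?N \<subseteq> series (W t)"
    by (rule span_subset[OF stable_S U X])
      (auto simp: series_add stableD[OF stable_W] series_mono[THEN subsetD, of "W t" UNIV])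
  moreover have "series (W t) \<subseteq> ?N"
  proof (rule generated_series[OF fg_weight_class[OF n_pos]])
    show "monom_xy i j \<in> ?N" if "(i, j) \<in> W t" for i j
      using that span_closed(1)[OF stable_S U] by (auto simp: weight_class_def)
  qed (use span_closed(3-5)[OF stable_S U] in auto)
  ultimately have "?N = series (W t)" by blast
  then show ?thesis
    by (simp add: module_M_def ring_R_eq ring_S_module) (simp add: series_module_def)
qed

lemma ring_as_module_R: "ring_as_module (ring_R \<zeta> a) = series_module (W 0)"
  by (simp add: ring_R_eq ring_as_module_def series_module_def ring_S_def)

lemma finitely_generated_series:
  assumes "fg_exps (W 0) E"
  shows "finitely_generated R (series_module E :: ('k fps fps, _) module)"
proof -
  obtain F where F: "finite F" "F \<subseteq> E" "E \<subseteq> F + W 0" using assms by (auto simp: fg_exps_def)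
  define X :: "'k fps fps set" where "X = (\<lambda>e. monom_xy (fst e) (snd e)) ` F"
  have st: "stable E" by (rule fg_imp_stable[OF assms])
  have X: "X \<subseteq> series E" using F by (auto simp: X_def)
  have "series E \<subseteq> module.span R (series_module E) X"
  proof (rule series_subsetI[OF F(1,3)])
    fix i j and b :: "'k fps fps" assume ij: "(i, j) \<in> F" and b: "b \<in> series (W 0)"
    have "(monom_xy i j :: 'k fps fps) \<in> X" using ij by (auto simp: X_def intro!: image_eqI[of _ _ "(i, j)"])
    then show "monom_xy i j * b \<in> module.span R (series_module E) X"
      using span_closed(1,5)[OF st X] b by (subst mult.commute) blast
  qed (use span_closed(3,4)[OF st X] in auto)
  then have "module.span R (series_module E) X = carrier (series_module E)"
    using span_closed(2)[OF st X] by auto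
  then show ?thesis unfolding finitely_generated_def
    using X F by (intro exI[of _ X]) (auto simp: X_def)
qed

text \<open>The projection onto series with exponents in \<open>W t\<close> is \<open>R\<close>-linear; it brings identities in
  \<open>\<bbbk>[[x, y]]\<close> back to \<open>R\<close> and its modules.\<close>
lemma restrict_mult:
  assumes "f \<in> series (W 0)"
  shows "restrict_series (W t) (f * g) = f * restrict_series (W t) g"
proof (rule fps2_eqI)
  fix i j
  have "f $ q $ p * restrict_series (W t) g $ (j - q) $ (i - p) =
      (if (i, j) \<in> W t then f $ q $ p * g $ (j - q) $ (i - p) else 0)" if "q \<le> j" "p \<le> i" for p q
  proof (cases "(p, q) \<in> W 0")
    case True
    have "(i - p, j - q) \<in> W t \<longleftrightarrow> (i, j) \<in> W t"
      using weight_class_diff[of i j n a t p q 0] weight_class_add[OF True, of "(i - p, j - q)" t] True that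
      by auto
    then show ?thesis by simp
  next
    case False
    then show ?thesis using assms by (simp add: seriesD)
  qed
  then show "restrict_series (W t) (f * g) $ j $ i = (f * restrict_series (W t) g) $ j $ i"
    unfolding fps2_mult_nth restrict_series_nth[of _ "f * g"] by (auto simp del: restrict_series_nth)
qed

lemma in_series_P_iff: "f \<in> series (W 0) \<Longrightarrow> f \<in> series P \<longleftrightarrow> f $ 0 $ 0 = 0"
  by (auto simp: series_def invariant_exps_def zero_prod_def) (metis gr0I)

text \<open>The inverse exists in \<open>\<bbbk>[[x, y]]\<close>, and its projection to \<open>R\<close> is again an inverse.\<close>
lemma invertible_R:
  fixes f :: "'k fps fps"
  assumes "f \<in> series (W 0)" "f \<notin> series P"
  shows "\<exists>g\<in>series (W 0). f * g = 1"
proof -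
  have "f $ 0 $ 0 \<noteq> 0" using assms in_series_P_iff by blast
  then have "f $ 0 * inverse (f $ 0) = 1" by (rule inverse_mult_eq_1')
  from fps_right_inverse[OF this] obtain g where g: "f * g = 1" by blast
  have "f * restrict_series (W 0) g = restrict_series (W 0) (f * g)"
    by (rule restrict_mult[OF assms(1), symmetric])
  also have "\<dots> = 1" unfolding g by (rule restrict_series_id[OF one])
  finally show ?thesis using restrict_series_in by blast
qed

lemma P_subset: "series P \<subseteq> series (W 0)"
  by (rule series_mono) (auto simp: invariant_exps_def)

lemma ideal_P: "ideal (series P) R"
  unfolding ideal_iff using P_subset
  by (auto simp: series_add stableD[OF stableI[OF invariant_exps_ideal]])

lemma ideal_subset_P:
  assumes "ideal N R" "N \<noteq> series (W 0)"
  shows "N \<subseteq> series P"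
proof (rule ccontr)
  note N = assms(1)[unfolded ideal_iff]
  assume "\<not> N \<subseteq> series P"
  then obtain f where "f \<in> N" "f \<notin> series P" by blast
  moreover from this obtain g where "g \<in> series (W 0)" "f * g = 1"
    using invertible_R[of f] N by blast
  ultimately have "1 \<in> N" using N by (metis mult.commute)
  then have "f \<in> N" if "f \<in> series (W 0)" for f using N that by (metis mult.right_neutral)
  then show False using N assms(2) by blast
qed

lemma one_notin_P: "(1 :: 'k fps fps) \<notin> series P"
  by (simp add: in_series_P_iff[OF one])

lemma max_ideal_R: "max_ideal R = series P"
  unfolding max_ideal_def
proof (rule the_equality)
  show "maximalideal (series P) R"
  proof (rule maximalidealI[OF ideal_P])
    show "carrier R \<noteq> series P" using one one_notin_P by auto
    fix J assume J: "ideal J R" "series P \<subseteq> J" "J \<subseteq> carrier R"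
    then show "J = series P \<or> J = carrier R" using ideal_subset_P[OF J(1)] by auto
  qed
  fix J assume "maximalideal J R"
  then interpret J: maximalideal J R .
  have "J \<subseteq> series P" using ideal_subset_P[OF J.is_ideal] J.I_notcarr by auto
  then show "J = series P"
    using J.I_maximal[OF ideal_P] P_subset one one_notin_P by auto
qed

lemma ideal_prod_series:
  assumes D: "D \<subseteq> W 0" and DE: "fg_exps (W 0) (D + E)" and E: "E \<subseteq> W 0" and D': "W 0 + D \<subseteq> D"
  shows "ideal_prod R (series D) (series E) = (series (D + E) :: 'k fps fps set)"
proof
  show "ideal_prod R (series D) (series E) \<subseteq> (series (D + E) :: 'k fps fps set)"
  proof
    fix x :: "'k fps fps" assume "x \<in> ideal_prod R (series D) (series E)"
    then show "x \<in> series (D + E)"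
      by induction (auto intro: series_mult series_add)
  qed
  show "(series (D + E) :: 'k fps fps set) \<subseteq> ideal_prod R (series D) (series E)"
  proof (rule generated_series[OF DE])
    let ?N = "ideal_prod R (series D) (series E)"
    have prod: "f * g \<in> ?N" if "f \<in> series D" "g \<in> series E" for f g
      using ideal_prod.prod[OF that, of R] by simp
    show "monom_xy i j \<in> ?N" if ij: "(i, j) \<in> D + E" for i j
    proof -
      obtain p q p' q' where "(p, q) \<in> D" "(p', q') \<in> E" "i = p + p'" "j = q + q'"
        using ij by (auto elim!: set_plus_elim)
      then show ?thesis using prod by (simp add: monom_xy_add)
    qed
    show "0 \<in> ?N" using prod[of 0 0] by simp
    show add: "f + g \<in> ?N" if "f \<in> ?N" "g \<in> ?N" for f g using ideal_prod.sum[OF that] by simp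
    show "c * f \<in> ?N" if "c \<in> series (W 0)" "f \<in> ?N" for c f
      using that(2)
    proof induction
      case (prod i j)
      have "c * i \<in> series D" using stableD[OF stableI[OF D'] that(1) prod(1)] .
      then show ?case using \<open>\<And>g f. f \<in> series D \<Longrightarrow> g \<in> series E \<Longrightarrow> f * g \<in> ?N\<close> prod(2)
        by (simp flip: mult.assoc)
    next
      case (sum s1 s2)
      then show ?case using add by (simp add: distrib_left)
    qed
  qed
qed

lemma fg_W: "fg_exps (W 0) (W t)" and fg_power: "fg_exps (W 0) (power_exps n a k t)"
  by (rule fg_weight_class[OF n_pos] fg_power_exps[OF n_pos])+

lemma ideal_power_P: "ideal_power R (series P) k = (series (power_exps n a k 0) :: 'k fps fps set)"
proof (induction k)
  case (Suc k)
  have "ideal_power R (series P) (Suc k) = ideal_prod R (series P) (series (power_exps n a k 0))"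
    using Suc by (simp add: ideal_power_def)
  also have "\<dots> = series (P + power_exps n a k 0)"
    using fg_power[of "Suc k" 0] power_exps_subset invariant_exps_ideal
    by (intro ideal_prod_series) (auto simp: power_exps_Suc invariant_exps_def)
  finally show ?case by (simp add: power_exps_Suc)
qed (simp add: ideal_power_def power_exps_0)

text \<open>The defining properties of \<open>IM\<close> as the submodule generated by the products.\<close>
lemma ideal_smult_closed:
  assumes st: "stable E" and I: "I \<subseteq> series (W 0)"
  shows "f \<in> I \<Longrightarrow> g \<in> series E \<Longrightarrow> f * g \<in> ideal_smult R I (series_module E)"
    and "ideal_smult R I (series_module E) \<subseteq> series E"
    and "0 \<in> ideal_smult R I (series_module E)"
    and "f \<in> ideal_smult R I (series_module E) \<Longrightarrow> g \<in> ideal_smult R I (series_module E) \<Longrightarrow>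
          f + g \<in> ideal_smult R I (series_module E)"
    and "c \<in> series (W 0) \<Longrightarrow> f \<in> ideal_smult R I (series_module E) \<Longrightarrow>
          c * f \<in> ideal_smult R I (series_module E)"
proof -
  let ?X = "{r * x | r x. r \<in> I \<and> x \<in> series E}"
  have eq: "ideal_smult R I (series_module E) = module.span R (series_module E) ?X"
    by (simp add: ideal_smult_def)
  have X: "?X \<subseteq> series E" using I stableD[OF st] by auto
  note sp = span_closed[OF st X, folded eq]
  show "f \<in> I \<Longrightarrow> g \<in> series E \<Longrightarrow> f * g \<in> ideal_smult R I (series_module E)" using sp(1) by auto
  show "ideal_smult R I (series_module E) \<subseteq> series E" by (rule sp(2))
  show "0 \<in> ideal_smult R I (series_module E)" by (rule sp(3))
  show "f \<in> ideal_smult R I (series_module E) \<Longrightarrow> g \<in> ideal_smult R I (series_module E) \<Longrightarrow>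
          f + g \<in> ideal_smult R I (series_module E)" by (rule sp(4))
  show "c \<in> series (W 0) \<Longrightarrow> f \<in> ideal_smult R I (series_module E) \<Longrightarrow>
          c * f \<in> ideal_smult R I (series_module E)" by (rule sp(5))
qed

lemma ideal_smult_subset:
  assumes "stable E" "I \<subseteq> series (W 0)" and "N \<subseteq> series E" "0 \<in> N"
    "\<And>f g. f \<in> I \<Longrightarrow> g \<in> series E \<Longrightarrow> f * g \<in> N"
    "\<And>f g. f \<in> N \<Longrightarrow> g \<in> N \<Longrightarrow> f + g \<in> N" "\<And>c f. c \<in> series (W 0) \<Longrightarrow> f \<in> N \<Longrightarrow> c * f \<in> N"
  shows "ideal_smult R I (series_module E) \<subseteq> (N :: 'k fps fps set)"
  unfolding ideal_smult_def
  by (rule span_subset[OF assms(1)]) (use assms in \<open>auto intro: stableD\<close>)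

lemma ideal_smult_series:
  assumes D: "D \<subseteq> W 0" and DE: "fg_exps (W 0) (D + E)" and E: "W 0 + E \<subseteq> E"
  shows "ideal_smult R (series D) (series_module E) = (series (D + E) :: 'k fps fps set)"
proof
  have st: "stable E" by (rule stableI[OF E])
  have DE_E: "D + E \<subseteq> E" using set_plus_mono2[OF D order_refl[of E]] E by blast
  note cl = ideal_smult_closed[OF st series_mono[OF D]]
  show "ideal_smult R (series D) (series_module E) \<subseteq> (series (D + E) :: 'k fps fps set)"
    by (rule ideal_smult_subset[OF st series_mono[OF D] series_mono[OF DE_E]])
      (auto intro: series_mult series_add stableD[OF fg_imp_stable[OF DE]])
  show "(series (D + E) :: 'k fps fps set) \<subseteq> ideal_smult R (series D) (series_module E)"
  proof (rule generated_series[OF DE])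
    fix i j assume "(i, j) \<in> D + E"
    then obtain p q p' q' where pq: "(p, q) \<in> D" "(p', q') \<in> E" "i = p + p'" "j = q + q'"
      by (auto elim!: set_plus_elim)
    have "monom_xy p q * (monom_xy p' q' :: 'k fps fps) \<in> ideal_smult R (series D) (series_module E)"
      using pq by (intro cl(1)) auto
    then show "(monom_xy i j :: 'k fps fps) \<in> ideal_smult R (series D) (series_module E)"
      using pq by (simp add: monom_xy_add)
  qed (use cl(3-5) in auto)
qed

lemma ideal_smult_power:
  "ideal_smult R (ideal_power R (max_ideal R) k) (series_module (W t)) =
     (series (power_exps n a k t) :: 'k fps fps set)"
  unfolding max_ideal_R ideal_power_P
  using fg_power[of k t] power_exps_subset W0_plus
  by (subst ideal_smult_series) (auto simp: power_exps_plus)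

lemma ideal_smult_max:
  "ideal_smult R (max_ideal R) (series_module (W t)) = (series (P + W t) :: 'k fps fps set)"
  unfolding max_ideal_R using fg_power[of 1 t] W0_plus
  by (intro ideal_smult_series) (auto simp: power_exps_Suc power_exps_0 invariant_exps_def)

lemma min_num_generators_M:
  "min_num_generators field_k R (series_module (W t) :: ('k fps fps, _) module) = card (min_exps n a t)"
proof -
  have "P + W t = power_exps n a 1 t" by (simp add: power_exps_Suc power_exps_0)
  then have "P + W t \<subseteq> W t" "finite (W t - (P + W t))"
    using power_exps_subset[of n a 1 t] finite_codim_power_exps[OF n_pos, of a t 1] by auto
  then show ?thesis
    by (simp add: min_num_generators_def ideal_smult_max dim_series_quot min_exps_def)
qed

lemma length_M:
  "module_length R (quot_module (series_module (W t) :: ('k fps fps, _) module)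
     (ideal_smult R (ideal_power R (max_ideal R) k) (series_module (W t)))) =
   enat (card (W t - power_exps n a k t))"
  unfolding ideal_smult_power
  by (rule module_length_series_quot[OF zero_in_weight_class W0_plus W0_plus _ power_exps_subset
        finite_codim_power_exps[OF n_pos]])
    (use fg_power[of k t] in \<open>simp add: fg_exps_def\<close>)

section \<open>Multiplicity\<close>

text \<open>As \<open>lim\<close> is a definite description, it takes the same value on any two sequences with the
  same limits; this includes two divergent sequences.\<close>
lemma lim_eqI:
  fixes X Y :: "nat \<Rightarrow> real"
  assumes "(\<lambda>k. X k - Y k) \<longlonglongrightarrow> 0"
  shows "lim X = lim Y"
proof -
  have "X \<longlonglongrightarrow> L \<longleftrightarrow> Y \<longlonglongrightarrow> L" for L
    using Lim_transform[OF _ assms, of L] Lim_transform2[OF _ assms, of L] by blast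
  then show ?thesis by (simp add: lim_def)
qed

text \<open>Apply \<open>card_codim_compare\<close> with \<open>x\<^sup>t\<close> from \<open>R\<close> to \<open>M\<^sub>t\<close> and with \<open>x\<^sup>n\<^sup>-\<^sup>t\<close> from \<open>M\<^sub>t\<close> to \<open>R\<close>.\<close>
theorem multiplicity_M:
  assumes dim: "krull_dim R = 2" and t: "t < n"
  shows "multiplicity_module R (max_ideal R) (series_module (W t) :: ('k fps fps, _) module) =
    multiplicity_module R (max_ideal R) (series_module (W 0))"
proof -
  let ?c = "\<lambda>t k. card (W t - power_exps n a k t)"
  have m: "multiplicity_module R (max_ideal R) (series_module (W s) :: ('k fps fps, _) module) =
      lim (\<lambda>k. 2 * real (?c s k) / real k ^ 2)" for s
    unfolding multiplicity_module_def length_M dim Let_def numeral_eq_enat by (simp add: fact_2)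
  have "(\<lambda>k. 2 * real (?c t k) / real k ^ 2 - 2 * real (?c 0 k) / real k ^ 2) \<longlonglongrightarrow> 0"
  proof (rule tendsto_0_le[where K = 1])
    show "\<forall>\<^sub>F k in sequentially. norm (2 * real (?c t k) / real k ^ 2 - 2 * real (?c 0 k) / real k ^ 2)
        \<le> norm (2 * real (n * n) / real k) * 1"
    proof (rule eventually_sequentiallyI[of 1])
      fix k :: nat assume k: "1 \<le> k"
      have "?c t k \<le> ?c 0 k + t * (k * n)" by (rule card_codim_compare[OF n_pos]) simp
      moreover have "t * (k * n) \<le> n * (k * n)" using t by (intro mult_right_mono) auto
      moreover have "?c 0 k \<le> ?c t k + (n - t) * (k * n)"
        by (rule card_codim_compare[OF n_pos]) (use t in \<open>simp add: cong_0_iff\<close>)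
      moreover have "(n - t) * (k * n) \<le> n * (k * n)" by (intro mult_right_mono) auto
      ultimately have "?c t k \<le> ?c 0 k + n * (k * n)" "?c 0 k \<le> ?c t k + n * (k * n)" by linarith+
      then have "real (?c t k) \<le> real (?c 0 k) + real (n * (k * n))"
        "real (?c 0 k) \<le> real (?c t k) + real (n * (k * n))"
        by (simp_all only: of_nat_le_iff flip: of_nat_add)
      then have "\<bar>real (?c t k) - real (?c 0 k)\<bar> \<le> real (n * n) * real k"
        by (simp add: abs_le_iff algebra_simps)
      then have "2 * \<bar>real (?c t k) - real (?c 0 k)\<bar> / real k ^ 2 \<le> 2 * (real (n * n) * real k) / real k ^ 2"
        by (intro divide_right_mono) auto
      also have "\<dots> = 2 * real (n * n) / real k" using k by (simp add: power2_eq_square)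
      finally have "norm (2 * (real (?c t k) - real (?c 0 k)) / real k ^ 2) \<le> norm (2 * real (n * n) / real k) * 1"
        by (simp add: abs_mult del: right_diff_distrib_numeral)
      then show "norm (2 * real (?c t k) / real k ^ 2 - 2 * real (?c 0 k) / real k ^ 2)
        \<le> norm (2 * real (n * n) / real k) * 1"
        by (simp only: diff_divide_distrib right_diff_distrib)
    qed
    show "(\<lambda>k. 2 * real (n * n) / real k) \<longlonglongrightarrow> 0" by (rule lim_const_over_n)
  qed
  then show ?thesis unfolding m by (rule lim_eqI)
qed

end

section \<open>Weierstrass division and elimination\<close>

text \<open>Gaussian elimination without division: a pivot \<open>m\<close> clears the last coordinate of all other
  vectors.\<close>
lemma linear_dependence:
  fixes w :: "'i \<Rightarrow> nat \<Rightarrow> 'a::idom"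
  assumes "finite X" "d < card X"
  shows "\<exists>\<gamma>. (\<exists>i\<in>X. \<gamma> i \<noteq> 0) \<and> (\<forall>j<d. (\<Sum>i\<in>X. \<gamma> i * w i j) = 0)"
  using assms
proof (induction d arbitrary: X w)
  case 0
  then have "X \<noteq> {}" by auto
  then show ?case by (intro exI[of _ "\<lambda>_. 1"]) auto
next
  case (Suc d)
  show ?case
  proof (cases "\<exists>m\<in>X. w m d \<noteq> 0")
    case False
    from Suc.IH[of X w] Suc.prems obtain \<gamma> where "\<exists>i\<in>X. \<gamma> i \<noteq> 0" "\<forall>j<d. (\<Sum>i\<in>X. \<gamma> i * w i j) = 0" by auto
    moreover have "(\<Sum>i\<in>X. \<gamma> i * w i d) = 0" using False by (intro sum.neutral) auto
    ultimately show ?thesis by (intro exI[of _ \<gamma>]) (auto simp: less_Suc_eq)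
  next
    case True
    then obtain m where m: "m \<in> X" "w m d \<noteq> 0" by blast
    let ?Y = "X - {m}"
    have "d < card ?Y" using Suc.prems m(1) by simp
    with Suc.IH[of ?Y "\<lambda>i j. w m d * w i j - w i d * w m j"] Suc.prems obtain \<delta> where
      \<delta>: "\<exists>i\<in>?Y. \<delta> i \<noteq> 0" "\<And>j. j < d \<Longrightarrow> (\<Sum>i\<in>?Y. \<delta> i * (w m d * w i j - w i d * w m j)) = 0" by auto
    define \<gamma> where "\<gamma> i = (if i = m then - (\<Sum>i\<in>?Y. \<delta> i * w i d) else \<delta> i * w m d)" for i
    have "(\<Sum>i\<in>X. \<gamma> i * w i j) = (\<Sum>i\<in>?Y. \<delta> i * (w m d * w i j - w i d * w m j))" for j
    proof -
      have "(\<Sum>i\<in>X. \<gamma> i * w i j) = \<gamma> m * w m j + (\<Sum>i\<in>?Y. \<gamma> i * w i j)"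
        using Suc.prems m(1) by (rule_tac sum.remove) auto
      also have "(\<Sum>i\<in>?Y. \<gamma> i * w i j) = (\<Sum>i\<in>?Y. \<delta> i * w m d * w i j)"
        by (intro sum.cong) (auto simp: \<gamma>_def)
      also have "\<gamma> m * w m j = - (\<Sum>i\<in>?Y. \<delta> i * w i d * w m j)"
        by (simp add: \<gamma>_def sum_distrib_right)
      finally show ?thesis by (simp add: sum_subtractf right_diff_distrib mult.assoc)
    qed
    moreover have "(\<Sum>i\<in>?Y. \<delta> i * (w m d * w i d - w i d * w m d)) = 0"
      by (intro sum.neutral) (simp add: mult.commute)
    moreover have "\<exists>i\<in>X. \<gamma> i \<noteq> 0" using \<delta>(1) m(2) by (auto simp: \<gamma>_def)
    ultimately show ?thesis using \<delta>(2) by (intro exI[of _ \<gamma>]) (auto simp: less_Suc_eq)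
  qed
qed

text \<open>The variable \<open>x\<close>.\<close>
abbreviation X_xy :: "'k::field fps fps" where "X_xy \<equiv> fps_const fps_X"

lemma X_xy_power_mult_nth: "(X_xy ^ k * f) $ j $ i = (if i < k then 0 else f $ j $ (i - k))"
  by (simp add: fps_const_power fps_X_power_mult_nth)

text \<open>The solution is the \<open>x\<close>-adically convergent series \<open>\<Sum>\<^sub>k (- xT)\<^sup>k g = \<Sum>\<^sub>k x\<^sup>k (- T)\<^sup>k g\<close>.\<close>
lemma contraction_fixpoint:
  fixes T :: "'k::field fps fps \<Rightarrow> 'k fps fps"
  assumes add: "\<And>f g. T (f + g) = T f + T g" and X: "\<And>f. T (X_xy * f) = X_xy * T f"
  shows "\<exists>w. w + X_xy * T w = g"
proof -
  define z where "z k = ((\<lambda>f. - T f) ^^ k) g" for k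
  \<comment> \<open>\<open>s m\<close> is the tail \<open>\<Sum>\<^sub>k x\<^sup>k z\<^sub>k\<^sub>+\<^sub>m\<close>; the error \<open>e 0\<close> is divisible by every power of \<open>x\<close>.\<close>
  define s where "s m = Abs_fps (\<lambda>j. Abs_fps (\<lambda>i. \<Sum>k\<le>i. z (k + m) $ j $ (i - k)))" for m
  have s: "s m = z m + X_xy * s (Suc m)" for m
  proof (rule fps2_eqI)
    fix i j
    show "s m $ j $ i = (z m + X_xy * s (Suc m)) $ j $ i"
    proof (cases i)
      case (Suc i')
      have "s m $ j $ i = z m $ j $ i + (\<Sum>k\<le>i'. z (Suc k + m) $ j $ (i - Suc k))"
        unfolding s_def Suc by (simp add: sum.atMost_Suc_shift del: sum.atMost_Suc)
      then show ?thesis by (simp add: Suc s_def)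
    qed (simp add: s_def)
  qed
  define e where "e m = s m + X_xy * T (s m) - z m" for m
  have e: "e m = X_xy * e (Suc m)" for m
  proof -
    have "e m = X_xy * (s (Suc m) + (T (z m) + X_xy * T (s (Suc m))))"
      unfolding e_def by (subst (1 2) s) (simp add: add X algebra_simps)
    also have "T (z m) = - z (Suc m)" by (simp add: z_def)
    finally show ?thesis by (simp add: e_def algebra_simps)
  qed
  have "e 0 = X_xy ^ k * e k" for k
    by (induction k) (simp, metis e mult.assoc power_Suc2)
  then have "e 0 $ j $ i = 0" for i j
    using X_xy_power_mult_nth[of "Suc i" "e (Suc i)" j i] by (metis lessI)
  then have "e 0 = 0" by (intro fps2_eqI) simp
  then show ?thesis by (intro exI[of _ "s 0"]) (simp add: e_def z_def)
qed

lemma fps_unit_exists: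
  fixes f :: "'k::field fps fps"
  assumes "f $ 0 $ 0 \<noteq> 0"
  shows "\<exists>g. f * g = 1"
  using fps_right_inverse[of f "inverse (f $ 0)"] inverse_mult_eq_1'[OF assms] by blast

text \<open>Write \<open>c = xL + y\<^sup>d U\<close> with a unit \<open>U\<close>. That \<open>g - qc\<close> has degree less than \<open>d\<close> in \<open>y\<close> is
  then a fixpoint equation for \<open>w = qU\<close> of the above form, in which \<open>T w\<close> is the part of \<open>w U\<^sup>-\<^sup>1
  L\<close> of degree at least \<open>d\<close>, divided by \<open>y\<^sup>d\<close>.\<close>
lemma weierstrass_division:
  fixes c g :: "'k::field fps fps"
  assumes c: "c $ d $ 0 \<noteq> 0" "\<And>j. j < d \<Longrightarrow> c $ j $ 0 = 0"
  shows "\<exists>q r. g = q * c + r \<and> (\<forall>j\<ge>d. r $ j = 0)"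
proof -
  define U where "U = fps_shift d c"
  define L where "L = Abs_fps (\<lambda>j. if j < d then fps_shift 1 (c $ j) else 0)"
  have "c = X_xy * L + fps_X ^ d * U"
  proof (rule fps2_eqI)
    fix i j
    show "c $ j $ i = (X_xy * L + fps_X ^ d * U) $ j $ i"
      using c(2)[of j] by (cases i) (auto simp: L_def U_def fps_X_power_mult_nth)
  qed
  then have c_eq: "q * c = X_xy * (q * L) + fps_X ^ d * (q * U)" for q
    by (simp add: algebra_simps)
  obtain V where V: "U * V = 1" using fps_unit_exists[of U] c(1) by (auto simp: U_def)
  define T where "T w = fps_shift d (w * V * L)" for w
  have shift_X: "fps_shift d (X_xy * f) = X_xy * fps_shift d f" for f :: "'k fps fps"
    by (rule fps_ext) simp
  have shift_add: "fps_shift d (f + h) = fps_shift d f + fps_shift d h" for f h :: "'k fps fps"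
    by (rule fps_ext) simp
  have shift_pow: "fps_shift d (fps_X ^ d * f) = f" for f :: "'k fps fps"
    by (rule fps_ext) (simp add: fps_X_power_mult_nth)
  have "\<exists>w. w + X_xy * T w = fps_shift d g"
  proof (rule contraction_fixpoint)
    show "T (f + h) = T f + T h" for f h by (simp add: T_def distrib_right shift_add)
    show "T (X_xy * f) = X_xy * T f" for f using shift_X[of "f * V * L"] by (simp add: T_def mult.assoc)
  qed
  then obtain w where w: "w + X_xy * T w = fps_shift d g" by blast
  define q where "q = w * V"
  have qU: "q * U = w" 
  proof -
    have "q * U = w * (U * V)" by (simp add: q_def mult_ac)
    then show ?thesis by (simp add: V)
  qed
  then have "fps_shift d (q * c) = fps_shift d g"
    unfolding c_eq shift_add shift_X shift_pow using w qU by (simp add: T_def add.commute flip: q_def)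
  then have "(g - q * c) $ j = 0" if "j \<ge> d" for j
    using that by (auto simp: fps_eq_iff[of "fps_shift d _"] dest!: spec[of _ "j - d"])
  then show ?thesis by (intro exI[of _ q] exI[of _ "g - q * c"]) auto
qed

text \<open>Restriction to the line \<open>x = 0\<close>, with values in \<open>\<bbbk>[[y]]\<close>.\<close>
definition at_x0 :: "'k::field fps fps \<Rightarrow> 'k fps" where
  "at_x0 f = Abs_fps (\<lambda>j. f $ j $ 0)"

lemma at_x0_nth [simp]: "at_x0 f $ j = f $ j $ 0"
  by (simp add: at_x0_def)

lemma at_x0_mult: "at_x0 (f * g) = at_x0 f * at_x0 g"
  by (rule fps_ext) (simp add: fps_mult_nth fps_sum_nth)

lemma at_x0_1: "at_x0 1 = 1"
  by (rule fps_ext) (simp add: fps_one_nth)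

lemma at_x0_power: "at_x0 (f ^ k) = at_x0 f ^ k"
  by (induction k) (simp_all add: at_x0_mult at_x0_1)

text \<open>The \<open>d + 1\<close> powers \<open>1, g, \<dots>, g\<^sup>d\<close> have remainders modulo \<open>c\<close> in a free \<open>\<bbbk>[[x]]\<close>-module of
  rank \<open>d\<close>, so they are linearly dependent. The first nonzero coefficient of the relation is
  normalised to a power of \<open>x\<close>.\<close>
lemma elimination:
  fixes c g :: "'k::field fps fps"
  assumes "at_x0 c \<noteq> 0"
  shows "\<exists>\<gamma> k d e Q. k \<le> d \<and> (\<forall>i<k. \<gamma> i = 0) \<and> \<gamma> k = fps_X ^ e \<and>
    (\<Sum>i\<le>d. fps_const (\<gamma> i) * g ^ i) = c * Q"
proof -
  define d where "d = (LEAST j. c $ j $ 0 \<noteq> 0)"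
  have "\<exists>j. c $ j $ 0 \<noteq> 0" using assms by (auto simp: fps_eq_iff)
  then have d: "c $ d $ 0 \<noteq> 0" unfolding d_def by (rule LeastI_ex)
  have d': "c $ j $ 0 = 0" if "j < d" for j using that not_less_Least unfolding d_def by blast
  have "\<forall>i. \<exists>q r. g ^ i = q * c + r \<and> (\<forall>j\<ge>d. r $ j = 0)"
    using weierstrass_division[OF d d'] by blast
  then obtain q r where qr: "\<And>i. g ^ i = q i * c + r i" "\<And>i j. j \<ge> d \<Longrightarrow> r i $ j = 0" by metis
  obtain \<gamma> :: "nat \<Rightarrow> 'k fps" where \<gamma>: "\<exists>i\<in>{..d}. \<gamma> i \<noteq> 0" "\<forall>j<d. (\<Sum>i\<le>d. \<gamma> i * r i $ j) = 0"
    using linear_dependence[of "{..d}" d "\<lambda>i j. r i $ j"] by auto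
  have "(\<Sum>i\<le>d. fps_const (\<gamma> i) * r i) $ j = 0" for j
    using \<gamma>(2) qr(2) by (cases "j < d") (simp_all add: fps_sum_nth)
  then have zero: "(\<Sum>i\<le>d. fps_const (\<gamma> i) * r i) = 0" by (simp add: fps_eq_iff)
  have rel: "(\<Sum>i\<le>d. fps_const (\<gamma> i) * g ^ i) = c * (\<Sum>i\<le>d. fps_const (\<gamma> i) * q i)"
    unfolding qr(1) using zero
    by (simp add: distrib_left sum.distrib sum_distrib_left mult_ac)
  define k where "k = (LEAST i. \<gamma> i \<noteq> 0)"
  have "\<exists>i. \<gamma> i \<noteq> 0" using \<gamma>(1) by blast
  then have k: "\<gamma> k \<noteq> 0" unfolding k_def by (rule LeastI_ex)
  have k': "\<gamma> i = 0" if "i < k" for i using that not_less_Least unfolding k_def by blast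
  have kd: "k \<le> d" using \<gamma>(1) k' by (meson atMost_iff not_le order_less_le_trans)
  define e where "e = subdegree (\<gamma> k)"
  define s where "s = fps_shift e (\<gamma> k)"
  have s: "\<gamma> k = fps_X ^ e * s" "s $ 0 \<noteq> 0"
    unfolding e_def s_def using k subdegree_decompose[of "\<gamma> k"] by (simp_all add: mult.commute)
  have "inverse s * \<gamma> k = fps_X ^ e"
    using inverse_mult_eq_1[OF s(2)] s(1) by (metis mult.commute mult.assoc mult_1_right)
  moreover have "(\<Sum>i\<le>d. fps_const (inverse s * \<gamma> i) * g ^ i) =
      c * (fps_const (inverse s) * (\<Sum>i\<le>d. fps_const (\<gamma> i) * q i))"
  proof -
    have "(\<Sum>i\<le>d. fps_const (inverse s * \<gamma> i) * g ^ i) = fps_const (inverse s) * (\<Sum>i\<le>d. fps_const (\<gamma> i) * g ^ i)"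
      by (simp add: sum_distrib_left mult.assoc flip: fps_const_mult)
    then show ?thesis unfolding rel by (simp add: mult.left_commute)
  qed
  ultimately show ?thesis using kd k'
    by (intro exI[of _ "\<lambda>i. inverse s * \<gamma> i"] exI[of _ k] exI[of _ d] exI[of _ e]) auto
qed

lemma shift_factor:
  fixes f :: "'k::field fps fps"
  assumes "\<And>i j. f $ j $ i \<noteq> 0 \<Longrightarrow> p \<le> i \<and> q \<le> j"
  shows "\<exists>g. f = monom_xy p q * g"
proof
  show "f = monom_xy p q * Abs_fps (\<lambda>j. Abs_fps (\<lambda>i. f $ (j + q) $ (i + p)))"
    using assms by (intro fps2_eqI) (auto simp: monom_xy_mult_nth)
qed

lemma monom_xy_neq_0: "(monom_xy p q :: 'k::field fps fps) \<noteq> 0"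
  using monom_xy_nth[of p q q p, where 'k = 'k] by auto

context cyclic_action
begin

abbreviation (input) "u \<equiv> (monom_xy n 0 :: 'k fps fps)"
abbreviation (input) "v \<equiv> (monom_xy 0 n :: 'k fps fps)"

lemma monom_cancel_series:
  assumes "(p, q) \<in> W 0" "monom_xy p q * g \<in> series (W t)"
  shows "g \<in> series (W t)"
  unfolding series_def
proof (intro CollectI allI impI)
  fix i j assume "g $ j $ i \<noteq> 0"
  then have "(monom_xy p q * g) $ (j + q) $ (i + p) \<noteq> 0" by (simp add: monom_xy_mult_nth)
  then have "(i + p, j + q) \<in> W t" using assms(2) by (auto simp: series_def)
  from weight_class_diff[OF this assms(1)] show "(i, j) \<in> W t" by simp
qed

lemma shift_factor_series:
  assumes "(p, q) \<in> W 0" "f \<in> series (W t)" "\<And>i j. f $ j $ i \<noteq> 0 \<Longrightarrow> p \<le> i \<and> q \<le> j"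
  shows "\<exists>g\<in>series (W t). f = monom_xy p q * g"
  using shift_factor[OF assms(3)] monom_cancel_series[OF assms(1)] assms(2) by metis

lemma n_in_W: "(n * k, 0) \<in> W 0" "(0, n * k) \<in> W 0" "(n, 0) \<in> W 0" "(0, n) \<in> W 0"
  by (simp_all add: weight_class_def cong_0_iff)

lemma power_closed: "(f :: 'k fps fps) \<in> series (W 0) \<Longrightarrow> f ^ k \<in> series (W 0)"
  by (induction k) (simp_all add: one mult)

lemma u_closed: "monom_xy (n * k) 0 \<in> series (W 0)" "monom_xy 0 (n * k) \<in> series (W 0)"
  "monom_xy n 0 \<in> series (W 0)" "monom_xy 0 n \<in> series (W 0)"
  by (simp_all add: n_in_W)

text \<open>Multiply the relation by a power of \<open>x\<close> that turns its first coefficient into a power of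
  \<open>u = x\<^sup>n\<close>, and project it to \<open>R\<close>.\<close>
lemma elimination_R:
  assumes c: "c \<in> series (W 0)" "at_x0 c \<noteq> 0" and g: "g \<in> series (W 0)"
  shows "\<exists>k e. \<exists>h\<in>series (W 0). \<exists>q\<in>series (W 0). g ^ k * (u ^ e + g * h) = c * q"
proof -
  obtain \<gamma> k d e Q where *: "k \<le> d" "\<forall>i<k. \<gamma> i = 0" "\<gamma> k = fps_X ^ e"
    "(\<Sum>i\<le>d. fps_const (\<gamma> i) * g ^ i) = c * Q" using elimination[OF c(2), of g] by metis
  \<comment> \<open>\<open>x\<^sup>m\<close> completes \<open>x\<^sup>e\<close> to \<open>x\<^sup>n\<^sup>e\<close>.\<close>
  define m where "m = e * (n - 1)"
  have m: "e + m = n * e" using n_pos by (simp add: m_def algebra_simps flip: mult_Suc_right) (cases n; simp)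
  let ?pr = "restrict_series (W 0)"
  define \<rho> where "\<rho> i = ?pr (fps_const (fps_X ^ m * \<gamma> i))" for i
  have \<rho>: "\<rho> i \<in> series (W 0)" for i unfolding \<rho>_def by (rule restrict_series_in)
  have pr_sum: "?pr (sum h X) = (\<Sum>x\<in>X. ?pr (h x))" for h and X :: "nat set"
    by (rule fps2_eqI) (simp add: fps_sum_nth)
  have "(\<Sum>i\<le>d. \<rho> i * g ^ i) = ?pr (\<Sum>i\<le>d. fps_const (fps_X ^ m * \<gamma> i) * g ^ i)"
  proof -
    have "?pr z * g ^ i = ?pr (z * g ^ i)" for z i
      using restrict_mult[OF power_closed[OF g, of i], of 0 z] by (simp only: mult.commute)
    then show ?thesis unfolding pr_sum \<rho>_def by simp
  qed
  also have "(\<Sum>i\<le>d. fps_const (fps_X ^ m * \<gamma> i) * g ^ i) = c * (fps_const (fps_X ^ m) * Q)"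
  proof -
    have "(\<Sum>i\<le>d. fps_const (fps_X ^ m * \<gamma> i) * g ^ i) = fps_const (fps_X ^ m) * (\<Sum>i\<le>d. fps_const (\<gamma> i) * g ^ i)"
      by (simp add: sum_distrib_left mult.assoc flip: fps_const_mult)
    then show ?thesis unfolding *(4) by (simp add: mult.left_commute)
  qed
  also have "?pr (c * (fps_const (fps_X ^ m) * Q)) = c * ?pr (fps_const (fps_X ^ m) * Q)"
    by (rule restrict_mult[OF c(1)])
  finally have rel: "(\<Sum>i\<le>d. \<rho> i * g ^ i) = c * ?pr (fps_const (fps_X ^ m) * Q)" .
  have \<rho>0: "\<rho> i = 0" if "i < k" for i
    using *(2) that by (intro fps2_eqI) (simp add: \<rho>_def)
  have "fps_const (fps_X ^ m * \<gamma> k) = u ^ e"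
    unfolding *(3) monom_xy_power by (simp add: monom_xy_def fps_const_power flip: power_add m) (simp add: add.commute)
  then have \<rho>k: "\<rho> k = u ^ e"
    using u_closed by (simp add: \<rho>_def restrict_series_id power_closed)
  define h where "h = (\<Sum>i\<in>{Suc k..d}. \<rho> i * g ^ (i - Suc k))"
  have h: "h \<in> series (W 0)" unfolding h_def by (intro series_sum mult power_closed g \<rho>)
  have "(\<Sum>i\<le>d. \<rho> i * g ^ i) = (\<Sum>i\<in>{k..d}. \<rho> i * g ^ i)"
    using \<rho>0 by (intro sum.mono_neutral_right) auto
  also have "\<dots> = \<rho> k * g ^ k + (\<Sum>i\<in>{Suc k..d}. \<rho> i * g ^ i)"
    using *(1) by (rule sum.atLeast_Suc_atMost)
  also have "(\<Sum>i\<in>{Suc k..d}. \<rho> i * g ^ i) = g ^ k * (g * h)"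
  proof -
    have "\<rho> i * g ^ i = g ^ k * (g * (\<rho> i * g ^ (i - Suc k)))" if "i \<in> {Suc k..d}" for i
    proof -
      have "g ^ i = g ^ k * (g * g ^ (i - Suc k))"
      proof -
        have "i = k + Suc (i - Suc k)" using that by simp
        then have "g ^ i = g ^ (k + Suc (i - Suc k))" by simp
        then show ?thesis by (simp only: power_add power_Suc)
      qed
      then show ?thesis by (simp add: mult_ac)
    qed
    then show ?thesis unfolding h_def sum_distrib_left by (rule sum.cong[OF refl])
  qed
  finally have "g ^ k * (u ^ e + g * h) = c * ?pr (fps_const (fps_X ^ m) * Q)"
    using rel by (simp add: \<rho>k algebra_simps)
  then show ?thesis using h restrict_series_in by blast
qed

text \<open>If \<open>f = x\<^sup>p g\<close> with \<open>g\<close> not divisible by \<open>x\<close>, then \<open>g\<close> is only semi-invariant; the \<open>n\<close>-th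
  power makes both factors invariant.\<close>
lemma x_factor:
  assumes "f \<in> series (W 0)" "f \<noteq> 0"
  shows "\<exists>p. \<exists>c\<in>series (W 0). f ^ n = u ^ p * c \<and> at_x0 c \<noteq> 0"
proof -
  have ex: "\<exists>i. \<exists>j. f $ j $ i \<noteq> 0" using assms(2) by (auto simp: fps_eq_iff)
  define p where "p = (LEAST i. \<exists>j. f $ j $ i \<noteq> 0)"
  have p: "\<exists>j. f $ j $ p \<noteq> 0" unfolding p_def using ex by (rule LeastI_ex)
  have "p \<le> i" if "f $ j $ i \<noteq> 0" for i j unfolding p_def using that by (intro Least_le) blast
  then obtain g where g: "f = monom_xy p 0 * g" using shift_factor[of f p 0] by auto
  from p obtain j where "f $ j $ p \<noteq> 0" by blast
  then have "at_x0 g $ j \<noteq> 0" unfolding g by (simp add: monom_xy_mult_nth)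
  then have "at_x0 g \<noteq> 0" by (metis fps_zero_nth)
  then have "at_x0 (g ^ n) \<noteq> 0" by (simp add: at_x0_power)
  moreover have fn: "f ^ n = monom_xy (n * p) 0 * g ^ n"
    by (simp add: g power_mult_distrib monom_xy_power mult.commute)
  moreover have "g ^ n \<in> series (W 0)"
    using monom_cancel_series[of "n * p" 0 "g ^ n" 0] power_closed[OF assms(1), of n] n_in_W fn by simp
  ultimately show ?thesis by (intro exI[of _ p] bexI[of _ "g ^ n"]) (simp_all add: monom_xy_power)
qed

end

locale cyclic_quotient = cyclic_action n a \<zeta> for n a and \<zeta> :: "'k::field" +
  assumes cop: "coprime a n"
begin

text \<open>The part \<open>s\<close> of \<open>f\<close> without \<open>x\<close> is a series in \<open>y\<^sup>n\<close>, as \<open>a\<close> is coprime to \<open>n\<close>; so it is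
  zero or a power of \<open>v = y\<^sup>n\<close> times a unit. The rest \<open>w\<close> is divisible by \<open>x\<close>, so its \<open>n\<close>-th
  power is divisible by \<open>u\<close> in \<open>R\<close>.\<close>
lemma mod_x:
  assumes f: "f \<in> series (W 0)"
  shows "\<exists>s\<in>series (W 0). \<exists>w\<in>series (W 0). \<exists>h\<in>series (W 0). f = s + w \<and> w ^ n = u * h \<and>
    (at_x0 f = 0 \<longrightarrow> s = 0) \<and>
    (at_x0 f \<noteq> 0 \<longrightarrow> (\<exists>e. \<exists>s'\<in>series (W 0). \<exists>s''\<in>series (W 0). s = v ^ e * s' \<and> s' * s'' = 1 \<and>
      (f \<in> series P \<longrightarrow> e > 0)))"
proof -
  define s where "s = restrict_series ({0} \<times> UNIV) f"
  have s: "s \<in> series (W 0)" using f by (auto simp: s_def series_def)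
  have w: "f - s \<in> series (W 0)" using f s by (rule series_diff)
  have "1 \<le> i" if "(f - s) $ j $ i \<noteq> 0" for i j
    using that by (cases i) (auto simp: s_def)
  then obtain h where h: "f - s = monom_xy 1 0 * h" using shift_factor[of "f - s" 1 0] by auto
  then have hn: "(f - s) ^ n = u * h ^ n" by (simp add: power_mult_distrib monom_xy_power)
  then have "h ^ n \<in> series (W 0)"
    using monom_cancel_series[OF n_in_W(3), of "h ^ n"] power_closed[OF w, of n] by simp
  moreover have "s = 0" if "at_x0 f = 0"
  proof -
    have "f $ j $ 0 = 0" for j using that by (metis at_x0_nth fps_zero_nth)
    then show "s = 0" by (intro fps2_eqI) (auto simp: s_def)
  qed
  moreover have "\<exists>e. \<exists>s'\<in>series (W 0). \<exists>s''\<in>series (W 0).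
      s = v ^ e * s' \<and> s' * s'' = 1 \<and> (f \<in> series P \<longrightarrow> e > 0)" if "at_x0 f \<noteq> 0"
  proof -
    have ex: "\<exists>j. f $ j $ 0 \<noteq> 0" using that by (auto simp: fps_eq_iff)
    define j where "j = (LEAST j. f $ j $ 0 \<noteq> 0)"
    have j: "f $ j $ 0 \<noteq> 0" unfolding j_def using ex by (rule LeastI_ex)
    have least: "j \<le> j'" if j': "f $ j' $ 0 \<noteq> 0" for j' unfolding j_def using j' by (rule Least_le)
    have "(0, j) \<in> W 0" using f j by (auto simp: series_def)
    then have "n dvd j * a" by (simp add: weight_class_def cong_0_iff)
    then obtain e where e: "j = n * e" using cop by (metis coprime_commute coprime_dvd_mult_left_iff dvdE)
    have "j \<le> j'" if s_nz: "s $ j' $ i \<noteq> 0" for i j' using s_nz least by (auto simp: s_def split: if_splits)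
    then obtain s' where s': "s' \<in> series (W 0)" "s = monom_xy 0 j * s'"
      using shift_factor_series[of 0 j s 0] s \<open>(0, j) \<in> W 0\<close> by auto
    have "s' $ 0 $ 0 = s $ j $ 0" unfolding s'(2) by (simp add: monom_xy_mult_nth)
    then have "s' $ 0 $ 0 \<noteq> 0" using j by (simp add: s_def)
    then obtain s'' where "s'' \<in> series (W 0)" "s' * s'' = 1"
      using invertible_R[OF s'(1)] in_series_P_iff[OF s'(1)] by auto
    moreover have "s = v ^ e * s'" unfolding s'(2) monom_xy_power e by simp
    moreover have "e > 0" if fP: "f \<in> series P"
      using fP in_series_P_iff[OF f] j e by (cases "e = 0") auto
    ultimately show ?thesis using s'(1) by blast
  qed
  moreover have "f = s + (f - s)" by simp
  ultimately show ?thesis using s w hn by blast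
qed

lemma power_congruence:
  fixes b c :: "'k fps fps"
  assumes "b \<in> series (W 0)" "c \<in> series (W 0)"
  shows "\<exists>h\<in>series (W 0). (b + c) ^ k = b * h + c ^ k"
proof (induction k)
  case (Suc k)
  then obtain h where h: "h \<in> series (W 0)" "(b + c) ^ k = b * h + c ^ k" by blast
  have "(b + c) ^ Suc k = b * ((b + c) * h + c ^ k) + c ^ Suc k" by (simp add: h(2) algebra_simps)
  moreover have "(b + c) * h + c ^ k \<in> series (W 0)" by (intro add mult power_closed assms h)
  ultimately show ?case by blast
qed (auto intro: bexI[of _ 0])

text \<open>Modulo \<open>f\<close>, the element \<open>v\<^sup>e\<close> times a unit is congruent to \<open>- w\<close>, whose \<open>nq\<close>-th power is a
  multiple of \<open>u\<^sup>q\<close>.\<close>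
lemma v_power_in_ideal:
  assumes f: "f \<in> series (W 0)" "at_x0 f \<noteq> 0"
  shows "\<exists>L. \<exists>\<alpha>\<in>series (W 0). \<exists>\<beta>\<in>series (W 0). v ^ L = \<alpha> * f + \<beta> * u ^ q"
proof -
  obtain s w h e s' s'' where swh: "s \<in> series (W 0)" "w \<in> series (W 0)" "h \<in> series (W 0)"
    "f = s + w" "w ^ n = u * h" and s': "s' \<in> series (W 0)" "s'' \<in> series (W 0)" "s = v ^ e * s'" "s' * s'' = 1"
    using mod_x[OF f(1)] f(2) by metis
  let ?N = "n * q"
  obtain r where r: "r \<in> series (W 0)" "(f + (- w)) ^ ?N = f * r + (- w) ^ ?N"
    using power_congruence[OF f(1) uminus[OF swh(2)]] by blast
  have "(- w) ^ ?N = (- 1) ^ ?N * (u ^ q * h ^ q)"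
    by (subst power_minus) (simp add: power_mult swh(5) power_mult_distrib)
  moreover have "(f + (- w)) ^ ?N = v ^ (e * ?N) * s' ^ ?N"
    by (simp add: swh(4) s'(3) power_mult_distrib power_mult)
  ultimately have "v ^ (e * ?N) * s' ^ ?N = f * r + (- 1) ^ ?N * (u ^ q * h ^ q)" using r(2) by simp
  then have "v ^ (e * ?N) * (s' ^ ?N * s'' ^ ?N) = (s'' ^ ?N * r) * f + (s'' ^ ?N * (- 1) ^ ?N * h ^ q) * u ^ q"
    by (simp add: algebra_simps)
  then have "v ^ (e * ?N) = (s'' ^ ?N * r) * f + (s'' ^ ?N * (- 1) ^ ?N * h ^ q) * u ^ q"
    by (simp add: s'(4) flip: power_mult_distrib)
  moreover have "s'' ^ ?N * r \<in> series (W 0)" "s'' ^ ?N * (- 1) ^ ?N * h ^ q \<in> series (W 0)"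
    using s' r swh by (auto intro!: mult power_closed uminus one)
  ultimately show ?thesis by blast
qed

section \<open>Krull dimension\<close>

lemma primeideal_rules:
  assumes "primeideal Q R"
  shows "ideal Q R" "Q \<subseteq> series P" "1 \<notin> Q"
    "\<And>f g. f \<in> series (W 0) \<Longrightarrow> g \<in> series (W 0) \<Longrightarrow> f * g \<in> Q \<Longrightarrow> f \<in> Q \<or> g \<in> Q"
    "\<And>f k. f \<in> series (W 0) \<Longrightarrow> f ^ k \<in> Q \<Longrightarrow> f \<in> Q"
    "0 \<in> Q" "\<And>f g. f \<in> Q \<Longrightarrow> g \<in> Q \<Longrightarrow> f + g \<in> Q" "\<And>f g. f \<in> Q \<Longrightarrow> g \<in> Q \<Longrightarrow> f - g \<in> Q"
    "\<And>c f. c \<in> series (W 0) \<Longrightarrow> f \<in> Q \<Longrightarrow> c * f \<in> Q"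
    "\<And>c f. c \<in> series (W 0) \<Longrightarrow> f \<in> Q \<Longrightarrow> f * c \<in> Q"
proof -
  interpret Q: primeideal Q R by (rule assms)
  show id: "ideal Q R" by (rule Q.ideal_axioms)
  note Q = id[unfolded ideal_iff]
  show QP: "Q \<subseteq> series P" using ideal_subset_P[OF id] Q.I_notcarr by auto
  then show no1: "1 \<notin> Q" using one_notin_P by blast
  show pr: "f \<in> Q \<or> g \<in> Q" if "f \<in> series (W 0)" "g \<in> series (W 0)" "f * g \<in> Q" for f g
    using Q.I_prime[of f g] that by simp
  show "f \<in> Q" if "f \<in> series (W 0)" "f ^ k \<in> Q" for f k
    using that(2) by (induction k) (use no1 pr[OF that(1) power_closed[OF that(1)]] in auto)
  show "0 \<in> Q" using Q by blast
  show add': "f + g \<in> Q" if "f \<in> Q" "g \<in> Q" for f g using Q that by blast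
  show mul: "c * f \<in> Q" if "c \<in> series (W 0)" "f \<in> Q" for c f using Q that by blast
  then show "f * c \<in> Q" if "c \<in> series (W 0)" "f \<in> Q" for c f using that by (simp add: mult.commute)
  show "f - g \<in> Q" if "f \<in> Q" "g \<in> Q" for f g
    using add'[OF that(1) mul[OF uminus[OF one] that(2)]] by simp
qed

text \<open>Let \<open>0 \<noteq> f \<in> Q1\<close> and \<open>g \<in> Q2 - Q1\<close>. By \<open>x_factor\<close>, \<open>Q1\<close> contains \<open>u\<close> or an element \<open>c\<close>
  that does not vanish on \<open>x = 0\<close>. In the first case \<open>g\<close> itself does not vanish there, since
  otherwise \<open>g\<^sup>n\<close> would be a multiple of \<open>u\<close> and \<open>g\<close> would lie in \<open>Q1\<close>; in the second case
  elimination gives \<open>u \<in> Q2\<close>. Either way \<open>Q2\<close> contains \<open>u\<close>, then \<open>v\<close>, and then by \<open>mod_x\<close> every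
  non-unit.\<close>
lemma prime_over_nonzero_is_maximal:
  assumes Q1: "primeideal Q1 R" and Q2: "primeideal Q2 R" and less: "Q1 \<subset> Q2"
    and f: "f \<in> Q1" "f \<noteq> 0"
  shows "Q2 = series P"
proof -
  note p1 = primeideal_rules[OF Q1] and p2 = primeideal_rules[OF Q2]
  have fR: "f \<in> series (W 0)" using f p1(2) P_subset by blast
  obtain g where g: "g \<in> Q2" "g \<notin> Q1" using less by blast
  have gR: "g \<in> series (W 0)" using g p2(2) P_subset by blast
  have w_in: "w \<in> Q" if "primeideal Q R" "u \<in> Q" "w \<in> series (W 0)" "h \<in> series (W 0)" "w ^ n = u * h" for Q w h
    using primeideal_rules(5)[OF that(1,3), of n] primeideal_rules(10)[OF that(1,4,2)] that(5) by simp
  obtain p c where pc: "c \<in> series (W 0)" "f ^ n = u ^ p * c" "at_x0 c \<noteq> 0"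
    using x_factor[OF fR f(2)] by blast
  have "f ^ n \<in> Q1"
  proof -
    have "f ^ n = f ^ (n - 1) * f" using n_pos by (metis Suc_diff_1 power_Suc2)
    then show ?thesis using p1(9)[OF power_closed[OF fR] f(1)] by simp
  qed
  then have "u ^ p \<in> Q1 \<or> c \<in> Q1"
    using p1(4)[OF power_closed[OF u_closed(3)] pc(1)] pc(2) by simp
  then have "\<exists>c\<in>Q2. at_x0 c \<noteq> 0 \<and> u \<in> Q2"
  proof
    assume "u ^ p \<in> Q1"
    then have u: "u \<in> Q1" using p1(5)[OF u_closed(3)] by blast
    have "at_x0 g \<noteq> 0"
    proof
      assume "at_x0 g = 0"
      then obtain w h where "w \<in> series (W 0)" "h \<in> series (W 0)" "g = w" "w ^ n = u * h"
        using mod_x[OF gR] by force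
      then show False using w_in[OF Q1 u] g(2) by blast
    qed
    then show ?thesis using g(1) u less by blast
  next
    assume c: "c \<in> Q1"
    obtain k e h q where *: "h \<in> series (W 0)" "q \<in> series (W 0)" "g ^ k * (u ^ e + g * h) = c * q"
      using elimination_R[OF pc(1,3) gR] by blast
    then have "g ^ k * (u ^ e + g * h) \<in> Q1" using p1(10)[OF _ c] by simp
    moreover have "g ^ k \<notin> Q1" using p1(5)[OF gR] g(2) by blast
    moreover have "u ^ e + g * h \<in> series (W 0)"
      by (intro add mult power_closed u_closed gR *(1))
    ultimately have "u ^ e + g * h \<in> Q1" using p1(4)[OF power_closed[OF gR]] by blast
    then have "u ^ e + g * h \<in> Q2" "g * h \<in> Q2" using less p2(10)[OF *(1) g(1)] by auto
    then have "(u ^ e + g * h) - g * h \<in> Q2" by (rule p2(8))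
    then have "u ^ e \<in> Q2" by simp
    then have "u \<in> Q2" by (rule p2(5)[OF u_closed(3)])
    then show ?thesis using c less pc(3) by blast
  qed
  then obtain c where c: "c \<in> Q2" "at_x0 c \<noteq> 0" "u \<in> Q2" by blast
  then have cR: "c \<in> series (W 0)" using p2(2) P_subset by blast
  obtain L \<alpha> \<beta> where "\<alpha> \<in> series (W 0)" "\<beta> \<in> series (W 0)" "v ^ L = \<alpha> * c + \<beta> * u ^ 1"
    using v_power_in_ideal[OF cR c(2), of 1] by blast
  then have "v ^ L \<in> Q2" using p2(7,9) c by simp
  then have v: "v \<in> Q2" by (rule p2(5)[OF u_closed(4)])
  have "series P \<subseteq> Q2"
  proof
    fix b :: "'k fps fps" assume b: "b \<in> series P"
    then have bR: "b \<in> series (W 0)" using P_subset by blast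
    obtain s w h where s: "s \<in> series (W 0)" "w \<in> series (W 0)" "h \<in> series (W 0)" "b = s + w" "w ^ n = u * h"
      and s': "s = 0 \<or> (\<exists>e. \<exists>s'\<in>series (W 0). s = v ^ e * s' \<and> e > 0)"
      using mod_x[OF bR] b by metis
    have "s \<in> Q2" using s'
    proof
      assume "\<exists>e. \<exists>s'\<in>series (W 0). s = v ^ e * s' \<and> e > 0"
      then obtain e s' where e: "s' \<in> series (W 0)" "s = v ^ e * s'" "e > 0" by blast
      then have "s = (v ^ (e - 1) * s') * v" by (cases e) (simp_all add: mult_ac)
      then show ?thesis using p2(9)[OF mult[OF power_closed[OF u_closed(4)] e(1)] v] by simp
    qed (simp add: p2(6))
    then show "b \<in> Q2" using w_in[OF Q2 c(3) s(2,3,5)] s(4) p2(7) by simp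
  qed
  with p2(2) show ?thesis by blast
qed

lemma primeidealI':
  assumes "ideal Q R" "1 \<notin> Q" "\<And>f g. f \<in> series (W 0) \<Longrightarrow> g \<in> series (W 0) \<Longrightarrow> f * g \<in> Q \<Longrightarrow> f \<in> Q \<or> g \<in> Q"
  shows "primeideal Q R"
  by (rule primeidealI[OF assms(1) cring_R]) (use assms one in auto)

text \<open>The chain of length two consists of \<open>0\<close>, the series vanishing on \<open>x = 0\<close>, and \<open>\<mm>\<close>.\<close>
theorem krull_dim_R: "krull_dim R = 2"
proof -
  let ?S = "{k. \<exists>Q :: nat \<Rightarrow> 'k fps fps set. (\<forall>i\<le>k. primeideal (Q i) R) \<and> (\<forall>i<k. Q i \<subset> Q (Suc i))}"
  have upper: "k \<le> 2" if k: "k \<in> ?S" for k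
  proof (rule ccontr)
    assume "\<not> k \<le> 2"
    moreover obtain Q :: "nat \<Rightarrow> 'k fps fps set"
      where Q: "\<forall>i\<le>k. primeideal (Q i) R" "\<forall>i<k. Q i \<subset> Q (Suc i)" using k by blast
    ultimately have pr: "primeideal (Q 0) R" "primeideal (Q 1) R" "primeideal (Q 2) R" "primeideal (Q 3) R"
      and lt: "Q 0 \<subset> Q 1" "Q 1 \<subset> Q 2" "Q 2 \<subset> Q 3"
      by (auto simp: numeral_2_eq_2 numeral_3_eq_3 simp del: psubset_eq)
    obtain f where "f \<in> Q 1" "f \<notin> Q 0" using lt(1) by blast
    then have "Q 2 = series P"
      using primeideal_rules(6)[OF pr(1)] by (intro prime_over_nonzero_is_maximal[OF pr(2,3) lt(2)]) auto
    then show False using primeideal_rules(2)[OF pr(4)] lt(3) by blast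
  qed
  have "2 \<in> ?S"
  proof -
    define Q1 :: "'k fps fps set" where "Q1 = {f \<in> series (W 0). at_x0 f = 0}"
    have at_add: "at_x0 (f + g) = at_x0 f + at_x0 g" for f g :: "'k fps fps" by (rule fps_ext) simp
    have at_0: "at_x0 (0 :: 'k fps fps) = 0" by (rule fps_ext) simp
    have p0: "primeideal {0} R"
      by (rule primeidealI') (auto simp: ideal_iff zero)
    have p1: "primeideal Q1 R"
      by (rule primeidealI') (auto simp: ideal_iff Q1_def zero add mult at_add at_0 at_x0_mult at_x0_1)
    have p2: "primeideal (series P) R"
    proof (rule primeidealI'[OF ideal_P one_notin_P])
      fix f g :: "'k fps fps" assume "f \<in> series (W 0)" "g \<in> series (W 0)" "f * g \<in> series P"
      then show "f \<in> series P \<or> g \<in> series P"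
        using in_series_P_iff[of f] in_series_P_iff[of g] in_series_P_iff[of "f * g"] mult[of f g]
        by (simp add: fps_mult_nth)
    qed
    have u: "u \<in> Q1" using n_pos u_closed(3) by (auto simp: Q1_def fps_eq_iff monom_xy_nth)
    have "u \<noteq> 0" by (rule monom_xy_neq_0)
    then have lt0: "{0} \<subset> Q1" using u primeideal_rules(6)[OF p1] by blast
    have "Q1 \<subseteq> series P" by (rule primeideal_rules(2)[OF p1])
    moreover have "v \<in> series P" "v \<notin> Q1"
      using n_pos n_in_W by (auto simp: invariant_exps_def zero_prod_def Q1_def fps_eq_iff monom_xy_nth)
    ultimately have lt1: "Q1 \<subset> series P" by blast
    let ?Q = "\<lambda>i::nat. if i = 0 then {0} else if i = 1 then Q1 else series P"
    have "\<forall>i\<le>2. primeideal (?Q i) R" using p0 p1 p2 by auto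
    moreover have "\<forall>i<2. ?Q i \<subset> ?Q (Suc i)" using lt0 lt1 by (auto simp: less_2_cases_iff)
    ultimately show ?thesis by (intro CollectI exI[of _ ?Q]) blast
  qed
  then have "Sup (enat ` ?S) = enat 2"
  proof (intro antisym Sup_least Sup_upper)
    fix x assume "x \<in> enat ` ?S"
    then obtain k where "x = enat k" "k \<in> ?S" by (rule imageE)
    then show "x \<le> enat 2" using upper[of k] by (simp only: enat_ord_simps)
  qed (rule imageI)
  then show ?thesis by (simp only: krull_dim_def numeral_eq_enat)
qed

end

section \<open>Depth\<close>

context cyclic_action
begin

lemma nonzerodivisor_quot_iff:
  assumes st: "stable E" and N: "submodule R N (series_module E)" and f: "f \<in> series (W 0)"
  shows "nonzerodivisor_on f (quot_module (series_module E) N) \<longleftrightarrow>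
    (\<forall>x\<in>series E. f * x \<in> N \<longrightarrow> x \<in> N)"
proof -
  have sub: "N \<subseteq> series E" using N by (simp add: submodule_def)
  note cl = N[unfolded submodule_iff[OF st sub]]
  have coset_N: "N +>\<^bsub>series_module E\<^esub> x = N \<longleftrightarrow> x \<in> N" for x
  proof
    have "0 + x \<in> N +>\<^bsub>series_module E\<^esub> x" using cl by (force simp: a_r_coset_def')
    then show "x \<in> N" if "N +>\<^bsub>series_module E\<^esub> x = N" using that by simp
    assume x: "x \<in> N"
    have "- x = - 1 * x" by simp
    then have "- x \<in> N" using cl x uminus[OF one] by metis
    then have "h \<in> N +>\<^bsub>series_module E\<^esub> x" if "h \<in> N" for h
      using that cl by (auto simp: a_r_coset_def' intro!: bexI[of _ "h + - x"])
    then show "N +>\<^bsub>series_module E\<^esub> x = N" using cl x by (auto simp: a_r_coset_def')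
  qed
  have smult: "f \<odot>\<^bsub>quot_module (series_module E) N\<^esub> (N +>\<^bsub>series_module E\<^esub> x) = N +>\<^bsub>series_module E\<^esub> (f * x)"
    if "x \<in> series E" for x
    using quot_module_smult_coset[OF module_series[OF st] N, of f x] that f by simp
  have carr: "carrier (quot_module (series_module E) N) = (\<lambda>x. N +>\<^bsub>series_module E\<^esub> x) ` series E"
    by (auto simp: quot_module_def A_RCOSETS_def')
  have zero: "\<zero>\<^bsub>quot_module (series_module E) N\<^esub> = N" by (simp add: quot_module_def)
  show ?thesis unfolding nonzerodivisor_on_def carr zero by (simp add: smult coset_N)
qed

text \<open>The submodule \<open>fM + gM\<close> of the module \<open>M\<close> of series supported on \<open>E\<close>.\<close>
definition gen2 :: "(nat \<times> nat) set \<Rightarrow> 'k fps fps \<Rightarrow> 'k fps fps \<Rightarrow> 'k fps fps set" where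
  "gen2 E f g = {f * x + g * y | x y. x \<in> series E \<and> y \<in> series E}"

lemma gen2_closed:
  assumes "stable E"
  shows "0 \<in> gen2 E f g"
    and "p \<in> gen2 E f g \<Longrightarrow> q \<in> gen2 E f g \<Longrightarrow> p + q \<in> gen2 E f g"
    and "c \<in> series (W 0) \<Longrightarrow> p \<in> gen2 E f g \<Longrightarrow> c * p \<in> gen2 E f g"
    and "x \<in> series E \<Longrightarrow> f * x \<in> gen2 E f g" "x \<in> series E \<Longrightarrow> g * x \<in> gen2 E f g"
    and "f \<in> series (W 0) \<Longrightarrow> g \<in> series (W 0) \<Longrightarrow> gen2 E f g \<subseteq> series E"
proof -
  show "0 \<in> gen2 E f g" unfolding gen2_def by (rule CollectI, rule exI[of _ 0], rule exI[of _ 0]) simp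
  show "p + q \<in> gen2 E f g" if pq: "p \<in> gen2 E f g" "q \<in> gen2 E f g"
  proof -
    obtain x y x' y' where "p = f * x + g * y" "q = f * x' + g * y'"
      "x \<in> series E" "y \<in> series E" "x' \<in> series E" "y' \<in> series E" using pq unfolding gen2_def by blast
    then show ?thesis unfolding gen2_def
      by (rule_tac CollectI, rule_tac exI[of _ "x + x'"], rule_tac exI[of _ "y + y'"])
        (simp add: series_add algebra_simps)
  qed
  show "c * p \<in> gen2 E f g" if cp: "c \<in> series (W 0)" "p \<in> gen2 E f g"
  proof -
    obtain x y where "p = f * x + g * y" "x \<in> series E" "y \<in> series E" using cp unfolding gen2_def by blast
    then show ?thesis using stableD[OF assms cp(1)] unfolding gen2_def
      by (rule_tac CollectI, rule_tac exI[of _ "c * x"], rule_tac exI[of _ "c * y"])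
        (simp add: distrib_left mult.left_commute)
  qed
  show "f * x \<in> gen2 E f g" if x: "x \<in> series E"
    unfolding gen2_def by (rule CollectI, rule exI[of _ x], rule exI[of _ 0]) (use x in simp)
  show "g * x \<in> gen2 E f g" if x: "x \<in> series E"
    unfolding gen2_def by (rule CollectI, rule exI[of _ 0], rule exI[of _ x]) (use x in simp)
  show "gen2 E f g \<subseteq> series E" if "f \<in> series (W 0)" "g \<in> series (W 0)"
    using that stableD[OF assms] by (auto simp: gen2_def intro!: series_add)
qed

lemma submodule_gen2:
  assumes "stable E" "f \<in> series (W 0)" "g \<in> series (W 0)"
  shows "submodule R (gen2 E f g) (series_module E)"
  using gen2_closed[OF assms(1)] assms by (simp add: submodule_iff)

text \<open>Allowing \<open>f\<close> or \<open>g\<close> to be zero covers the ideals with no, one and two generators at once.\<close>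
lemma ideal_smult_genideal:
  assumes st: "stable E" and fg: "f \<in> series (W 0)" "g \<in> series (W 0)"
    and X: "X \<subseteq> {f, g}" "f \<noteq> 0 \<Longrightarrow> f \<in> X" "g \<noteq> 0 \<Longrightarrow> g \<in> X"
  shows "ideal_smult R (Idl\<^bsub>R\<^esub> X) (series_module E) = gen2 E f g"
proof
  interpret cring R by (rule cring_R)
  let ?N = "gen2 E f g"
  note cl = gen2_closed[OF st, where f = f and g = g]
  let ?A = "{r \<in> series (W 0). \<forall>x\<in>series E. r * x \<in> ?N}"
  have "ideal ?A R" unfolding ideal_iff
    using cl by (auto simp: zero distrib_right mult.assoc intro: add mult)
  moreover have "X \<subseteq> ?A" using X(1) fg cl(4,5) by auto
  ultimately have IA: "Idl\<^bsub>R\<^esub> X \<subseteq> ?A" by (rule genideal_minimal)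
  then have I: "Idl\<^bsub>R\<^esub> X \<subseteq> series (W 0)" by blast
  show "ideal_smult R (Idl\<^bsub>R\<^esub> X) (series_module E) \<subseteq> ?N"
    using IA cl fg by (intro ideal_smult_subset[OF st I]) auto
  note cs = ideal_smult_closed[OF st I]
  have "X \<subseteq> Idl\<^bsub>R\<^esub> X" using X(1) fg by (intro genideal_self) auto
  then have gen: "r * x \<in> ideal_smult R (Idl\<^bsub>R\<^esub> X) (series_module E)" if "x \<in> series E" "r = f \<or> r = g" for r x
    using X(2,3) cs(1,3) that by (cases "r = 0") auto
  show "?N \<subseteq> ideal_smult R (Idl\<^bsub>R\<^esub> X) (series_module E)"
    using gen cs(4) by (auto simp: gen2_def)
qed

lemma monom_notin_gen2:
  assumes "t < n"
  shows "monom_xy t 0 \<notin> gen2 (W t) u v"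
proof
  assume "monom_xy t 0 \<in> gen2 (W t) u v"
  then obtain x y where "monom_xy t 0 = u * x + v * y" unfolding gen2_def by blast
  then have "(monom_xy t 0 :: 'k fps fps) $ 0 $ t = (u * x) $ 0 $ t + (v * y) $ 0 $ t" by simp
  then show False using assms by (simp only: monom_xy_nth monom_xy_mult_nth) simp
qed

lemma monom_in_W: "monom_xy t 0 \<in> series (W t)"
  by (simp add: weight_class_def)

lemma uv_in_P: "u \<in> series P" "v \<in> series P"
  using n_pos n_in_W by (auto simp: invariant_exps_def zero_prod_def)

lemma gen2_0: "gen2 E 0 0 = {0}" "gen2 E f 0 = {f * x | x. x \<in> series E}"
  by (auto simp: gen2_def intro: series_0 exI[of _ 0])

lemma regular_sequence_uv:
  assumes "t < n"
  shows "regular_sequence R (series_module (W t)) [u, v]"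
proof -
  let ?M = "series_module (W t) :: ('k fps fps, _) module"
  note smult = ideal_smult_genideal[OF stable_W]
  have uv: "u \<in> series (W 0)" "v \<in> series (W 0)" using uv_in_P P_subset by blast+
  have 0: "ideal_smult R (Idl\<^bsub>R\<^esub> {}) ?M = gen2 (W t) 0 0" by (rule smult) (auto simp: zero)
  have 1: "ideal_smult R (Idl\<^bsub>R\<^esub> {u}) ?M = gen2 (W t) u 0" by (rule smult) (auto simp: zero uv n_in_W)
  have 2: "ideal_smult R (Idl\<^bsub>R\<^esub> {u, v}) ?M = gen2 (W t) u v" by (rule smult) (auto simp: zero uv n_in_W)
  have "nonzerodivisor_on u (quot_module ?M (gen2 (W t) 0 0))"
    by (subst nonzerodivisor_quot_iff[OF stable_W submodule_gen2[OF stable_W zero zero] uv(1)])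
      (use monom_xy_neq_0[of n 0, where 'k = 'k] in \<open>simp add: gen2_0(1)\<close>)
  moreover have "nonzerodivisor_on v (quot_module ?M (gen2 (W t) u 0))"
  proof (subst nonzerodivisor_quot_iff[OF stable_W submodule_gen2[OF stable_W uv(1) zero] uv(2)], intro ballI impI)
    fix x :: "'k fps fps" assume x: "x \<in> series (W t)" and "v * x \<in> gen2 (W t) u 0"
    then obtain y where y: "v * x = u * y" by (auto simp: gen2_0)
    have "n \<le> i \<and> 0 \<le> j" if "x $ j $ i \<noteq> 0" for i j
    proof -
      have "x $ j $ i = (v * x) $ (j + n) $ i" by (simp add: monom_xy_mult_nth)
      then show ?thesis unfolding y using that by (auto simp: monom_xy_mult_nth split: if_splits)
    qed
    then show "x \<in> gen2 (W t) u 0"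
      using shift_factor_series[OF n_in_W(3) x] by (auto simp: gen2_0)
  qed
  moreover have "gen2 (W t) u v \<noteq> series (W t)" using monom_notin_gen2[OF assms] monom_in_W by blast
  ultimately show ?thesis
    unfolding regular_sequence_def using uv by (auto simp: 0 1 2 less_Suc_eq)
qed

end

context cyclic_quotient
begin

text \<open>The element \<open>f3\<close> is nilpotent on \<open>M\<^sub>t/(f1, f2)M\<^sub>t\<close>, so it can be regular there only if this
  module is zero. For the nilpotency it suffices that powers of \<open>u\<close> and of \<open>v\<close> annihilate this
  quotient. As in \<open>x_factor\<close>, \<open>f1\<^sup>n = u\<^sup>p c\<close>; regularity of \<open>f2\<close> modulo \<open>f1\<close> passes to \<open>f1\<^sup>n\<close> and
  from there to its factors. Regularity modulo \<open>c\<close> and elimination give the power of \<open>u\<close>. For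
  the power of \<open>v\<close>, an element that maps \<open>M\<^sub>t\<close> into \<open>(f1, f2)M\<^sub>t\<close> and does not vanish on \<open>x = 0\<close>
  is needed: this is \<open>c = f1\<^sup>n\<close> if \<open>p = 0\<close>, and \<open>f2\<close> if \<open>p > 0\<close>, because \<open>f2\<close> is then regular
  modulo \<open>u\<close>.\<close>
lemma no_regular_triple:
  assumes t: "t < n"
    and f1: "f1 \<in> series (W 0)" "f1 \<noteq> 0" and f2: "f2 \<in> series (W 0)" and f3: "f3 \<in> series P"
    and reg2: "\<And>x y. x \<in> series (W t) \<Longrightarrow> y \<in> series (W t) \<Longrightarrow> f2 * x = f1 * y \<Longrightarrow> \<exists>z\<in>series (W t). x = f1 * z"
    and reg3: "\<And>x. x \<in> series (W t) \<Longrightarrow> f3 * x \<in> gen2 (W t) f1 f2 \<Longrightarrow> x \<in> gen2 (W t) f1 f2"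
  shows "series (W t) \<subseteq> gen2 (W t) f1 f2"
proof -
  let ?M = "series (W t) :: 'k fps fps set"
  let ?S = "gen2 (W t) f1 f2"
  note st = stableD[OF stable_W]
  note S = gen2_closed[OF stable_W[of t], where f = f1 and g = f2]
  have u0: "u \<noteq> 0" by (rule monom_xy_neq_0)
  have uR: "u ^ k \<in> series (W 0)" for k by (rule power_closed[OF u_closed(3)])
  have vR: "v ^ k \<in> series (W 0)" for k by (rule power_closed[OF u_closed(4)])
  obtain p c where c: "c \<in> series (W 0)" "f1 ^ n = u ^ p * c" "at_x0 c \<noteq> 0"
    using x_factor[OF f1] by blast
  then have c0: "c \<noteq> 0" by (auto simp: fps_eq_iff)
  have f1n: "f1 ^ n = f1 * f1 ^ (n - 1)" using n_pos by (metis Suc_diff_1 power_Suc)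
  \<comment> \<open>\<open>f2\<close> is a nonzerodivisor on \<open>M\<^sub>t/dM\<^sub>t\<close>.\<close>
  define reg where "reg d \<longleftrightarrow> (\<forall>x\<in>?M. \<forall>y\<in>?M. f2 * x = d * y \<longrightarrow> (\<exists>z\<in>?M. x = d * z))" for d
  have reg_iter: "\<exists>z\<in>?M. x = d * z" if d: "reg d" and xy: "x \<in> ?M" "y \<in> ?M" "f2 ^ k * x = d * y" for d k x y
    using xy
  proof (induction k arbitrary: x y)
    case (Suc k)
    have "f2 * (f2 ^ k * x) = d * y" using Suc.prems(3) by (simp add: mult.assoc)
    moreover have "f2 ^ k * x \<in> ?M" by (intro st power_closed f2 Suc.prems)
    ultimately obtain z where "z \<in> ?M" "f2 ^ k * x = d * z"
      using d Suc.prems(2) unfolding reg_def by blast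
    then show ?case using Suc.IH Suc.prems(1) by blast
  qed auto
  have reg_cancel: "reg d" if b: "reg (b * d)" "b \<in> series (W 0)" "b \<noteq> 0" for b d
    unfolding reg_def
  proof (intro ballI impI)
    fix x y assume xy: "x \<in> ?M" "y \<in> ?M" "f2 * x = d * y"
    then have "f2 * (b * x) = (b * d) * y" by (metis mult.assoc mult.left_commute)
    then obtain z where "z \<in> ?M" "b * x = b * d * z"
      using b(1) st[OF b(2) xy(1)] xy(2) unfolding reg_def by blast
    then show "\<exists>z\<in>?M. x = d * z" using b(3) by (auto simp: mult.assoc)
  qed
  have reg_f1: "reg (f1 ^ k)" for k
  proof (induction k)
    case 0
    then show ?case by (simp add: reg_def)
  next
    case (Suc k)
    show ?case unfolding reg_def
    proof (intro ballI impI)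
      fix x y assume xy: "x \<in> ?M" "y \<in> ?M" "f2 * x = f1 ^ Suc k * y"
      then have "f2 * x = f1 ^ k * (f1 * y)" by (simp add: mult_ac)
      then obtain z where z: "z \<in> ?M" "x = f1 ^ k * z"
        using Suc xy st[OF f1(1) xy(2)] unfolding reg_def by blast
      then have "f1 ^ k * (f2 * z) = f1 ^ k * (f1 * y)" using \<open>f2 * x = f1 ^ k * (f1 * y)\<close> by (simp add: mult_ac)
      then have "f2 * z = f1 * y" using f1(2) by simp
      then obtain z' where "z' \<in> ?M" "z = f1 * z'" using reg2 z xy by blast
      then show "\<exists>z\<in>?M. x = f1 ^ Suc k * z" using z by (auto simp: mult_ac)
    qed
  qed
  have "reg c" using reg_cancel[of "u ^ p" c] reg_f1[of n] c(2) uR u0 by simp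
  obtain k e h q where el: "h \<in> series (W 0)" "q \<in> series (W 0)" "f2 ^ k * (u ^ e + f2 * h) = c * q"
    using elimination_R[OF c(1,3) f2] by blast
  define A where "A = p + e"
  have uA: "u ^ A * x \<in> ?S" if x: "x \<in> ?M" for x
  proof -
    have "f2 ^ k * ((u ^ e + f2 * h) * x) = c * (q * x)" using el(3) by (metis mult.assoc)
    moreover have "(u ^ e + f2 * h) * x \<in> ?M" by (intro st add mult uR f2 el x)
    ultimately obtain z where z: "z \<in> ?M" "(u ^ e + f2 * h) * x = c * z"
      using reg_iter[OF \<open>reg c\<close>] st[OF el(2) x] by blast
    have "u ^ A * x = u ^ p * ((u ^ e + f2 * h) * x) + f2 * (- (u ^ p * (h * x)))"
      by (simp add: A_def power_add algebra_simps)
    also have "u ^ p * ((u ^ e + f2 * h) * x) = f1 * (f1 ^ (n - 1) * z)"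
      unfolding z(2) using c(2) f1n by (metis mult.assoc)
    also have "f1 * (f1 ^ (n - 1) * z) + f2 * (- (u ^ p * (h * x))) \<in> ?S"
      by (intro S(2,4,5) st power_closed f1(1) z(1) series_uminus uR el x)
    finally show ?thesis .
  qed
  have "\<exists>b\<in>series (W 0). at_x0 b \<noteq> 0 \<and> (\<forall>x\<in>?M. b * x \<in> ?S)"
  proof (cases "p = 0")
    case True
    then have "c = f1 * f1 ^ (n - 1)" using c(2) f1n by simp
    then have "c * x = f1 * (f1 ^ (n - 1) * x)" for x by (simp only: mult.assoc)
    then have "\<forall>x\<in>?M. c * x \<in> ?S"
      using S(4)[OF st[OF power_closed[OF f1(1)]]] by (intro ballI) (simp only:)
    then show ?thesis using c by blast
  next
    case False
    have "at_x0 f2 \<noteq> 0"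
    proof
      assume "at_x0 f2 = 0"
      then obtain h where h: "h \<in> series (W 0)" "f2 ^ n = u * h" using mod_x[OF f2] by force
      have "f1 ^ n = (u ^ (p - 1) * c) * u" using c(2) False by (cases p) (simp_all add: mult_ac)
      then have "reg u"
        using reg_cancel[of "u ^ (p - 1) * c" u] reg_f1[of n] mult[OF uR c(1)] u0 c0 by simp
      have "f2 ^ n * monom_xy t 0 = u * (h * monom_xy t 0)" using h(2) by (simp add: mult.assoc)
      then obtain z where "monom_xy t 0 = u * z"
        using reg_iter[OF \<open>reg u\<close> monom_in_W st[OF h(1) monom_in_W]] by blast
      then have "(monom_xy t 0 :: 'k fps fps) $ 0 $ t = (u * z) $ 0 $ t" by simp
      then show False using t by (simp only: monom_xy_nth monom_xy_mult_nth) simp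
    qed
    then show ?thesis using f2 S(5) by blast
  qed
  then obtain b where b: "b \<in> series (W 0)" "at_x0 b \<noteq> 0" "\<forall>x\<in>?M. b * x \<in> ?S" by blast
  obtain L \<alpha> \<beta> where L: "\<alpha> \<in> series (W 0)" "\<beta> \<in> series (W 0)" "v ^ L = \<alpha> * b + \<beta> * u ^ A"
    using v_power_in_ideal[OF b(1,2)] by blast
  have vL: "v ^ L * x \<in> ?S" if x: "x \<in> ?M" for x
  proof -
    have "v ^ L * x = \<alpha> * (b * x) + \<beta> * (u ^ A * x)" unfolding L(3) by (simp add: algebra_simps)
    then show ?thesis using S(2,3) b(3) uA L x by simp
  qed
  \<comment> \<open>Every exponent of degree at least \<open>K\<close> lies above the exponent of \<open>u\<^sup>A\<close> or of \<open>v\<^sup>L\<close>.\<close>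
  define K where "K = n * A + n * L"
  have f3R: "f3 \<in> series (W 0)" using f3 P_subset by blast
  have f3_power: "f3 ^ k \<in> series (power_exps n a k 0)" for k
  proof (induction k)
    case (Suc k)
    then show ?case using series_mult[OF f3] by (simp add: power_exps_Suc)
  qed (simp add: power_exps_0 one)
  have f3K: "f3 ^ K * x \<in> ?S" if x: "x \<in> ?M" for x
  proof -
    let ?r = "restrict_series ({n * A..} \<times> UNIV) (f3 ^ K)"
    have fK: "f3 ^ K \<in> series (W 0)" by (rule power_closed[OF f3R])
    have r: "?r \<in> series (W 0)" using fK by (auto simp: series_def)
    have "n * A \<le> i \<and> 0 \<le> j" if "?r $ j $ i \<noteq> 0" for i j using that by (auto split: if_splits)
    then obtain h where h: "h \<in> series (W 0)" "?r = u ^ A * h"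
      using shift_factor_series[OF n_in_W(1)[of A] r] by (auto simp: monom_xy_power)
    have "0 \<le> i \<and> n * L \<le> j" if nz: "(f3 ^ K - ?r) $ j $ i \<noteq> 0" for i j
    proof -
      have "(f3 ^ K) $ j $ i \<noteq> 0" "i < n * A" using nz by (auto split: if_splits)
      moreover from this have "K \<le> i + j"
        using f3_power[of K] power_exps_degree[of i j n a K 0] by (auto simp: series_def)
      ultimately show ?thesis by (simp add: K_def)
    qed
    then obtain h' where h': "h' \<in> series (W 0)" "f3 ^ K - ?r = v ^ L * h'"
      using shift_factor_series[OF n_in_W(2)[of L] series_diff[OF fK r]]
      by (auto simp: monom_xy_power)
    have "f3 ^ K * x = ?r * x + (f3 ^ K - ?r) * x" by (simp add: algebra_simps)
    also have "\<dots> = u ^ A * (h * x) + v ^ L * (h' * x)" unfolding h'(2) unfolding h(2) by (simp add: mult.assoc)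
    also have "\<dots> \<in> ?S" by (intro S(2) uA vL st h h' x)
    finally show ?thesis .
  qed
  have "x \<in> ?S" if "x \<in> ?M" "f3 ^ k * x \<in> ?S" for k x
    using that(2)
  proof (induction k)
    case (Suc k)
    then show ?case using reg3[of "f3 ^ k * x"] st[OF power_closed[OF f3R] that(1)] by (simp add: mult.assoc)
  qed simp
  then show ?thesis using f3K by blast
qed

lemma regular_sequence_length_le:
  assumes t: "t < n" and fs: "regular_sequence R (series_module (W t)) fs" "set fs \<subseteq> series P"
  shows "length fs \<le> 2"
proof (rule ccontr)
  assume "\<not> length fs \<le> 2"
  then obtain f1 f2 f3 gs where fs_eq: "fs = f1 # f2 # f3 # gs"
    by (metis One_nat_def Suc_1 length_Cons list.size(3) neq_Nil_conv not_less_eq_eq le0 nat_le_linear Suc_le_mono)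
  let ?M = "series_module (W t) :: ('k fps fps, _) module"
  note smult = ideal_smult_genideal[OF stable_W]
  have P: "f1 \<in> series P" "f2 \<in> series P" "f3 \<in> series P" using fs(2) by (auto simp: fs_eq)
  then have f: "f1 \<in> series (W 0)" "f2 \<in> series (W 0)" "f3 \<in> series (W 0)" using P_subset by blast+
  have 0: "ideal_smult R (Idl\<^bsub>R\<^esub> {}) ?M = gen2 (W t) 0 0" by (rule smult) (auto simp: zero)
  have 1: "ideal_smult R (Idl\<^bsub>R\<^esub> {f1}) ?M = gen2 (W t) f1 0" by (rule smult) (auto simp: zero f)
  have 2: "ideal_smult R (Idl\<^bsub>R\<^esub> {f1, f2}) ?M = gen2 (W t) f1 f2" by (rule smult) (auto simp: zero f)
  note reg = fs(1)[unfolded regular_sequence_def]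
  have nz: "nonzerodivisor_on (fs ! i) (quot_module ?M (ideal_smult R (Idl\<^bsub>R\<^esub> (set (take i fs))) ?M))"
    if "i < length fs" for i using reg that by blast
  have n1: "nonzerodivisor_on f1 (quot_module ?M (gen2 (W t) 0 0))" using nz[of 0] by (simp add: fs_eq 0)
  have n2: "nonzerodivisor_on f2 (quot_module ?M (gen2 (W t) f1 0))" using nz[of 1] by (simp add: fs_eq 1)
  have n3: "nonzerodivisor_on f3 (quot_module ?M (gen2 (W t) f1 f2))" using nz[of 2] by (simp add: fs_eq 2)
  note iff = nonzerodivisor_quot_iff[OF stable_W submodule_gen2[OF stable_W]]
  have "f1 \<noteq> 0"
  proof
    assume "f1 = 0"
    then have "monom_xy t 0 \<in> gen2 (W t) 0 0"
      using n1[unfolded iff[OF zero zero f(1)]] monom_in_W by (simp add: gen2_0(1))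
    then show False using monom_xy_neq_0[of t 0, where 'k = 'k] by (simp add: gen2_0(1))
  qed
  have "series (W t) \<subseteq> gen2 (W t) f1 f2"
  proof (rule no_regular_triple[OF t f(1) \<open>f1 \<noteq> 0\<close> f(2) P(3)])
    fix x y :: "'k fps fps" assume "x \<in> series (W t)" "y \<in> series (W t)" "f2 * x = f1 * y"
    then show "\<exists>z\<in>series (W t). x = f1 * z"
      using n2[unfolded iff[OF f(1) zero f(2)]] by (auto simp: gen2_0)
  next
    fix x :: "'k fps fps" assume "x \<in> series (W t)" "f3 * x \<in> gen2 (W t) f1 f2"
    then show "x \<in> gen2 (W t) f1 f2" using n3[unfolded iff[OF f(1,2,3)]] by blast
  qed
  moreover have "gen2 (W t) f1 f2 \<subseteq> ideal_smult R (Idl\<^bsub>R\<^esub> (set fs)) ?M"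
    "ideal_smult R (Idl\<^bsub>R\<^esub> (set fs)) ?M \<subseteq> series (W t)"
  proof -
    interpret cring R by (rule cring_R)
    have "set fs \<subseteq> series (W 0)" using fs(2) P_subset by blast
    then have "set fs \<subseteq> Idl\<^bsub>R\<^esub> (set fs)" "Idl\<^bsub>R\<^esub> (set fs) \<subseteq> series (W 0)"
      using genideal_self[of "set fs"] ideal.Icarr[OF genideal_ideal[of "set fs"]] by auto
    note cl = ideal_smult_closed[OF stable_W this(2)] and this(1)
    then show "gen2 (W t) f1 f2 \<subseteq> ideal_smult R (Idl\<^bsub>R\<^esub> (set fs)) ?M"
      by (auto simp: gen2_def fs_eq)
    show "ideal_smult R (Idl\<^bsub>R\<^esub> (set fs)) ?M \<subseteq> series (W t)" by (rule cl(2))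
  qed
  ultimately show False using reg by auto
qed

theorem depth_M:
  assumes "t < n"
  shows "depth R (series_module (W t)) = 2"
proof -
  let ?S = "{fs. regular_sequence R (series_module (W t)) fs \<and> set fs \<subseteq> max_ideal R}"
  have "[u, v] \<in> ?S" using regular_sequence_uv[OF assms] uv_in_P by (simp add: max_ideal_R)
  then have "enat 2 \<le> Sup ((\<lambda>fs. enat (length fs)) ` ?S)"
    by (intro Sup_upper image_eqI[of _ _ "[u, v]"]) simp_all
  moreover have "Sup ((\<lambda>fs. enat (length fs)) ` ?S) \<le> enat 2"
    using regular_sequence_length_le[OF assms] by (intro Sup_least) (auto simp: max_ideal_R)
  ultimately show ?thesis by (simp add: depth_def numeral_eq_enat)
qed

theorem maximal_Cohen_Macaulay_M: "t < n \<Longrightarrow> maximal_Cohen_Macaulay R (series_module (W t))"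
  by (simp add: maximal_Cohen_Macaulay_def depth_M krull_dim_R module_series stable_W
      finitely_generated_series fg_W)

end

section \<open>Ulrich modules\<close>

theorem theorem1p2:
  fixes \<zeta> :: "'k::alg_closed_field" and n a t :: nat and \<alpha>s :: "int list"
  assumes "1 \<le> a" and "a \<le> n - 1" and "coprime a n"
    and "of_nat n \<noteq> (0 :: 'k)"
    and "primitive_root_of_unity n \<zeta>"
    and "\<alpha>s \<noteq> []" and "\<forall>\<alpha>\<in>set \<alpha>s. \<alpha> \<ge> 2"
    and "of_nat n / of_nat a = HJ_fraction \<alpha>s"
    and "t \<in> {0..n - 1}"
  shows "Ulrich field_k (ring_R \<zeta> a) (module_M n \<zeta> a t) \<longleftrightarrow>
    real_of_int (\<Sum>u = 1..length \<alpha>s. div_quot (i_seq n a \<alpha>s) t u) =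
      ring_multiplicity (ring_R \<zeta> a) - 1"
proof -
  have "a < n" and t: "t < n" using assms by auto
  interpret HJ_expansion n a \<alpha>s by unfold_locales (use assms \<open>a < n\<close> in auto)
  interpret cyclic_quotient n a \<zeta> by unfold_locales (use assms in auto)
  have "Ulrich field_k (ring_R \<zeta> a) (module_M n \<zeta> a t) \<longleftrightarrow>
      real (card (min_exps n a t)) = ring_multiplicity (ring_R \<zeta> a)"
    unfolding Ulrich_def ring_multiplicity_def ring_as_module_R module_M_eq
    unfolding ring_R_eq
    by (simp add: maximal_Cohen_Macaulay_M[OF t] min_num_generators_M multiplicity_M[OF krull_dim_R t])
  moreover have "real (card (min_exps n a t)) =
      1 + real_of_int (\<Sum>u = 1..length \<alpha>s. div_quot (i_seq n a \<alpha>s) t u)"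
    using card_min_exps[OF t] by (metis of_int_1 of_int_add of_int_of_nat_eq)
  ultimately show ?thesis by (simp add: algebra_simps)
qed

end
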